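(* Let $A$ be a local domain with quotient field $K$, and let $v_0$ be a valuation of $K$ which dominates $A$. Suppose that $f(x)\in A[x]$ is monic and irreducible in $K[x]$, that the characteristic $p$ of the residue field of $A$ does not divide $\deg f$, and that there is a unique extension $v$ of $v_0$ to the quotient field $K[x]/(f(x))$ of $A[x]/(f(x))$. Then there exists a finite sequence of inductive values $v_1,\ldots,v_n$ extending $v_0$ to $K[x]$, with respective associated key polynomials $\phi_1=x,\phi_2,\ldots,\phi_n=f$, all lying in $A[x]$, such that $v_k=[v_{k-1};v_k(\phi_k)=v(\phi_k)]$ for $1\le k\le n$ and $v$ is induced by the pseudo valuation $v_n$, and such that the following holds. Let $\overline\phi_i$ be the initial form of (the class of) $\phi_i$ in ${\rm gr}_v(A[x]/(f(x)))$ and let $m_i=\deg\phi_{i+1}/\deg\phi_i$ (a positive integer) for $1\le i\le n-1$. Then there are homogeneous elements $\overline c_{i,j_1,\ldots,j_{i-1},k}\in{\rm gr}_{v_0}(A)$ (for $1\le i\le n-1$, $0\le j_l<m_l$ for $1\le l\le i-1$, $0\le k<m_i$) such that the homomorphism of graded ${\rm gr}_{v_0}(A)$-algebras $${\rm gr}_{v_0}(A)[X_1,\ldots,X_{n-1}]\to{\rm gr}_v(A[x]/(f(x))),\qquad X_i\mapsto\overline\phi_i,$$ where $X_i$ has degree $v(\phi_i)$, is surjective with kernel $$I=\Big(X_i^{m_i}+\sum_{j_1,\ldots,j_{i-1},k}\overline c_{i,j_1,\ldots,j_{i-1},k}\,X_1^{j_1}\cdots X_{i-1}^{j_{i-1}}X_i^k\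 :\ 1\le i\le n-1\Big),$$ each of these generators being homogeneous; that is, it induces a graded isomorphism ${\rm gr}_v(A[x]/(f(x)))\cong{\rm gr}_{v_0}(A)[X_1,\ldots,X_{n-1}]/I$.
   Context: A local ring is a commutative ring with a unique maximal ideal (not necessarily Noetherian); $m_A$ denotes the maximal ideal of $A$. Valuations are Krull valuations of arbitrary rank, written additively. The valuation ring of $v_0$ is $\mathcal O_{v_0}$, with maximal ideal $m_{v_0}$; $v_0$ dominates $A$ if $A\subset\mathcal O_{v_0}$ and $m_{v_0}\cap A=m_A$. Associated graded rings. For a valuation $w$ of a field $F$ with value group $wF$ and a subring $R$ of $F$, ${\rm gr}_w(R)=\bigoplus_{\gamma\in wF}\mathcal P_\gamma(R)/\mathcal P_\gamma^+(R)$, where $\mathcal P_\gamma(R)=\{g\in R\mid w(g)\ge\gamma\}$ and $\mathcal P^+_\gamma(R)=\{g\in R\mid w(g)>\gamma\}$ (with $w(0)=\infty$). The initial form of a nonzero $g\in R$ is its class in $\mathcal P_{w(g)}(R)/\mathcal P_{w(g)}^+(R)$, homogeneous of degree $w(g)$. The ring ${\rm gr}_v(A[x]/(f(x)))$ is a graded ${\rm gr}_{v_0}(A)$-algebra via the inclusion $A\subset A[x]/(f(x))$. A pseudo valuation $w$ on a domain $R$ is a surjective map $w:R\to G_w\cup\{\infty\}$, with $G_w$ a totally ordered abelian group, such that $I(w)_\infty=\{g\in R\mid w(g)=\infty\}$ is a prime ideal of $R$ and $w$ induces a valuation of the quotient field of $R/I(w)_\infty$. The valuation $v$ of $K[x]/(f(x))$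 is identified with the pseudo valuation of $K[x]$ obtained by composing with $K[x]\to K[x]/(f(x))$; so $v(g)$ makes sense for $g\in K[x]$, and $v(g)=\infty$ exactly when $f\mid g$. Let $w$ be a valuation or pseudo valuation on $K[x]$. For $g,h\in K[x]$ write $g\sim_w h$ (equivalent in $w$) if $w(g-h)>\min\{w(g),w(h)\}$ or $w(g)=w(h)=\infty$. Write $h|_w g$ ($g$ is equivalence divisible by $h$ in $w$) if there is $a\in K[x]$ with $g\sim_w ah$. An element $g$ is equivalence irreducible in $w$ if $g|_w ab$ implies $g|_w a$ or $g|_w b$. Inductive values (MacLane). The first one is $v_1=[v_0;v_1(\phi_1)=\mu_1]$ with $\phi_1=x$, given by $v_1(\sum a_ix^i)=\min_i\{v_0(a_i)+i\mu_1\}$. For $k\ge 2$, $v_k=[v_{k-1};v_k(\phi_k)=\mu_k]$ is defined as follows, where $\phi_k$ is a key polynomial over $v_{k-1}$ with key value $\mu_k$: if $g=g_m\phi_k^m+\cdots+g_0$ is the unique expansion with $g_i\in K[x]$ and $\deg g_i<\deg\phi_k$, then $v_k(g)=\min_i\{v_{k-1}(g_i)+i\mu_k\}$. The value $\mu_k=\infty$ is allowed at the last step, in which case $v_k$ is a pseudo valuation with $I(v_k)_\infty=(\phi_k)$. The values $\mu_k$ lie in $\{\infty\}$ or in a totally ordered abelian group containing the value group of $v_0$ (here the value group of $v$). For $k\ge 2$, $\phi_k\in K[x]$ is a key polynomial with key value $\mu_k$ over $v_{k-1}$ if: (1) $\phi_k$ is equivalence irreducible in $v_{k-1}$; (2)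 $\phi_k$ is minimal in $v_{k-1}$, i.e. if $\phi_k|_{v_{k-1}}g$ with $g\neq 0$ then $\deg\phi_k\le\deg g$; (3) $\phi_k$ is monic of positive degree; (4) $\mu_k>v_{k-1}(\phi_k)$; (5) $\deg\phi_k\ge\deg\phi_{k-1}$; (6) $\phi_k\sim_{v_{k-1}}\phi_{k-1}$ is false. (It is known that $\deg\phi_{k-1}$ divides $\deg\phi_k$.) *)

theory Defs
  imports
    "HOL-Algebra.Subrings"
    "HOL-Algebra.Product_Groups"
    "HOL-Decision_Procs.Algebra_Aux"
    "HOL-Computational_Algebra.Polynomial_Factorial"
begin

section \<open>Ordered groups with an infinite element\<close>

datatype 'g ext_value = Fin (fin_part: 'g) | Infty

instantiation ext_value :: (linorder) linorder
begin

definition less_eq_ext_value :: "'a ext_value \<Rightarrow> 'a ext_value \<Rightarrow> bool" where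
  "x \<le> y \<longleftrightarrow>
    (case y of Infty \<Rightarrow> True | Fin b \<Rightarrow> (case x of Infty \<Rightarrow> False | Fin a \<Rightarrow> a \<le> b))"

definition less_ext_value :: "'a ext_value \<Rightarrow> 'a ext_value \<Rightarrow> bool" where
  "x < y \<longleftrightarrow>
    (case x of Infty \<Rightarrow> False | Fin a \<Rightarrow> (case y of Infty \<Rightarrow> True | Fin b \<Rightarrow> a < b))"

instance
  by standard
    (auto simp: less_eq_ext_value_def less_ext_value_def split: ext_value.splits)

end

instantiation ext_value :: (comm_monoid_add) comm_monoid_add
begin

definition zero_ext_value :: "'a ext_value" where
  "0 = Fin 0"

definition plus_ext_value :: "'a ext_value \<Rightarrow> 'a ext_value \<Rightarrow> 'a ext_value" where
  "x + y =
    (case x of Infty \<Rightarrow> Infty | Fin a \<Rightarrow> (case y of Infty \<Rightarrow> Infty | Fin b \<Rightarrow> Fin (a + b)))"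

instance
  by standard
    (auto simp: zero_ext_value_def plus_ext_value_def ac_simps split: ext_value.splits)

end

instance ext_value :: ("{linorder, ordered_comm_monoid_add}") ordered_comm_monoid_add
  by standard
    (auto simp: less_eq_ext_value_def plus_ext_value_def add_left_mono split: ext_value.splits)

text \<open>The convention \<open>0 \<cdot> \<infinity> = 0\<close> is the one needed for pseudo valuations.\<close>

definition nat_mult :: "nat \<Rightarrow> 'a::comm_monoid_add \<Rightarrow> 'a" where
  "nat_mult i \<mu> = (\<Sum>_<i. \<mu>)"


section \<open>Local rings\<close>

definition local_ring :: "('a, 'm) ring_scheme \<Rightarrow> bool" where
  "local_ring R \<longleftrightarrow> cring R \<and> (\<exists>!M. maximalideal M R)"

definition max_ideal :: "('a, 'm) ring_scheme \<Rightarrow> 'a set" where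
  "max_ideal R = (THE M. maximalideal M R)"

definition residue_field :: "('a, 'm) ring_scheme \<Rightarrow> 'a set ring" where
  "residue_field R = R Quot (max_ideal R)"

text \<open>The library defines the order of an element of infinite order to be \<open>0\<close>.\<close>

definition ring_characteristic :: "('a, 'm) ring_scheme \<Rightarrow> nat" where
  "ring_characteristic R = group.ord (add_monoid R) \<one>\<^bsub>R\<^esub>"

text \<open>The quotient field of \<open>A\<close> is a type \<open>'k\<close> of class \<^class>\<open>field\<close>, and \<open>A\<close> is a subset of it.\<close>

definition local_domain_of :: "'k::field set \<Rightarrow> bool" where
  "local_domain_of A \<longleftrightarrow>
     subring A (cring_class_ops :: 'k ring) \<and>
     local_ring ((cring_class_ops :: 'k ring)\<lparr>carrier := A\<rparr>) \<and>
     (\<forall>x. \<exists>a\<in>A. \<exists>b\<in>A - {0}. x = a / b)"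


section \<open>Valuations\<close>

definition valuation :: "('a, 'm) ring_scheme \<Rightarrow> ('a \<Rightarrow> 'g::linordered_ab_group_add ext_value) \<Rightarrow> bool"
  where
  "valuation F w \<longleftrightarrow>
     field F \<and>
     (\<forall>a\<in>carrier F. w a = Infty \<longleftrightarrow> a = \<zero>\<^bsub>F\<^esub>) \<and>
     (\<forall>a\<in>carrier F. \<forall>b\<in>carrier F. w (a \<otimes>\<^bsub>F\<^esub> b) = w a + w b) \<and>
     (\<forall>a\<in>carrier F. \<forall>b\<in>carrier F. min (w a) (w b) \<le> w (a \<oplus>\<^bsub>F\<^esub> b))"

definition value_group :: "('a, 'm) ring_scheme \<Rightarrow> ('a \<Rightarrow> 'g ext_value) \<Rightarrow> 'g set" where
  "value_group F w = {\<gamma>. Fin \<gamma> \<in> w ` carrier F}"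

definition dominates ::
  "('a, 'm) ring_scheme \<Rightarrow> ('a \<Rightarrow> 'g::linordered_ab_group_add ext_value) \<Rightarrow> 'a set \<Rightarrow> bool" where
  "dominates F w A \<longleftrightarrow>
     A \<subseteq> {x \<in> carrier F. 0 \<le> w x} \<and>
     {x \<in> carrier F. 0 < w x} \<inter> A = max_ideal (F\<lparr>carrier := A\<rparr>)"

text \<open>
  Uniqueness of an extension has to range over valuations with arbitrary value groups, not only over
  those with values in \<open>'g\<close>. Hence the following version of a valuation, on the nonzero elements, with
  values in an ordered abelian group that is given by an explicit carrier and order relation.
\<close>

definition ordered_abelian_group :: "('b, 'm) monoid_scheme \<Rightarrow> 'b rel \<Rightarrow> bool" where
  "ordered_abelian_group G r \<longleftrightarrow>
     comm_group G \<and> linear_order_on (carrier G) r \<and>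
     (\<forall>a\<in>carrier G. \<forall>b\<in>carrier G. \<forall>c\<in>carrier G.
        (a, b) \<in> r \<longrightarrow> (a \<otimes>\<^bsub>G\<^esub> c, b \<otimes>\<^bsub>G\<^esub> c) \<in> r)"

definition carrier_valuation ::
  "('a, 'm) ring_scheme \<Rightarrow> ('b, 'n) monoid_scheme \<Rightarrow> 'b rel \<Rightarrow> ('a \<Rightarrow> 'b) \<Rightarrow> bool" where
  "carrier_valuation F G r w \<longleftrightarrow>
     field F \<and> ordered_abelian_group G r \<and>
     w \<in> carrier F - {\<zero>\<^bsub>F\<^esub>} \<rightarrow> carrier G \<and>
     (\<forall>a\<in>carrier F - {\<zero>\<^bsub>F\<^esub>}. \<forall>b\<in>carrier F - {\<zero>\<^bsub>F\<^esub>}.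
        w (a \<otimes>\<^bsub>F\<^esub> b) = w a \<otimes>\<^bsub>G\<^esub> w b \<and>
        (a \<oplus>\<^bsub>F\<^esub> b \<noteq> \<zero>\<^bsub>F\<^esub> \<longrightarrow> (w a, w (a \<oplus>\<^bsub>F\<^esub> b)) \<in> r \<or> (w b, w (a \<oplus>\<^bsub>F\<^esub> b)) \<in> r))"

text \<open>
  Here \<open>\<iota>\<close> embeds \<open>F\<close> into \<open>E\<close>. As usual, valuations are identified when they are equivalent, i.e.
  when they order the nonzero elements in the same way. The value group of any valuation of \<open>E\<close> is
  the group of nonzero elements of \<open>E\<close> modulo the units of the valuation ring, so it can be realised
  on a set of cosets in \<open>E\<close>: no valuation is lost by taking the elements of \<open>G\<close> to be sets of elements
  of \<open>E\<close>.
\<close>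

definition unique_extension ::
  "('a, 'm) ring_scheme \<Rightarrow> ('a \<Rightarrow> 'g::linordered_ab_group_add ext_value) \<Rightarrow>
   ('b, 'n) ring_scheme \<Rightarrow> ('a \<Rightarrow> 'b) \<Rightarrow> ('b \<Rightarrow> 'g ext_value) \<Rightarrow> bool" where
  "unique_extension F v0 E \<iota> v \<longleftrightarrow>
     valuation E v \<and> (\<forall>a\<in>carrier F. v (\<iota> a) = v0 a) \<and>
     (\<forall>(G :: 'b set monoid) r w.
        carrier_valuation E G r w \<and>
        (\<forall>a\<in>carrier F - {\<zero>\<^bsub>F\<^esub>}. \<forall>b\<in>carrier F - {\<zero>\<^bsub>F\<^esub>}.
           (w (\<iota> a), w (\<iota> b)) \<in> r \<longleftrightarrow> v0 a \<le> v0 b) \<longrightarrow>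
        (\<forall>x\<in>carrier E - {\<zero>\<^bsub>E\<^esub>}. \<forall>y\<in>carrier E - {\<zero>\<^bsub>E\<^esub>}.
           (w x, w y) \<in> r \<longleftrightarrow> v x \<le> v y))"


section \<open>The field \<open>K[x]/(f)\<close>\<close>

definition polys_over :: "'k::zero set \<Rightarrow> 'k poly set" where
  "polys_over A = {g. \<forall>i. Polynomial.coeff g i \<in> A}"

definition quot_field :: "'k::field poly \<Rightarrow> 'k poly set ring" where
  "quot_field f = cring_class_ops Quot (PIdl\<^bsub>cring_class_ops\<^esub> f)"

definition cls :: "'k::field poly \<Rightarrow> 'k poly \<Rightarrow> 'k poly set" where
  "cls f g = (PIdl\<^bsub>cring_class_ops\<^esub> f) +>\<^bsub>cring_class_ops\<^esub> g"

text \<open>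
  For monic \<open>f\<close> with coefficients in \<open>A\<close> the map from \<open>A[x]/(f)\<close> to \<open>K[x]/(f)\<close> is injective;
  \<open>A[x]/(f)\<close> is its image.
\<close>

definition quot_subring :: "'k::field set \<Rightarrow> 'k poly \<Rightarrow> 'k poly set set" where
  "quot_subring A f = cls f ` polys_over A"


section \<open>Inductive values\<close>

definition equivalent_in :: "('k::field poly \<Rightarrow> 'g::linorder ext_value) \<Rightarrow> 'k poly \<Rightarrow> 'k poly \<Rightarrow> bool"
  where
  "equivalent_in w g h \<longleftrightarrow> w (g - h) > min (w g) (w h) \<or> (w g = Infty \<and> w h = Infty)"

definition equiv_dvd :: "('k::field poly \<Rightarrow> 'g::linorder ext_value) \<Rightarrow> 'k poly \<Rightarrow> 'k poly \<Rightarrow> bool"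
  where
  "equiv_dvd w h g \<longleftrightarrow> (\<exists>a. equivalent_in w g (a * h))"

definition equiv_irreducible :: "('k::field poly \<Rightarrow> 'g::linorder ext_value) \<Rightarrow> 'k poly \<Rightarrow> bool" where
  "equiv_irreducible w g \<longleftrightarrow>
     (\<forall>a b. equiv_dvd w g (a * b) \<longrightarrow> equiv_dvd w g a \<or> equiv_dvd w g b)"

definition minimal_in :: "('k::field poly \<Rightarrow> 'g::linorder ext_value) \<Rightarrow> 'k poly \<Rightarrow> bool" where
  "minimal_in w \<phi> \<longleftrightarrow>
     (\<forall>g. g \<noteq> 0 \<and> equiv_dvd w \<phi> g \<longrightarrow> Polynomial.degree \<phi> \<le> Polynomial.degree g)"

definition key_polynomial ::
  "('k::field poly \<Rightarrow> 'g::linorder ext_value) \<Rightarrow> 'k poly \<Rightarrow> 'k poly \<Rightarrow> 'g ext_value \<Rightarrow> bool" where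
  "key_polynomial w \<phi>' \<phi> \<mu> \<longleftrightarrow>
     equiv_irreducible w \<phi> \<and>
     minimal_in w \<phi> \<and>
     Polynomial.lead_coeff \<phi> = 1 \<and> Polynomial.degree \<phi> > 0 \<and>
     \<mu> > w \<phi> \<and>
     Polynomial.degree \<phi> \<ge> Polynomial.degree \<phi>' \<and>
     \<not> equivalent_in w \<phi> \<phi>'"

definition first_value ::
  "('k::field \<Rightarrow> 'g::linordered_ab_group_add ext_value) \<Rightarrow> 'g ext_value \<Rightarrow> 'k poly \<Rightarrow> 'g ext_value"
  where
  "first_value v0 \<mu> g =
     Min ((\<lambda>i. v0 (Polynomial.coeff g i) + nat_mult i \<mu>) ` {..Polynomial.degree g})"

text \<open>The \<open>\<phi>\<close>-adic expansion of \<open>g\<close>, as a polynomial in \<open>\<phi>\<close> with polynomial coefficients.\<close>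

definition phi_expansion :: "'k::field poly \<Rightarrow> 'k poly \<Rightarrow> 'k poly poly" where
  "phi_expansion \<phi> g =
     (THE e. (\<forall>i. Polynomial.degree (Polynomial.coeff e i) < Polynomial.degree \<phi>) \<and> poly e \<phi> = g)"

definition augmented_value ::
  "('k::field poly \<Rightarrow> 'g::linordered_ab_group_add ext_value) \<Rightarrow> 'k poly \<Rightarrow> 'g ext_value \<Rightarrow>
   'k poly \<Rightarrow> 'g ext_value" where
  "augmented_value w \<phi> \<mu> g =
     (let e = phi_expansion \<phi> g
      in Min ((\<lambda>i. w (Polynomial.coeff e i) + nat_mult i \<mu>) ` {..Polynomial.degree e}))"

text \<open>
  \<open>V 1, \<dots>, V n\<close> are successive inductive values with key polynomials \<open>\<phi> 1, \<dots>, \<phi> n\<close> and key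
  values \<open>\<mu> 1, \<dots>, \<mu> n\<close>. The value \<open>\<mu> n = \<infinity>\<close> is allowed also for \<open>n = 1\<close>; this is needed
  when \<open>f = x\<close>.
\<close>

definition inductive_values ::
  "('k::field \<Rightarrow> 'g::linordered_ab_group_add ext_value) \<Rightarrow> nat \<Rightarrow> (nat \<Rightarrow> 'k poly) \<Rightarrow>
   (nat \<Rightarrow> 'g ext_value) \<Rightarrow> (nat \<Rightarrow> 'k poly \<Rightarrow> 'g ext_value) \<Rightarrow> bool" where
  "inductive_values v0 n \<phi> \<mu> V \<longleftrightarrow>
     1 \<le> n \<and>
     \<phi> 1 = [:0, 1:] \<and> V 1 = first_value v0 (\<mu> 1) \<and>
     (\<forall>k\<in>{2..n}. key_polynomial (V (k - 1)) (\<phi> (k - 1)) (\<phi> k) (\<mu> k) \<and>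
                 V k = augmented_value (V (k - 1)) (\<phi> k) (\<mu> k)) \<and>
     (\<forall>k\<in>{1..<n}. \<mu> k \<noteq> Infty)"


section \<open>Associated graded rings\<close>

definition P_ge ::
  "('a \<Rightarrow> 'g::linordered_ab_group_add ext_value) \<Rightarrow> 'a set \<Rightarrow> 'g \<Rightarrow> 'a set" where
  "P_ge w R \<gamma> = {g \<in> R. Fin \<gamma> \<le> w g}"

definition P_gt ::
  "('a \<Rightarrow> 'g::linordered_ab_group_add ext_value) \<Rightarrow> 'a set \<Rightarrow> 'g \<Rightarrow> 'a set" where
  "P_gt w R \<gamma> = {g \<in> R. Fin \<gamma> < w g}"

definition gr_piece ::
  "('a, 'm) ring_scheme \<Rightarrow> ('a \<Rightarrow> 'g::linordered_ab_group_add ext_value) \<Rightarrow> 'a set \<Rightarrow> 'g \<Rightarrow>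
   'a set monoid" where
  "gr_piece F w R \<gamma> = ((add_monoid F)\<lparr>carrier := P_ge w R \<gamma>\<rparr>) Mod (P_gt w R \<gamma>)"

definition initial_form ::
  "('a, 'm) ring_scheme \<Rightarrow> ('a \<Rightarrow> 'g::linordered_ab_group_add ext_value) \<Rightarrow> 'a set \<Rightarrow> 'a \<Rightarrow>
   'g \<Rightarrow> 'a set" where
  "initial_form F w R g =
     (\<lambda>\<gamma>\<in>value_group F w. if w g = Fin \<gamma> then P_gt w R \<gamma> +>\<^bsub>F\<^esub> g else P_gt w R \<gamma>)"

text \<open>
  The product of the classes of \<open>x\<close> and \<open>y\<close> in degrees \<open>\<alpha>\<close> and \<open>\<beta>\<close> is the class of \<open>xy\<close> in degree
  \<open>\<alpha> + \<beta>\<close>; the groups \<^const>\<open>gr_piece\<close> are written multiplicatively.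
\<close>

definition gr_mult ::
  "('a, 'm) ring_scheme \<Rightarrow> ('a \<Rightarrow> 'g::linordered_ab_group_add ext_value) \<Rightarrow> 'a set \<Rightarrow>
   ('g \<Rightarrow> 'a set) \<Rightarrow> ('g \<Rightarrow> 'a set) \<Rightarrow> 'g \<Rightarrow> 'a set" where
  "gr_mult F w R a b =
     (\<lambda>\<gamma>\<in>value_group F w.
        finprod (gr_piece F w R \<gamma>)
          (\<lambda>\<alpha>. rcoset_mult F (P_gt w R \<gamma>) (a \<alpha>) (b (\<gamma> - \<alpha>)))
          {\<alpha> \<in> value_group F w. a \<alpha> \<noteq> \<one>\<^bsub>gr_piece F w R \<alpha>\<^esub>})"

definition gr ::
  "('a, 'm) ring_scheme \<Rightarrow> ('a \<Rightarrow> 'g::linordered_ab_group_add ext_value) \<Rightarrow> 'a set \<Rightarrow>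
   ('g \<Rightarrow> 'a set) ring" where
  "gr F w R =
     \<lparr>carrier = carrier (sum_group (value_group F w) (gr_piece F w R)),
      monoid.mult = gr_mult F w R,
      one = initial_form F w R \<one>\<^bsub>F\<^esub>,
      zero = \<one>\<^bsub>sum_group (value_group F w) (gr_piece F w R)\<^esub>,
      add = (\<otimes>\<^bsub>sum_group (value_group F w) (gr_piece F w R)\<^esub>)\<rparr>"

definition gr_homog ::
  "('a, 'm) ring_scheme \<Rightarrow> ('a \<Rightarrow> 'g::linordered_ab_group_add ext_value) \<Rightarrow> 'a set \<Rightarrow> 'g \<Rightarrow>
   ('g \<Rightarrow> 'a set) set" where
  "gr_homog F w R \<gamma> =
     {c \<in> carrier (gr F w R). \<forall>\<delta>\<in>value_group F w - {\<gamma>}. c \<delta> = \<one>\<^bsub>gr_piece F w R \<delta>\<^esub>}"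

text \<open>
  The map induced by \<open>\<iota>\<close> on graded rings, for an embedding \<open>\<iota>\<close> of \<open>F\<close> into \<open>E\<close> that maps \<open>R\<close> into \<open>S\<close>
  and satisfies \<open>w (\<iota> a) = v a\<close>: the class of \<open>a\<close> is sent to the class of \<open>\<iota> a\<close>.
\<close>

definition gr_map ::
  "('a, 'm) ring_scheme \<Rightarrow> ('a \<Rightarrow> 'g::linordered_ab_group_add ext_value) \<Rightarrow>
   ('b, 'n) ring_scheme \<Rightarrow> ('b \<Rightarrow> 'g ext_value) \<Rightarrow> 'b set \<Rightarrow>
   ('a \<Rightarrow> 'b) \<Rightarrow> ('g \<Rightarrow> 'a set) \<Rightarrow> 'g \<Rightarrow> 'b set" where
  "gr_map F v E w S \<iota> c =
     (\<lambda>\<gamma>\<in>value_group E w.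
        if \<gamma> \<in> value_group F v then P_gt w S \<gamma> <+>\<^bsub>E\<^esub> (\<iota> ` c \<gamma>) else P_gt w S \<gamma>)"


section \<open>Polynomial rings in several variables\<close>

text \<open>
  A monomial is the multiset of its variables, as in the library theory on indexed polynomials.
\<close>

definition mpoly_const :: "('a, 'm) ring_scheme \<Rightarrow> 'a \<Rightarrow> 'i multiset \<Rightarrow> 'a" where
  "mpoly_const S c = (\<lambda>M. if M = {#} then c else \<zero>\<^bsub>S\<^esub>)"

definition mpoly_var :: "('a, 'm) ring_scheme \<Rightarrow> 'i \<Rightarrow> 'i multiset \<Rightarrow> 'a" where
  "mpoly_var S i = (\<lambda>M. if M = {#i#} then \<one>\<^bsub>S\<^esub> else \<zero>\<^bsub>S\<^esub>)"

definition mpoly_ring :: "('a, 'm) ring_scheme \<Rightarrow> 'i set \<Rightarrow> ('i multiset \<Rightarrow> 'a) ring" where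
  "mpoly_ring S I =
     \<lparr>carrier = {p. (\<forall>M. p M \<in> carrier S) \<and> finite {M. p M \<noteq> \<zero>\<^bsub>S\<^esub>} \<and>
                    (\<forall>M. p M \<noteq> \<zero>\<^bsub>S\<^esub> \<longrightarrow> set_mset M \<subseteq> I)},
      monoid.mult = (\<lambda>p q M. \<Oplus>\<^bsub>S\<^esub>N\<in>{N. N \<subseteq># M}. p N \<otimes>\<^bsub>S\<^esub> q (M - N)),
      one = mpoly_const S \<one>\<^bsub>S\<^esub>,
      zero = (\<lambda>M. \<zero>\<^bsub>S\<^esub>),
      add = (\<lambda>p q M. p M \<oplus>\<^bsub>S\<^esub> q M)\<rparr>"

text \<open>
  Homogeneous elements of degree \<open>\<delta>\<close> when \<open>S\<close> is graded with homogeneous parts \<open>H\<close> and the variable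
  \<open>i\<close> has degree \<open>d i\<close>.
\<close>

definition mpoly_homog ::
  "('a, 'm) ring_scheme \<Rightarrow> 'i set \<Rightarrow> ('g::ab_group_add \<Rightarrow> 'a set) \<Rightarrow> ('i \<Rightarrow> 'g) \<Rightarrow> 'g \<Rightarrow>
   ('i multiset \<Rightarrow> 'a) set" where
  "mpoly_homog S I H d \<delta> =
     {p \<in> carrier (mpoly_ring S I). \<forall>M. p M \<in> H (\<delta> - (\<Sum>i\<in>#M. d i))}"

definition relation_indices :: "(nat \<Rightarrow> nat) \<Rightarrow> nat \<Rightarrow> ((nat \<Rightarrow> nat) \<times> nat) set" where
  "relation_indices m i = (\<Pi>\<^sub>E l\<in>{1..<i}. {..<m l}) \<times> {..<m i}"

definition relation ::
  "('a, 'm) ring_scheme \<Rightarrow> nat \<Rightarrow> (nat \<Rightarrow> nat) \<Rightarrow> (nat \<Rightarrow> (nat \<Rightarrow> nat) \<Rightarrow> nat \<Rightarrow> 'a) \<Rightarrow> nat \<Rightarrow>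
   nat multiset \<Rightarrow> 'a" where
  "relation S n m c i =
     (let P = mpoly_ring S {1..<n}; X = mpoly_var S
      in X i [^]\<^bsub>P\<^esub> m i \<oplus>\<^bsub>P\<^esub>
         finsum P
           (\<lambda>(j, k). mpoly_const S (c i j k) \<otimes>\<^bsub>P\<^esub>
                      (\<Otimes>\<^bsub>P\<^esub>l\<in>{1..<i}. X l [^]\<^bsub>P\<^esub> j l) \<otimes>\<^bsub>P\<^esub> X i [^]\<^bsub>P\<^esub> k)
           (relation_indices m i))"

end

theory Submission
  imports Defs "HOL-Library.Poly_Mapping"
begin

text \<open>
  Let \<open>u\<close> be the pseudo valuation of \<open>K[x]\<close> induced by \<open>v\<close>. For a monic polynomial \<open>\<phi>\<close>, the truncation of
  \<open>u\<close> at \<open>\<phi>\<close> gives \<open>g\<close> the least value of a term of its expansion in powers of \<open>\<phi>\<close>. Below the degree of a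
  key polynomial the preceding inductive value agrees with \<open>u\<close>, so the inductive value with last key
  polynomial \<open>\<phi>\<close> is this truncation, and no recursion on the sequence is needed.

  Suppose that the truncation at \<open>\<phi>\<close> is a valuation, and let \<open>\<psi>\<close> be monic of least degree among the
  polynomials on which it is smaller than \<open>u\<close>. Division with remainder shows that \<open>\<psi>\<close> divides a nonzero \<open>g\<close>
  up to equivalence exactly when the truncation at \<open>\<phi>\<close> is smaller than \<open>u\<close> at \<open>g\<close>
  (\<open>jump_equiv_dvd\<close>). As both functions are multiplicative, all the defining properties of a key
  polynomial follow (\<open>jump_key_polynomial\<close>), and the truncation at \<open>\<psi>\<close> is again a valuation
  (\<open>jump_abstract_key\<close>, \<open>trunc_mult\<close>).

  Uniqueness of the extension is used once: it makes the elements of value \<open>0\<close> integral over the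
  valuation ring of \<open>v\<^sub>0\<close>, since otherwise Chevalley's theorem gives an extension in which such an element
  has negative value (\<open>unique_extension_integral_val\<close>). An integral equation for a power of \<open>\<phi>\<close> then
  forces the degree of \<open>\<phi>\<close> to divide that of \<open>f\<close>, and the top term \<open>\<phi>\<^sup>e\<close> of the expansion of \<open>f\<close> to have
  the least value (\<open>leading_index_f\<close>).

  The hypothesis on \<open>p\<close> makes \<open>e\<close> invertible in \<open>A\<close>. Replacing a candidate \<open>\<psi>\<close> for the next key polynomial
  by the Tschirnhausen transform \<open>\<psi> + a\<^sub>e\<^sub>-\<^sub>1/e\<close>, where \<open>a\<^sub>e\<^sub>-\<^sub>1\<close> is the coefficient of \<open>\<psi>\<^sup>e\<^sup>-\<^sup>1\<close> in \<open>f\<close>, does not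
  lower its value, and repeating this ends at the approximate root of \<open>f\<close> of that degree
  (\<open>approx_root_jump\<close>). The approximate root has coefficients in \<open>A\<close> and is unique, so after the first
  step the degrees of the key polynomials increase strictly and the sequence reaches \<open>f\<close>
  (\<open>chain_exists\<close>).

  For the graded rings, the monomials in the key polynomials with exponents \<open>j\<^sub>i < m\<^sub>i\<close> form a basis of
  \<open>A[x]/(f)\<close> over \<open>A\<close>, and \<open>u\<close> of a combination is the least value of its terms (\<open>box_sum_value\<close>,
  \<open>box_sum_exists\<close>). The relation of index \<open>i\<close> comes from expanding \<open>\<phi>\<^sub>i\<^sub>+\<^sub>1 - \<phi>\<^sub>i\<^sup>m\<close> with \<open>m = m\<^sub>i\<close> in this basis, because
  \<open>u(\<phi>\<^sub>i\<^sub>+\<^sub>1)\<close> exceeds \<open>u(\<phi>\<^sub>i\<^sup>m)\<close>. The relations rewrite every polynomial to a combination of the basis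
  monomials (\<open>reduce\<close>), and such a combination vanishes in the graded ring only if its coefficients do
  (\<open>eval_class_boxed\<close>); hence the relations generate the kernel.

  The graded rings and the polynomial ring over one of them are handled through surjections from
  subrings of monoid algebras with coefficients in \<open>K\<close> or \<open>K[x]\<close>, where multiplication is that of a type
  class. Ring axioms and homomorphisms are transported along these surjections.
\<close>

abbreviation "lookup \<equiv> Poly_Mapping.lookup"
abbreviation "single \<equiv> Poly_Mapping.single"
abbreviation "keys \<equiv> Poly_Mapping.keys"

section \<open>Values with an infinite element\<close>

lemma ext_order_simps [simp]:
  "Fin a \<le> Fin b \<longleftrightarrow> a \<le> b" "Fin a < Fin b \<longleftrightarrow> a < b" "x \<le> Infty" "Infty \<le> x \<longleftrightarrow> x = Infty"
  "Fin a < Infty" "\<not> Infty < x"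
  by (auto simp: less_eq_ext_value_def less_ext_value_def split: ext_value.splits)

lemma ext_add_simps [simp]:
  "Fin a + Fin b = Fin (a + b)" "Infty + x = Infty" "x + Infty = Infty"
  by (auto simp: plus_ext_value_def split: ext_value.splits)

lemma ext_eq_0_iff [simp]: "0 = Fin a \<longleftrightarrow> a = 0" "Fin a = 0 \<longleftrightarrow> a = 0"
  "(0::'a::comm_monoid_add ext_value) \<noteq> Infty" "Infty \<noteq> (0::'a::comm_monoid_add ext_value)"
  by (auto simp: zero_ext_value_def)

lemma ext_add_eq_Infty [simp]: "x + y = Infty \<longleftrightarrow> x = Infty \<or> y = Infty"
  by (cases x; cases y) auto

lemma less_Infty_iff [simp]: "x < Infty \<longleftrightarrow> x \<noteq> Infty"
  by (cases x) auto

lemma ext_add_strict_right: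
  "x < y \<Longrightarrow> z \<noteq> Infty \<Longrightarrow> x + z < y + (z :: 'g::linordered_ab_group_add ext_value)"
  by (cases x; cases y; cases z) auto

lemma ext_add_le_less:
  "x \<le> x' \<Longrightarrow> y < y' \<Longrightarrow> x \<noteq> Infty \<Longrightarrow> x + y < x' + (y' :: 'g::linordered_ab_group_add ext_value)"
  by (cases x; cases y; cases x'; cases y') (auto intro: add_le_less_mono)

lemma ext_add_less_le:
  "x < x' \<Longrightarrow> y \<le> y' \<Longrightarrow> y \<noteq> Infty \<Longrightarrow> x + y < x' + (y' :: 'g::linordered_ab_group_add ext_value)"
  by (cases x; cases y; cases x'; cases y') (auto intro: add_less_le_mono)

lemma nat_mult_0 [simp]: "nat_mult 0 x = 0" by (simp add: nat_mult_def)
lemma nat_mult_Suc [simp]: "nat_mult (Suc n) x = x + nat_mult n x"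
  by (simp add: nat_mult_def add.commute)

section \<open>Expansions\<close>

lemma degree_mod_lt:
  "0 < degree \<phi> \<Longrightarrow> degree (g mod \<phi>) < degree (\<phi> :: 'k::field poly)"
  by (metis degree_0 degree_mod_less' not_gr_zero)

lemma degree_div_eq:
  fixes g \<phi> :: "'k::field poly"
  assumes "0 < degree \<phi>"
  shows "degree (g div \<phi>) = degree g - degree \<phi>"
proof (cases "g div \<phi> = 0")
  case True
  hence "g mod \<phi> = g" by (metis add.left_neutral div_mult_mod_eq mult_zero_left)
  hence "degree g < degree \<phi>"
    using assms by (metis degree_0 degree_mod_less' not_gr_zero)
  thus ?thesis using True by simp
next
  case False
  have \<phi>: "\<phi> \<noteq> 0" using assms by auto
  have "degree (g mod \<phi>) < degree \<phi>"
    using assms by (metis degree_0 degree_mod_less' not_gr_zero)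
  also have "\<dots> \<le> degree (g div \<phi> * \<phi>)" using False \<phi> by (simp add: degree_mult_eq)
  finally have "degree (g div \<phi> * \<phi> + g mod \<phi>) = degree (g div \<phi> * \<phi>)"
    by (rule degree_add_eq_left)
  thus ?thesis using False \<phi> by (simp add: degree_mult_eq)
qed

text \<open>
  An expansion is stored as a polynomial in \<open>\<phi>\<close> with polynomial coefficients, so that its existence,
  uniqueness and behaviour under multiplication become statements about \<open>poly e \<phi>\<close>.
\<close>

definition is_expansion :: "'k::field poly \<Rightarrow> 'k poly poly \<Rightarrow> bool" where
  "is_expansion \<phi> e \<longleftrightarrow> (\<forall>i. degree (poly.coeff e i) < degree \<phi>)"

lemma expansion_zero:
  assumes "is_expansion \<phi> e" "poly e \<phi> = 0"
  shows "e = 0"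
  using assms
proof (induction e)
  case 0
  then show ?case by simp
next
  case (pCons a e)
  have da: "degree a < degree \<phi>"
    using pCons.prems(1)[unfolded is_expansion_def, THEN spec, of 0] by simp
  have e: "is_expansion \<phi> e"
    unfolding is_expansion_def
  proof
    fix i show "degree (poly.coeff e i) < degree \<phi>"
      using pCons.prems(1)[unfolded is_expansion_def, THEN spec, of "Suc i"] by simp
  qed
  have "a + \<phi> * poly e \<phi> = 0" using pCons.prems(2) by simp
  hence "\<phi> dvd a"
    by (metis dvd_triv_left add.commute add_eq_0_iff dvd_minus_iff)
  hence "a = 0" using da by (meson dvd_imp_degree_le not_le)
  moreover from this have "poly e \<phi> = 0" using pCons.prems(2) da by auto
  hence "e = 0" using pCons.IH e by blast
  ultimately show ?case by simp
qed

lemma expansion_diff: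
  "is_expansion \<phi> e \<Longrightarrow> is_expansion \<phi> e' \<Longrightarrow> is_expansion \<phi> (e - e')"
  by (auto simp: is_expansion_def intro: degree_diff_less)

lemma expansion_add:
  "is_expansion \<phi> e \<Longrightarrow> is_expansion \<phi> e' \<Longrightarrow> is_expansion \<phi> (e + e')"
  by (auto simp: is_expansion_def intro: degree_add_less)

lemma expansion_pCons:
  "degree a < degree \<phi> \<Longrightarrow> is_expansion \<phi> e \<Longrightarrow> is_expansion \<phi> (pCons a e)"
  by (auto simp: is_expansion_def coeff_pCons split: nat.splits)

text \<open>
  Repeated division by \<open>\<phi>\<close> never leaves a set that is stable under quotient and remainder; for a monic
  \<open>\<phi>\<close> with coefficients in \<open>A\<close> this produces expansions over \<open>A\<close>.
\<close>

lemma expansion_exists_over: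
  fixes \<phi> :: "'k::field poly"
  assumes d: "degree \<phi> > 0"
    and A: "\<And>g. g \<in> S \<Longrightarrow> g mod \<phi> \<in> S \<and> g div \<phi> \<in> S" "0 \<in> S"
  shows "g \<in> S \<Longrightarrow> \<exists>e. is_expansion \<phi> e \<and> poly e \<phi> = g \<and> (\<forall>i. poly.coeff e i \<in> S)"
proof (induction "degree g" arbitrary: g rule: less_induct)
  case less
  show ?case
  proof (cases "degree g < degree \<phi>")
    case True
    thus ?thesis using d A less.prems
      by (intro exI[of _ "[:g:]"]) (auto simp: is_expansion_def coeff_pCons split: nat.splits)
  next
    case False
    have "degree (g div \<phi>) < degree g"
      using False d by (simp add: degree_div_eq)
    with less.hyps[of "g div \<phi>"] A less.prems obtain e where
      e: "is_expansion \<phi> e" "poly e \<phi> = g div \<phi>" "\<forall>i. poly.coeff e i \<in> S" by blast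
    have "degree (g mod \<phi>) < degree \<phi>"
      using d by (metis degree_0 degree_mod_less' not_gr_zero)
    thus ?thesis using e A less.prems
      by (intro exI[of _ "pCons (g mod \<phi>) e"])
        (auto simp: expansion_pCons coeff_pCons split: nat.splits)
  qed
qed

lemma expansion_exists:
  fixes \<phi> :: "'k::field poly"
  assumes "degree \<phi> > 0"
  shows "\<exists>e. is_expansion \<phi> e \<and> poly e \<phi> = g"
  using expansion_exists_over[OF assms, of UNIV g] by auto

lemma phi_expansion_eqI:
  assumes "is_expansion \<phi> e" "poly e \<phi> = g"
  shows "phi_expansion \<phi> g = e"
  unfolding phi_expansion_def
proof (rule the_equality)
  show "(\<forall>i. degree (poly.coeff e i) < degree \<phi>) \<and> poly e \<phi> = g"
    using assms by (simp add: is_expansion_def)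
  fix e' assume "(\<forall>i. degree (poly.coeff e' i) < degree \<phi>) \<and> poly e' \<phi> = g"
  hence "is_expansion \<phi> (e' - e)" "poly (e' - e) \<phi> = 0"
    using assms by (auto simp: is_expansion_def intro: degree_diff_less)
  hence "e' - e = 0" by (rule expansion_zero)
  thus "e' = e" by simp
qed

lemma phi_expansion:
  assumes "degree \<phi> > 0"
  shows "is_expansion \<phi> (phi_expansion \<phi> g)" "poly (phi_expansion \<phi> g) \<phi> = g"
  using expansion_exists[OF assms, of g] phi_expansion_eqI[of \<phi> _ g] by auto

section \<open>Pseudo valuations\<close>

text \<open>
  The valuation of \<open>K[x]/(f)\<close> is studied as the pseudo valuation of \<open>K[x]\<close> that it induces.
\<close>

locale pseudo_val =
  fixes f :: "'k::field poly" and u :: "'k poly \<Rightarrow> 'g::linordered_ab_group_add ext_value"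
  assumes u_Infty: "u g = Infty \<longleftrightarrow> f dvd g"
    and u_mult: "u (g * h) = u g + u h"
    and u_add: "min (u g) (u h) \<le> u (g + h)"
    and f_monic: "lead_coeff f = 1"
    and f_degree: "degree f > 0"
begin

abbreviation "d \<equiv> degree f"

lemma u_0 [simp]: "u 0 = Infty" by (simp add: u_Infty)

lemma u_finite: "g \<noteq> 0 \<Longrightarrow> degree g < d \<Longrightarrow> u g \<noteq> Infty"
  using u_Infty dvd_imp_degree_le not_le by blast

lemma u_1 [simp]: "u 1 = 0"
proof -
  have "u 1 \<noteq> Infty" using u_finite[of 1] f_degree by simp
  moreover have "u 1 = u 1 + u 1" using u_mult[of 1 1] by simp
  ultimately show ?thesis by (cases "u 1") auto
qed

lemma u_uminus [simp]: "u (- g) = u g"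
proof -
  have "u (-1) + u (-1) = 0" using u_mult[of "-1" "-1"] by simp
  hence "u (-1) = 0"
    by (cases "u (-1)") (auto simp: add_nonneg_eq_0_iff double_zero)
  thus ?thesis using u_mult[of "-1" g] by simp
qed

lemma u_diff: "min (u g) (u h) \<le> u (g - h)"
  using u_add[of g "-h"] by simp

lemma u_add_eq: "u g < u h \<Longrightarrow> u (g + h) = u g"
  using u_add[of g h] u_diff[of "g + h" h] by (auto simp: min_def split: if_splits)

lemma u_diff_eq: "u g < u h \<Longrightarrow> u (g - h) = u g"
  using u_add_eq[of g "- h"] by simp

lemma u_sum_ge: "(\<And>i. i \<in> I \<Longrightarrow> \<gamma> \<le> u (g i)) \<Longrightarrow> \<gamma> \<le> u (sum g I)"
proof (induction I rule: infinite_finite_induct)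
  case (insert i I)
  hence "\<gamma> \<le> min (u (g i)) (u (sum g I))" by simp
  also have "\<dots> \<le> u (g i + sum g I)" by (rule u_add)
  finally show ?case using insert by simp
qed auto

lemma u_sum_gt: "(\<And>i. i \<in> I \<Longrightarrow> \<gamma> < u (g i)) \<Longrightarrow> \<gamma> \<noteq> Infty \<Longrightarrow> \<gamma> < u (sum g I)"
proof (induction I rule: infinite_finite_induct)
  case (insert i I)
  hence "\<gamma> < min (u (g i)) (u (sum g I))" by simp
  also have "\<dots> \<le> u (g i + sum g I)" by (rule u_add)
  finally show ?case using insert by simp
qed auto

lemma u_power: "u (\<phi> ^ i) = nat_mult i (u \<phi>)"
  by (induction i) (simp_all add: u_mult)

definition exp_term :: "'k poly \<Rightarrow> 'k poly \<Rightarrow> nat \<Rightarrow> 'k poly" where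
  "exp_term \<phi> g i = poly.coeff (phi_expansion \<phi> g) i * \<phi> ^ i"

text \<open>
  The inductive value with last key polynomial \<open>\<phi>\<close>. Values of coefficients are measured by \<open>u\<close> itself,
  with which the preceding inductive value agrees in degrees below that of \<open>\<phi>\<close>.
\<close>

definition trunc :: "'k poly \<Rightarrow> 'k poly \<Rightarrow> 'g ext_value" where
  "trunc \<phi> g = Min ((\<lambda>i. u (exp_term \<phi> g i)) ` {..degree (phi_expansion \<phi> g)})"

lemma exp_term_gt_degree: "i > degree (phi_expansion \<phi> g) \<Longrightarrow> exp_term \<phi> g i = 0"
  by (simp add: exp_term_def coeff_eq_0)

lemma trunc_le: "trunc \<phi> g \<le> u (exp_term \<phi> g i)"
  by (cases "i \<le> degree (phi_expansion \<phi> g)") (auto simp: trunc_def exp_term_gt_degree)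

lemma trunc_attained: "\<exists>i. trunc \<phi> g = u (exp_term \<phi> g i)"
proof -
  have "trunc \<phi> g \<in> (\<lambda>i. u (exp_term \<phi> g i)) ` {..degree (phi_expansion \<phi> g)}"
    unfolding trunc_def by (rule Min_in) auto
  thus ?thesis by auto
qed

lemma le_trunc_iff: "\<gamma> \<le> trunc \<phi> g \<longleftrightarrow> (\<forall>i. \<gamma> \<le> u (exp_term \<phi> g i))"
  using trunc_le trunc_attained by (metis order_trans)

context
  fixes \<phi> :: "'k poly"
  assumes \<phi>_degree: "degree \<phi> > 0"
begin

lemmas expn = phi_expansion[OF \<phi>_degree]

lemma phi_expansion_add: "phi_expansion \<phi> (g + h) = phi_expansion \<phi> g + phi_expansion \<phi> h"
  by (rule phi_expansion_eqI) (auto simp: expn intro: expansion_add)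

lemma phi_expansion_diff: "phi_expansion \<phi> (g - h) = phi_expansion \<phi> g - phi_expansion \<phi> h"
  by (rule phi_expansion_eqI) (auto simp: expn intro: expansion_diff)

lemma exp_term_add: "exp_term \<phi> (g + h) i = exp_term \<phi> g i + exp_term \<phi> h i"
  by (simp add: exp_term_def phi_expansion_add algebra_simps)

lemma exp_term_diff: "exp_term \<phi> (g - h) i = exp_term \<phi> g i - exp_term \<phi> h i"
  by (simp add: exp_term_def phi_expansion_diff algebra_simps)

lemma phi_expansion_small:
  "degree g < degree \<phi> \<Longrightarrow> phi_expansion \<phi> g = [:g:]"
  using \<phi>_degree by (intro phi_expansion_eqI) (auto simp: is_expansion_def coeff_pCons split: nat.splits)

lemma exp_term_small:
  "degree g < degree \<phi> \<Longrightarrow> exp_term \<phi> g i = (if i = 0 then g else 0)"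
  by (auto simp: exp_term_def phi_expansion_small coeff_pCons split: nat.splits)

lemma sum_exp_term: "g = (\<Sum>i\<le>degree (phi_expansion \<phi> g). exp_term \<phi> g i)"
  using expn(2)[of g] by (simp add: exp_term_def poly_altdef)

lemma trunc_le_u: "trunc \<phi> g \<le> u g"
  by (subst (2) sum_exp_term) (rule u_sum_ge, rule trunc_le)

lemma trunc_small: "degree g < degree \<phi> \<Longrightarrow> trunc \<phi> g = u g"
  by (simp add: trunc_def phi_expansion_small exp_term_small)

lemma trunc_add: "min (trunc \<phi> g) (trunc \<phi> h) \<le> trunc \<phi> (g + h)"
  unfolding le_trunc_iff
proof
  fix i
  have "min (trunc \<phi> g) (trunc \<phi> h) \<le> min (u (exp_term \<phi> g i)) (u (exp_term \<phi> h i))"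
    using trunc_le by (meson min.mono)
  also have "\<dots> \<le> u (exp_term \<phi> (g + h) i)" unfolding exp_term_add by (rule u_add)
  finally show "min (trunc \<phi> g) (trunc \<phi> h) \<le> u (exp_term \<phi> (g + h) i)" .
qed

lemma trunc_diff: "min (trunc \<phi> g) (trunc \<phi> h) \<le> trunc \<phi> (g - h)"
  unfolding le_trunc_iff
proof
  fix i
  have "min (trunc \<phi> g) (trunc \<phi> h) \<le> min (u (exp_term \<phi> g i)) (u (exp_term \<phi> h i))"
    using trunc_le by (meson min.mono)
  also have "\<dots> \<le> u (exp_term \<phi> (g - h) i)" unfolding exp_term_diff by (rule u_diff)
  finally show "min (trunc \<phi> g) (trunc \<phi> h) \<le> u (exp_term \<phi> (g - h) i)" .
qed

lemma trunc_diff_eq: "trunc \<phi> g < trunc \<phi> h \<Longrightarrow> trunc \<phi> (g - h) = trunc \<phi> g" "trunc \<phi> h < trunc \<phi> g \<Longrightarrow> trunc \<phi> (g - h) = trunc \<phi> h"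
  using trunc_diff[of g h] trunc_add[of "g - h" h] trunc_diff[of g "g - h"]
  by (auto simp: min_def split: if_splits)

lemma trunc_sum_gt: "(\<And>i. i \<in> I \<Longrightarrow> \<gamma> < trunc \<phi> (g i)) \<Longrightarrow> \<gamma> \<noteq> Infty \<Longrightarrow> \<gamma> < trunc \<phi> (sum g I)"
proof (induction I rule: infinite_finite_induct)
  case (insert i I)
  hence "\<gamma> < min (trunc \<phi> (g i)) (trunc \<phi> (sum g I))" by simp
  also have "\<dots> \<le> trunc \<phi> (g i + sum g I)" by (rule trunc_add)
  finally show ?case using insert by simp
qed (auto simp: trunc_small \<phi>_degree)

lemma trunc_0 [simp]: "trunc \<phi> 0 = Infty"
  using \<phi>_degree by (simp add: trunc_small)

end

subsection \<open>Leading index\<close>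

text \<open>
  The largest exponent at which the least value is attained, that is, the degree in \<open>\<phi>\<close> of the
  initial form for the truncation. It is additive on products, like a degree.
\<close>

definition leading_index :: "'k poly \<Rightarrow> 'k poly \<Rightarrow> nat \<Rightarrow> bool" where
  "leading_index \<phi> g s \<longleftrightarrow> u (exp_term \<phi> g s) = trunc \<phi> g \<and> trunc \<phi> g \<noteq> Infty \<and> (\<forall>i>s. trunc \<phi> g < u (exp_term \<phi> g i))"

lemma leading_index_unique: "leading_index \<phi> g s \<Longrightarrow> leading_index \<phi> g t \<Longrightarrow> s = t"
  unfolding leading_index_def by (metis less_irrefl linorder_neqE_nat)

lemma leading_index_exists:
  assumes "trunc \<phi> g \<noteq> Infty"
  shows "\<exists>s. leading_index \<phi> g s"
proof -
  let ?S = "{i. u (exp_term \<phi> g i) = trunc \<phi> g}"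
  have "?S \<subseteq> {..degree (phi_expansion \<phi> g)}"
    using assms exp_term_gt_degree by (metis (mono_tags, lifting) atMost_iff mem_Collect_eq not_le subsetI u_0)
  hence fin: "finite ?S" using finite_subset by blast
  have ne: "?S \<noteq> {}" using trunc_attained[of \<phi> g] by auto
  have "leading_index \<phi> g (Max ?S)"
    unfolding leading_index_def
  proof (intro conjI allI impI)
    show "u (exp_term \<phi> g (Max ?S)) = trunc \<phi> g" using Max_in[OF fin ne] by simp
    fix i assume "Max ?S < i"
    hence "i \<notin> ?S" using Max_ge[OF fin] not_le by blast
    thus "trunc \<phi> g < u (exp_term \<phi> g i)" using trunc_le[of \<phi> g i] by simp
  qed (rule assms)
  thus ?thesis ..
qed

lemma trunc_finite:
  assumes "0 < degree \<phi>" "degree \<phi> \<le> d" "u \<phi> \<noteq> Infty" "g \<noteq> 0"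
  shows "trunc \<phi> g \<noteq> Infty"
proof -
  note e = phi_expansion[OF assms(1), of g]
  have "phi_expansion \<phi> g \<noteq> 0" using e(2) assms(4) by auto
  then obtain i where i: "poly.coeff (phi_expansion \<phi> g) i \<noteq> 0" by (meson leading_coeff_neq_0)
  have "u (poly.coeff (phi_expansion \<phi> g) i) \<noteq> Infty"
    using e(1) assms(2) i by (intro u_finite) (auto simp: is_expansion_def intro: less_le_trans)
  moreover have "u (\<phi> ^ i) \<noteq> Infty"
    using assms(3) by (induction i) (auto simp: u_mult)
  ultimately have "u (exp_term \<phi> g i) \<noteq> Infty" by (simp add: exp_term_def u_mult)
  thus ?thesis using trunc_le[of \<phi> g i] by auto
qed

lemma leading_index_equiv:
  assumes "0 < degree \<phi>" "leading_index \<phi> g s" "trunc \<phi> g < trunc \<phi> (h - g)"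
  shows "leading_index \<phi> h s"
proof -
  have eq: "exp_term \<phi> h i = exp_term \<phi> g i + exp_term \<phi> (h - g) i" for i by (simp add: exp_term_diff[OF assms(1)])
  have gt: "trunc \<phi> g < u (exp_term \<phi> (h - g) i)" for i
    using assms(3) trunc_le less_le_trans by blast
  have "min (trunc \<phi> g) (trunc \<phi> (h - g)) \<le> trunc \<phi> h" using trunc_add[OF assms(1), of g "h - g"] by simp
  hence ge: "trunc \<phi> g \<le> trunc \<phi> h" using assms(3) by simp
  have s: "u (exp_term \<phi> h s) = trunc \<phi> g"
    unfolding eq using assms(2) gt[of s] by (simp add: u_add_eq leading_index_def)
  hence trunc: "trunc \<phi> h = trunc \<phi> g" using trunc_le[of \<phi> h s] ge by simp
  have "trunc \<phi> g < u (exp_term \<phi> h i)" if "i > s" for i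
  proof -
    have "trunc \<phi> g < min (u (exp_term \<phi> g i)) (u (exp_term \<phi> (h - g) i))" using that assms(2) gt by (simp add: leading_index_def)
    also have "\<dots> \<le> u (exp_term \<phi> h i)" unfolding eq by (rule u_add)
    finally show ?thesis .
  qed
  thus ?thesis using s trunc assms(2) by (simp add: leading_index_def)
qed

text \<open>
  The condition under which the truncation at \<open>\<phi>\<close> is multiplicative: when a product of two polynomials of
  small degree is reduced modulo \<open>\<phi>\<close>, the multiple of \<open>\<phi>\<close> that is removed has larger value than the
  product, so reduction is invisible at the level of initial forms.
\<close>

definition abstract_key :: "'k poly \<Rightarrow> bool" where
  "abstract_key \<phi> \<longleftrightarrow> lead_coeff \<phi> = 1 \<and> 0 < degree \<phi> \<and> degree \<phi> \<le> d \<and>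
    (\<forall>g h. g \<noteq> 0 \<longrightarrow> h \<noteq> 0 \<longrightarrow> degree g < degree \<phi> \<longrightarrow>
       degree h < degree \<phi> \<longrightarrow> u (g * h) < u ((g * h) div \<phi> * \<phi>))"

lemma abstract_keyD:
  assumes "abstract_key \<phi>"
  shows "lead_coeff \<phi> = 1" "0 < degree \<phi>" "degree \<phi> \<le> d" "\<phi> \<noteq> 0"
    "\<And>g h. g \<noteq> 0 \<Longrightarrow> h \<noteq> 0 \<Longrightarrow> degree g < degree \<phi> \<Longrightarrow>
       degree h < degree \<phi> \<Longrightarrow> u (g * h) < u ((g * h) div \<phi> * \<phi>)"
  using assms by (auto simp: abstract_key_def)

lemma abstract_key_mod:
  assumes "abstract_key \<phi>" "degree g < degree \<phi>" "degree h < degree \<phi>"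
  shows "u ((g * h) mod \<phi>) = u (g * h)"
proof (cases "g = 0 \<or> h = 0")
  case False
  hence "u (g * h) < u ((g * h) div \<phi> * \<phi>)" using abstract_keyD(5)[OF assms(1)] assms(2,3) by blast
  thus ?thesis using u_diff_eq[of "g * h" "(g * h) div \<phi> * \<phi>"] by (simp add: minus_div_mult_eq_mod)
qed auto

text \<open>
  Multiplying two expansions gives coefficients of degree below twice that of \<open>\<phi>\<close>; one division by
  \<open>\<phi>\<close> suffices, and each quotient is carried to the next exponent.
\<close>

lemma phi_expansion_mult:
  assumes "0 < degree \<phi>"
    and C_def: "C = phi_expansion \<phi> g * phi_expansion \<phi> h"
  shows "phi_expansion \<phi> (g * h) = map_poly (\<lambda>c. c mod \<phi>) C + pCons 0 (map_poly (\<lambda>c. c div \<phi>) C)"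
proof (rule phi_expansion_eqI)
  note eg = phi_expansion[OF assms(1), of g] and eh = phi_expansion[OF assms(1), of h]
  have R: "is_expansion \<phi> (map_poly (\<lambda>c. c mod \<phi>) C)"
    unfolding is_expansion_def
    using assms(1) by (auto simp: coeff_map_poly) (metis degree_0 degree_mod_less' not_gr_zero)
  have "degree (poly.coeff C i div \<phi>) < degree \<phi>" for i
  proof -
    have "degree (poly.coeff C i) \<le> 2 * degree \<phi> - 2"
      unfolding C_def coeff_mult
    proof (rule degree_sum_le)
      fix j assume "j \<in> {..i}"
      have "degree (poly.coeff (phi_expansion \<phi> g) j) < degree \<phi>"
        "degree (poly.coeff (phi_expansion \<phi> h) (i - j)) < degree \<phi>"
        using eg(1) eh(1) by (auto simp: is_expansion_def)
      thus "degree (poly.coeff (phi_expansion \<phi> g) j *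
              poly.coeff (phi_expansion \<phi> h) (i - j)) \<le> 2 * degree \<phi> - 2"
        using degree_mult_le[of "poly.coeff (phi_expansion \<phi> g) j" "poly.coeff (phi_expansion \<phi> h) (i - j)"]
        by linarith
    qed auto
    thus ?thesis using assms(1) by (simp add: degree_div_eq)
  qed
  hence Q: "is_expansion \<phi> (map_poly (\<lambda>c. c div \<phi>) C)"
    by (auto simp: is_expansion_def coeff_map_poly)
  show "is_expansion \<phi> (map_poly (\<lambda>c. c mod \<phi>) C + pCons 0 (map_poly (\<lambda>c. c div \<phi>) C))"
    using R Q assms(1) by (intro expansion_add expansion_pCons) auto
  have C: "C = map_poly (\<lambda>c. c mod \<phi>) C + Polynomial.smult \<phi> (map_poly (\<lambda>c. c div \<phi>) C)"
    by (rule poly_eqI) (simp add: coeff_map_poly)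
  have "g * h = poly C \<phi>" by (simp add: C_def eg(2) eh(2))
  also have "\<dots> = poly (map_poly (\<lambda>c. c mod \<phi>) C + pCons 0 (map_poly (\<lambda>c. c div \<phi>) C)) \<phi>"
    by (subst C) simp
  finally show "poly (map_poly (\<lambda>c. c mod \<phi>) C + pCons 0 (map_poly (\<lambda>c. c div \<phi>) C)) \<phi> = g * h" ..
qed

end

context pseudo_val begin

lemma poly_mod_sum: "(\<Sum>i\<in>I. g i) mod \<phi> = (\<Sum>i\<in>I. g i mod (\<phi> :: 'k poly))"
  by (induction I rule: infinite_finite_induct) (simp_all add: poly_mod_add_left)

lemma poly_div_sum: "(\<Sum>i\<in>I. g i) div \<phi> = (\<Sum>i\<in>I. g i div (\<phi> :: 'k poly))"
  by (induction I rule: infinite_finite_induct) (simp_all add: poly_div_add_left)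

lemma trunc_uminus:
  assumes "0 < degree \<phi>"
  shows "trunc \<phi> (- g) = trunc \<phi> g"
  using trunc_diff[OF assms, of 0 g] trunc_diff[OF assms, of 0 "- g"] trunc_0[OF assms] by simp

lemma exp_term_mult:
  assumes "0 < degree \<phi>"
    and a: "a = poly.coeff (phi_expansion \<phi> g)" and b: "b = poly.coeff (phi_expansion \<phi> h)"
  shows "exp_term \<phi> (g * h) n = (\<Sum>i\<le>n. (a i * b (n - i)) mod \<phi> * \<phi> ^ n) +
    (\<Sum>i<n. (a i * b (n - Suc i)) div \<phi> * \<phi> ^ n)"
proof -
  have "poly.coeff (phi_expansion \<phi> (g * h)) n =
      (\<Sum>i\<le>n. (a i * b (n - i)) mod \<phi>) + (\<Sum>i<n. (a i * b (n - Suc i)) div \<phi>)"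
  proof (cases n)
    case 0
    thus ?thesis by (simp add: phi_expansion_mult[OF assms(1) refl] coeff_map_poly coeff_mult a b)
  next
    case (Suc m)
    thus ?thesis
      by (simp add: phi_expansion_mult[OF assms(1) refl] coeff_map_poly coeff_mult a b
          poly_mod_sum poly_div_sum lessThan_Suc_atMost del: sum.atMost_Suc)
  qed
  thus ?thesis by (simp add: exp_term_def algebra_simps sum_distrib_left)
qed

text \<open>
  Carries have value strictly above the sum of the two truncations by \<open>abstract_key\<close>, so they do not affect the
  terms of least value. At the exponent \<open>s + t\<close> only the product of the two leading terms attains that
  sum, and beyond it none does.
\<close>

lemma leading_index_mult:
  assumes "abstract_key \<phi>" "u \<phi> \<noteq> Infty" "leading_index \<phi> g s" "leading_index \<phi> h t"
  shows "leading_index \<phi> (g * h) (s + t)" "trunc \<phi> (g * h) = trunc \<phi> g + trunc \<phi> h"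
proof -
  note k = abstract_keyD[OF assms(1)]
  define a where "a = poly.coeff (phi_expansion \<phi> g)"
  define b where "b = poly.coeff (phi_expansion \<phi> h)"
  have da: "degree (a i) < degree \<phi>" and db: "degree (b i) < degree \<phi>" for i
    using phi_expansion(1)[OF k(2)] by (auto simp: is_expansion_def a_def b_def)
  have ta: "exp_term \<phi> g i = a i * \<phi> ^ i" and tb: "exp_term \<phi> h i = b i * \<phi> ^ i" for i
    by (simp_all add: exp_term_def a_def b_def)
  have p: "u (\<phi> ^ i) \<noteq> Infty" for i
    using assms(2) by (induction i) (auto simp: u_mult)
  define \<Gamma> where "\<Gamma> = trunc \<phi> g + trunc \<phi> h"
  have fin: "trunc \<phi> g \<noteq> Infty" "trunc \<phi> h \<noteq> Infty" "\<Gamma> \<noteq> Infty" using assms(3,4) by (auto simp: leading_index_def \<Gamma>_def)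
  have M: "u ((a i * b j) mod \<phi> * \<phi> ^ (i + j)) = u (exp_term \<phi> g i) + u (exp_term \<phi> h j)" for i j
    by (simp add: u_mult[of _ "\<phi> ^ _"] abstract_key_mod[OF assms(1) da db] ta tb power_add u_mult ac_simps)
  have Mge: "\<Gamma> \<le> u ((a i * b j) mod \<phi> * \<phi> ^ (i + j))" for i j
    unfolding M \<Gamma>_def by (intro add_mono trunc_le)
  have Mgt: "\<Gamma> < u ((a i * b j) mod \<phi> * \<phi> ^ (i + j))" if "i > s \<or> j > t" for i j
    using that
  proof
    assume "i > s"
    thus ?thesis unfolding M \<Gamma>_def using assms(3) fin
      by (intro ext_add_less_le trunc_le) (auto simp: leading_index_def)
  next
    assume "j > t"
    thus ?thesis unfolding M \<Gamma>_def using assms(4) fin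
      by (intro ext_add_le_less trunc_le) (auto simp: leading_index_def)
  qed
  have D: "\<Gamma> < u ((a i * b j) div \<phi> * \<phi> ^ Suc (i + j))" for i j
  proof (cases "a i = 0 \<or> b j = 0")
    case True
    thus ?thesis using fin by auto
  next
    case False
    have "\<Gamma> \<le> u (exp_term \<phi> g i) + u (exp_term \<phi> h j)" unfolding \<Gamma>_def by (intro add_mono trunc_le)
    also have "\<dots> = u (a i * b j) + u (\<phi> ^ (i + j))" by (simp add: ta tb power_add u_mult ac_simps)
    also have "\<dots> < u ((a i * b j) div \<phi> * \<phi>) + u (\<phi> ^ (i + j))"
      using False da db k(5) p by (intro ext_add_strict_right) auto
    also have "\<dots> = u ((a i * b j) div \<phi> * \<phi> ^ Suc (i + j))" by (simp add: u_mult ac_simps)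
    finally show ?thesis .
  qed
  have Dn: "\<Gamma> < u ((a i * b (n - Suc i)) div \<phi> * \<phi> ^ n)" if "i < n" for i n
    using D[of i "n - Suc i"] that by simp
  have Mn: "\<Gamma> \<le> u ((a i * b (n - i)) mod \<phi> * \<phi> ^ n)" if "i \<le> n" for i n
    using Mge[of i "n - i"] that by simp
  note T = exp_term_mult[OF k(2) a_def b_def]
  have ge: "\<Gamma> \<le> u (exp_term \<phi> (g * h) n)" for n
  proof -
    have "\<Gamma> \<le> min (u (\<Sum>i\<le>n. (a i * b (n - i)) mod \<phi> * \<phi> ^ n)) (u (\<Sum>i<n. (a i * b (n - Suc i)) div \<phi> * \<phi> ^ n))"
      using Mn Dn by (intro min.boundedI u_sum_ge) (auto intro: less_imp_le)
    also have "\<dots> \<le> u (exp_term \<phi> (g * h) n)" unfolding T by (rule u_add)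
    finally show ?thesis .
  qed
  have gt: "\<Gamma> < u (exp_term \<phi> (g * h) n)" if "n > s + t" for n
  proof -
    have "\<Gamma> < u ((a i * b (n - i)) mod \<phi> * \<phi> ^ n)" if "i \<le> n" for i
      using Mgt[of i "n - i"] \<open>n > s + t\<close> that by (cases "i > s") auto
    hence "\<Gamma> < min (u (\<Sum>i\<le>n. (a i * b (n - i)) mod \<phi> * \<phi> ^ n)) (u (\<Sum>i<n. (a i * b (n - Suc i)) div \<phi> * \<phi> ^ n))"
      using Dn fin by (auto intro!: u_sum_gt)
    also have "\<dots> \<le> u (exp_term \<phi> (g * h) n)" unfolding T by (rule u_add)
    finally show ?thesis .
  qed
  have eq: "u (exp_term \<phi> (g * h) (s + t)) = \<Gamma>"
  proof -
    let ?n = "s + t"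
    let ?m = "\<lambda>i. (a i * b (?n - i)) mod \<phi> * \<phi> ^ ?n"
    have "\<Gamma> < u (?m i)" if "i \<in> {..?n} - {s}" for i
      using Mgt[of i "?n - i"] that by (cases "i > s") auto
    hence 1: "\<Gamma> < u (sum ?m ({..?n} - {s}))" using fin by (intro u_sum_gt) auto
    have 2: "\<Gamma> < u (\<Sum>i<?n. (a i * b (?n - Suc i)) div \<phi> * \<phi> ^ ?n)"
      using Dn fin by (intro u_sum_gt) auto
    have 3: "u (?m s) = \<Gamma>" using M[of s t] assms(3,4) by (simp add: leading_index_def \<Gamma>_def)
    have "exp_term \<phi> (g * h) ?n = ?m s + (sum ?m ({..?n} - {s}) + (\<Sum>i<?n. (a i * b (?n - Suc i)) div \<phi> * \<phi> ^ ?n))"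
      unfolding T by (subst sum.remove[of _ s]) (simp_all add: algebra_simps)
    moreover have "\<Gamma> < u (sum ?m ({..?n} - {s}) + (\<Sum>i<?n. (a i * b (?n - Suc i)) div \<phi> * \<phi> ^ ?n))"
      using 1 2 less_le_trans[OF _ u_add] by simp
    ultimately show ?thesis using 3 by (simp add: u_add_eq)
  qed
  have trunc: "trunc \<phi> (g * h) = \<Gamma>"
    using ge eq trunc_le[of \<phi> "g * h" "s + t"] le_trunc_iff[of \<Gamma>] by (simp add: order_antisym)
  thus "trunc \<phi> (g * h) = trunc \<phi> g + trunc \<phi> h" by (simp add: \<Gamma>_def)
  show "leading_index \<phi> (g * h) (s + t)"
    using trunc eq gt fin by (simp add: leading_index_def)
qed

lemma trunc_mult:
  assumes "abstract_key \<phi>" "u \<phi> \<noteq> Infty"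
  shows "trunc \<phi> (g * h) = trunc \<phi> g + trunc \<phi> h"
proof (cases "g = 0 \<or> h = 0")
  case True
  thus ?thesis using trunc_0 abstract_keyD(2)[OF assms(1)] by auto
next
  case False
  hence "trunc \<phi> g \<noteq> Infty" "trunc \<phi> h \<noteq> Infty" using trunc_finite abstract_keyD[OF assms(1)] assms(2) by auto
  then obtain s t where "leading_index \<phi> g s" "leading_index \<phi> h t" using leading_index_exists by meson
  thus ?thesis using leading_index_mult assms by blast
qed

subsection \<open>Passing to the next key polynomial\<close>

text \<open>
  A candidate for the next key polynomial: the truncation at \<open>\<phi>\<close> already computes \<open>u\<close> below the degree of
  \<open>\<psi>\<close>, and fails to do so at \<open>\<psi>\<close>.
\<close>

definition jump :: "'k poly \<Rightarrow> 'k poly \<Rightarrow> bool" where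
  "jump \<phi> \<psi> \<longleftrightarrow> lead_coeff \<psi> = 1 \<and> trunc \<phi> \<psi> < u \<psi> \<and>
    (\<forall>g. degree g < degree \<psi> \<longrightarrow> trunc \<phi> g = u g)"

context
  fixes \<phi> \<psi> :: "'k poly"
  assumes key: "abstract_key \<phi>" and fin: "u \<phi> \<noteq> Infty" and jump: "jump \<phi> \<psi>"
begin

lemma jump_simps:
  "lead_coeff \<psi> = 1" "trunc \<phi> \<psi> < u \<psi>" "\<psi> \<noteq> 0"
  "degree g < degree \<psi> \<Longrightarrow> trunc \<phi> g = u g"
  using jump by (auto simp: jump_def)

lemma \<phi>_pos: "0 < degree \<phi>" using abstract_keyD[OF key] by simp

lemma trunc_fin: "g \<noteq> 0 \<Longrightarrow> trunc \<phi> g \<noteq> Infty" using trunc_finite abstract_keyD[OF key] fin by auto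

lemma jump_degree: "degree \<phi> \<le> degree \<psi>" "0 < degree \<psi>"
proof -
  show "degree \<phi> \<le> degree \<psi>"
    using trunc_small[OF \<phi>_pos] jump_simps(2) by (metis less_irrefl not_le)
  thus "0 < degree \<psi>" using \<phi>_pos by simp
qed

lemma jump_degree_le: "degree \<psi> \<le> d"
proof (rule ccontr)
  assume "\<not> ?thesis"
  hence "trunc \<phi> f = u f" using jump_simps(4) by simp
  moreover have "f \<noteq> 0" using f_degree by auto
  ultimately show False using u_Infty[of f] trunc_fin[of f] by simp
qed

lemma jump_mod: "trunc \<phi> (g mod \<psi>) = u (g mod \<psi>)"
  using jump_degree by (intro jump_simps degree_mod_lt)

lemma jump_mult: "q \<noteq> 0 \<Longrightarrow> trunc \<phi> (q * \<psi>) < u (q * \<psi>)"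
proof -
  assume q: "q \<noteq> 0"
  have "trunc \<phi> (q * \<psi>) = trunc \<phi> q + trunc \<phi> \<psi>" by (rule trunc_mult[OF key fin])
  also have "\<dots> < u q + u \<psi>"
    using trunc_fin[OF q] jump_simps(2) trunc_le_u[OF \<phi>_pos] by (intro ext_add_le_less)
  finally show ?thesis by (simp add: u_mult)
qed

text \<open>
  The remainder has degree below that of \<open>\<psi>\<close>, so on it the truncation and \<open>u\<close> agree, while they differ on
  a multiple of \<open>\<psi>\<close>. If the multiple of \<open>\<psi>\<close> had value at most \<open>u g\<close>, its truncation would be smaller
  than both, hence equal to the value of the remainder, against the ultrametric inequality.
\<close>

lemma jump_div_eq:
  assumes "g \<noteq> 0" "trunc \<phi> g = u g"
  shows "u g < u (g div \<psi> * \<psi>)"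
proof (cases "g div \<psi> = 0")
  case True
  thus ?thesis using assms trunc_fin by auto
next
  case False
  show ?thesis
  proof (rule ccontr)
    assume "\<not> ?thesis"
    hence le: "u (g div \<psi> * \<psi>) \<le> u g" by simp
    hence lt: "trunc \<phi> (g div \<psi> * \<psi>) < trunc \<phi> g" using jump_mult[OF False] assms by simp
    have r: "g mod \<psi> = g - g div \<psi> * \<psi>" by (simp add: minus_div_mult_eq_mod)
    have "u (g mod \<psi>) = trunc \<phi> (g div \<psi> * \<psi>)"
      using trunc_diff_eq(2)[OF \<phi>_pos lt] jump_mod[of g] r by simp
    moreover have "min (u g) (u (g div \<psi> * \<psi>)) \<le> u (g mod \<psi>)" unfolding r by (rule u_diff)
    ultimately have "u (g div \<psi> * \<psi>) \<le> trunc \<phi> (g div \<psi> * \<psi>)" using min.absorb2[OF le] by simp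
    thus False using jump_mult[OF False] by (simp add: not_less[symmetric])
  qed
qed

lemma jump_div_less:
  assumes "trunc \<phi> g < u g"
  shows "trunc \<phi> g < trunc \<phi> (g mod \<psi>)"
proof (rule ccontr)
  assume "\<not> ?thesis"
  hence le: "u (g mod \<psi>) \<le> trunc \<phi> g" by (simp add: jump_mod)
  hence lt: "u (g mod \<psi>) < u g" using assms by simp
  have q: "g div \<psi> * \<psi> = g - g mod \<psi>" by (simp add: minus_mod_eq_div_mult)
  have 1: "u (g div \<psi> * \<psi>) = u (g mod \<psi>)"
    unfolding q using u_diff_eq[OF lt] by (metis minus_diff_eq u_uminus)
  have "min (trunc \<phi> g) (trunc \<phi> (g mod \<psi>)) \<le> trunc \<phi> (g div \<psi> * \<psi>)" unfolding q by (rule trunc_diff[OF \<phi>_pos])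
  hence 2: "u (g div \<psi> * \<psi>) \<le> trunc \<phi> (g div \<psi> * \<psi>)" using le 1 by (simp add: jump_mod)
  show False
  proof (cases "g div \<psi> = 0")
    case True
    thus False using 1 lt by simp
  next
    case False
    thus False using jump_mult 2 by (meson not_le)
  qed
qed

text \<open>
  This characterisation turns equivalence divisibility into a comparison of two multiplicative
  functions. Minimality and equivalence irreducibility of \<open>\<psi>\<close> are immediate from it.
\<close>

lemma jump_equiv_dvd:
  assumes "g \<noteq> 0"
  shows "equiv_dvd (trunc \<phi>) \<psi> g \<longleftrightarrow> trunc \<phi> g < u g"
proof
  assume "equiv_dvd (trunc \<phi>) \<psi> g"
  then obtain a where a: "min (trunc \<phi> g) (trunc \<phi> (a * \<psi>)) < trunc \<phi> (g - a * \<psi>)"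
    using trunc_fin[OF assms] by (auto simp: equiv_dvd_def equivalent_in_def)
  hence eq: "trunc \<phi> g = trunc \<phi> (a * \<psi>)"
    using trunc_diff_eq[OF \<phi>_pos, where g = g and h = "a * \<psi>"] by (cases "trunc \<phi> g" "trunc \<phi> (a * \<psi>)" rule: linorder_cases) auto
  hence "a \<noteq> 0" using trunc_fin[OF assms] trunc_0[OF \<phi>_pos] by auto
  hence 1: "trunc \<phi> g < u (a * \<psi>)" using jump_mult eq by simp
  have 2: "trunc \<phi> g < u (g - a * \<psi>)" using a eq trunc_le_u[OF \<phi>_pos, of "g - a * \<psi>"] by simp
  show "trunc \<phi> g < u g" using u_add[of "g - a * \<psi>" "a * \<psi>"] 1 2 by (simp add: min_def split: if_splits)
next
  assume "trunc \<phi> g < u g"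
  from jump_div_less[OF this] have "trunc \<phi> g < trunc \<phi> (g - g div \<psi> * \<psi>)" by (simp add: minus_div_mult_eq_mod)
  thus "equiv_dvd (trunc \<phi>) \<psi> g" unfolding equiv_dvd_def equivalent_in_def
    by (intro exI[of _ "g div \<psi>"]) (simp add: min.strict_coboundedI1)
qed

lemma jump_key_polynomial: "key_polynomial (trunc \<phi>) \<phi> \<psi> (u \<psi>)"
  unfolding key_polynomial_def
proof (intro conjI)
  show "equiv_irreducible (trunc \<phi>) \<psi>"
    unfolding equiv_irreducible_def
  proof (intro allI impI)
    fix a b assume ab: "equiv_dvd (trunc \<phi>) \<psi> (a * b)"
    have z: "equiv_dvd (trunc \<phi>) \<psi> 0"
      unfolding equiv_dvd_def equivalent_in_def using trunc_0[OF \<phi>_pos] by (intro exI[of _ 0]) simp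
    show "equiv_dvd (trunc \<phi>) \<psi> a \<or> equiv_dvd (trunc \<phi>) \<psi> b"
    proof (cases "a = 0 \<or> b = 0")
      case True
      thus ?thesis using z by auto
    next
      case False
      hence "trunc \<phi> (a * b) < u (a * b)" using ab jump_equiv_dvd by simp
      hence "trunc \<phi> a + trunc \<phi> b < u a + u b" by (simp add: trunc_mult[OF key fin] u_mult)
      hence "trunc \<phi> a \<noteq> u a \<or> trunc \<phi> b \<noteq> u b" by auto
      hence "trunc \<phi> a < u a \<or> trunc \<phi> b < u b" using trunc_le_u[OF \<phi>_pos] by (auto simp: less_le)
      thus ?thesis using False jump_equiv_dvd by auto
    qed
  qed
  show "minimal_in (trunc \<phi>) \<psi>"
    unfolding minimal_in_def
  proof (intro allI impI)
    fix g assume "g \<noteq> 0 \<and> equiv_dvd (trunc \<phi>) \<psi> g"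
    hence "trunc \<phi> g < u g" using jump_equiv_dvd by blast
    thus "degree \<psi> \<le> degree g" using jump_simps(4)[of g] by (cases "degree g < degree \<psi>") auto
  qed
  show "\<not> equivalent_in (trunc \<phi>) \<psi> \<phi>"
  proof
    have trunc\<phi>: "trunc \<phi> \<phi> = u \<phi>"
    proof -
      have "phi_expansion \<phi> \<phi> = [:0, 1:]"
        using \<phi>_pos by (intro phi_expansion_eqI) (auto simp: is_expansion_def coeff_pCons split: nat.splits)
      thus ?thesis using fin
        by (simp add: trunc_def exp_term_def atMost_Suc min_def)
    qed
    assume "equivalent_in (trunc \<phi>) \<psi> \<phi>"
    hence e: "min (trunc \<phi> \<psi>) (trunc \<phi> \<phi>) < trunc \<phi> (\<psi> - \<phi>)"
      using trunc_fin[OF jump_simps(3)] by (auto simp: equivalent_in_def)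
    hence eq: "trunc \<phi> \<psi> = u \<phi>"
      using trunc_diff_eq[OF \<phi>_pos, where g = \<psi> and h = \<phi>] trunc\<phi> by (cases "trunc \<phi> \<psi>" "trunc \<phi> \<phi>" rule: linorder_cases) auto
    have "u \<phi> < u (\<psi> - \<phi>)" using e eq trunc\<phi> trunc_le_u[OF \<phi>_pos, of "\<psi> - \<phi>"] by simp
    moreover have "u \<phi> < u \<psi>" using jump_simps(2) eq by simp
    ultimately show False using u_diff[of \<psi> "\<psi> - \<phi>"] by (simp add: min_def split: if_splits)
  qed
qed (use jump_simps jump_degree in auto)

text \<open>
  On products of polynomials of degree below that of \<open>\<psi>\<close> the truncation at \<open>\<phi>\<close> still equals \<open>u\<close>, as both are
  multiplicative, and \<open>jump_div_eq\<close> applies.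
\<close>

lemma jump_abstract_key: "abstract_key \<psi>"
  unfolding abstract_key_def
proof (intro conjI allI impI)
  fix g h :: "'k poly" assume gh: "g \<noteq> 0" "h \<noteq> 0" "degree g < degree \<psi>" "degree h < degree \<psi>"
  hence "trunc \<phi> (g * h) = u (g * h)" by (simp add: trunc_mult[OF key fin] jump_simps(4) u_mult)
  thus "u (g * h) < u ((g * h) div \<psi> * \<psi>)" using gh by (intro jump_div_eq) auto
qed (use jump_simps jump_degree jump_degree_le in auto)

end

end

section \<open>Degrees of expansions\<close>

lemma expansion_degree:
  fixes \<phi> :: "'k::field poly"
  assumes "0 < degree \<phi>" "lead_coeff \<phi> = 1" "is_expansion \<phi> e" "e \<noteq> 0"
  shows "degree (poly e \<phi>) =
           degree e * degree \<phi> + degree (lead_coeff e)"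
    "lead_coeff (poly e \<phi>) = lead_coeff (lead_coeff e)"
  using assms(3,4)
proof (induction e)
  case 0
  case 1 thus ?case by simp
next
  case 0
  case 2 thus ?case by simp
next
  case (pCons a e)
  have da: "degree a < degree \<phi>" if "is_expansion \<phi> (pCons a e)"
    using that[unfolded is_expansion_def, THEN spec, of 0] by simp
  have ex: "is_expansion \<phi> e" if "is_expansion \<phi> (pCons a e)"
    unfolding is_expansion_def
  proof
    fix i show "degree (poly.coeff e i) < degree \<phi>"
      using that[unfolded is_expansion_def, THEN spec, of "Suc i"] by simp
  qed
  have *: "degree (poly (pCons a e) \<phi>) =
        degree (pCons a e) * degree \<phi> + degree (lead_coeff (pCons a e)) \<and>
      lead_coeff (poly (pCons a e) \<phi>) = lead_coeff (lead_coeff (pCons a e))"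
    if p: "is_expansion \<phi> (pCons a e)"
  proof (cases "e = 0")
    case False
    note IH = pCons.IH(1)[OF ex[OF p] False] pCons.IH(2)[OF ex[OF p] False]
    have ne: "poly e \<phi> \<noteq> 0" using expansion_zero ex[OF p] False by blast
    have \<phi>: "\<phi> \<noteq> 0" using assms by auto
    have d: "degree a < degree (\<phi> * poly e \<phi>)"
      using ne \<phi> da[OF p] by (simp add: degree_mult_eq)
    have "degree (a + \<phi> * poly e \<phi>) = degree (\<phi> * poly e \<phi>)"
      using d by (rule degree_add_eq_right)
    moreover have "lead_coeff (a + \<phi> * poly e \<phi>) = lead_coeff (\<phi> * poly e \<phi>)"
      using d by (metis add.commute lead_coeff_add_le)
    moreover have "lead_coeff (\<phi> * poly e \<phi>) = lead_coeff (lead_coeff e)"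
      unfolding lead_coeff_mult using IH(2) assms(2) by simp
    ultimately have "lead_coeff (a + \<phi> * poly e \<phi>) = lead_coeff (lead_coeff e)"
      "degree (a + \<phi> * poly e \<phi>) = degree \<phi> + degree (poly e \<phi>)"
      using ne \<phi> degree_mult_eq[of \<phi> "poly e \<phi>"] by simp_all
    thus ?thesis using False IH(1) by simp
  qed simp
  { case 1 thus ?case using * by blast }
  { case 2 thus ?case using * by blast }
qed

context pseudo_val
begin

lemma exp_term_degree_le:
  assumes "0 < degree \<phi>" "lead_coeff \<phi> = 1" "exp_term \<phi> g s \<noteq> 0"
  shows "s * degree \<phi> \<le> degree g"
    and "s * degree \<phi> = degree g \<Longrightarrow> exp_term \<phi> g s = Polynomial.smult (lead_coeff g) (\<phi> ^ s)"
proof -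
  define e where "e = phi_expansion \<phi> g"
  note ex = phi_expansion[OF assms(1), of g, folded e_def]
  have cs: "poly.coeff e s \<noteq> 0" using assms(3) by (auto simp: exp_term_def e_def)
  hence e0: "e \<noteq> 0" by auto
  note ed = expansion_degree[OF assms(1,2) ex(1) e0, unfolded ex(2)]
  have s: "s \<le> degree e" using cs by (rule le_degree)
  thus "s * degree \<phi> \<le> degree g" using ed(1) by (simp add: trans_le_add1)
  assume "s * degree \<phi> = degree g"
  hence eq: "degree e * degree \<phi> + degree (lead_coeff e) = s * degree \<phi>"
    using ed(1) by simp
  moreover have "s * degree \<phi> \<le> degree e * degree \<phi>" using s by simp
  ultimately have "degree e * degree \<phi> = s * degree \<phi>" "degree (lead_coeff e) = 0"
    by linarith+
  hence "degree e = s" "degree (lead_coeff e) = 0" using assms(1) by auto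
  hence "poly.coeff e s = [:lead_coeff g:]" using ed(2) by (metis degree_0_id lead_coeff_pCons(1) degree_pCons_0 coeff_pCons_0)
  thus "exp_term \<phi> g s = Polynomial.smult (lead_coeff g) (\<phi> ^ s)" by (simp add: exp_term_def e_def)
qed

lemma exp_term_monomial:
  assumes "degree a < degree \<phi>"
  shows "exp_term \<phi> (a * \<phi> ^ k) n = (if n = k then a * \<phi> ^ k else 0)"
proof -
  have "phi_expansion \<phi> (a * \<phi> ^ k) = Polynomial.monom a k"
    using assms by (intro phi_expansion_eqI) (auto simp: is_expansion_def poly_monom)
  thus ?thesis by (simp add: exp_term_def)
qed

lemma exp_term_sum:
  "0 < degree \<phi> \<Longrightarrow> exp_term \<phi> (\<Sum>i\<in>I. g i) n = (\<Sum>i\<in>I. exp_term \<phi> (g i) n)"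
  by (induction I rule: infinite_finite_induct) (simp_all add: exp_term_add exp_term_small)

lemma trunc_self: "0 < degree \<phi> \<Longrightarrow> trunc \<phi> (\<phi> ^ k) = u (\<phi> ^ k)"
proof (rule antisym)
  assume \<phi>: "0 < degree \<phi>"
  show "trunc \<phi> (\<phi> ^ k) \<le> u (\<phi> ^ k)" using \<phi> by (rule trunc_le_u)
  show "u (\<phi> ^ k) \<le> trunc \<phi> (\<phi> ^ k)"
    unfolding le_trunc_iff using exp_term_monomial[of 1 \<phi> k] \<phi> by simp
qed

lemma u_power_cong: "u a = u b \<Longrightarrow> u (a ^ n) = u (b ^ n)"
  by (simp add: u_power)

lemma u_mod_f: "u (g mod f) = u g"
proof -
  have "u (g - g mod f) = Infty" using u_Infty by (simp add: minus_mod_eq_div_mult)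
  thus ?thesis using u_diff[of g "g - g mod f"] u_add[of "g mod f" "g - g mod f"] by (simp add: min_def split: if_splits)
qed

end

section \<open>The expansion of \<open>f\<close> in powers of a key polynomial\<close>

text \<open>
  The assumption \<open>integral\<close> is the form in which the uniqueness of the extension is used: elements of value
  \<open>0\<close> satisfy a monic equation, modulo \<open>f\<close>, over the valuation ring of \<open>v\<^sub>0\<close>.
\<close>

locale integral_val = pseudo_val f u
  for f :: "'k::field poly" and u :: "'k poly \<Rightarrow> 'g::linordered_ab_group_add ext_value" +
  fixes v0 :: "'k \<Rightarrow> 'g ext_value"
  assumes u_const: "u [:a:] = v0 a"
    and integral: "u g = 0 \<Longrightarrow> \<exists>G. lead_coeff G = 1 \<and> (\<forall>i. 0 \<le> v0 (poly.coeff G i)) \<and> f dvd pcompose G g"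
begin

lemma v0_finite: "a \<noteq> 0 \<Longrightarrow> v0 a \<noteq> Infty"
  using u_finite[of "[:a:]"] f_degree by (simp add: u_const)

text \<open>
  The value group of the extension is torsion modulo that of \<open>v\<^sub>0\<close>. Expand \<open>f\<close> in powers of \<open>g\<close>: as
  \<open>u f\<close> is infinite, the least value of a term is attained twice, and comparing these two terms expresses a
  multiple of \<open>u g\<close> through values of polynomials of smaller degree.
\<close>

lemma torsion_small:
  "g \<noteq> 0 \<Longrightarrow> degree g < d \<Longrightarrow> \<exists>N>0. \<exists>c. c \<noteq> 0 \<and> u (g ^ N) = u [:c:]"
proof (induction "degree g" arbitrary: g rule: less_induct)
  case less
  show ?case
  proof (cases "degree g = 0")
    case True
    then obtain c where "g = [:c:]" by (rule degree_eq_zeroE)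
    thus ?thesis using less.prems by (intro exI[of _ 1] conjI exI[of _ c]) auto
  next
    case False
    hence g: "0 < degree g" by simp
    have ug: "u g \<noteq> Infty" using less.prems u_finite by blast
    have f0: "f \<noteq> 0" using f_degree by auto
    have trunc: "trunc g f \<noteq> Infty" using trunc_finite[OF g _ ug f0] less.prems by simp
    obtain s where s: "trunc g f = u (exp_term g f s)" using trunc_attained by blast
    define n where "n = degree (phi_expansion g f)"
    have sn: "s \<le> n" using s trunc exp_term_gt_degree[of g f s] by (auto simp: n_def intro: leI)
    have "\<exists>j. j \<noteq> s \<and> u (exp_term g f j) = u (exp_term g f s)"
    proof (rule ccontr)
      assume "\<not> ?thesis"
      hence "trunc g f < u (exp_term g f j)" if "j \<noteq> s" for j using trunc_le[of g f j] s that by (auto simp: less_le)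
      hence 1: "trunc g f < u (\<Sum>j\<in>{..n} - {s}. exp_term g f j)" using trunc by (intro u_sum_gt) auto
      have "f = exp_term g f s + (\<Sum>j\<in>{..n} - {s}. exp_term g f j)"
        using sum_exp_term[OF g, of f] sn by (simp add: n_def sum.remove[of _ s])
      hence "u f = trunc g f" using u_add_eq 1 s by metis
      thus False using trunc u_Infty[of f] by simp
    qed
    then obtain i j where ij: "i < j" "u (exp_term g f i) = u (exp_term g f j)" "u (exp_term g f i) \<noteq> Infty"
      using s trunc by (metis linorder_neqE_nat)
    define a where "a = poly.coeff (phi_expansion g f)"
    have t: "exp_term g f k = a k * g ^ k" for k by (simp add: exp_term_def a_def)
    have dg: "degree (a k) < degree g" for k
      using phi_expansion(1)[OF g] by (simp add: is_expansion_def a_def)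
    have ne: "a i \<noteq> 0" "a j \<noteq> 0" using ij by (auto simp: t)
    from less.hyps[OF dg ne(1)] dg less.prems(2) obtain N1 c1 where
      1: "N1 > 0" "c1 \<noteq> 0" "u (a i ^ N1) = u [:c1:]" using less_trans by metis
    from less.hyps[OF dg ne(2)] dg less.prems(2) obtain N2 c2 where
      2: "N2 > 0" "c2 \<noteq> 0" "u (a j ^ N2) = u [:c2:]" using less_trans by metis
    let ?M = "N1 * N2"
    have gi: "u (g ^ i) \<noteq> Infty" using ij(3) by (auto simp: t u_mult)
    have "u (a i) + u (g ^ i) = u (a j * g ^ (j - i)) + u (g ^ i)"
      using ij by (simp add: t u_mult[symmetric] mult.assoc power_add[symmetric])
    hence "u (a i) = u (a j * g ^ (j - i))"
      using gi by (cases "u (a i)"; cases "u (a j * g ^ (j - i))"; cases "u (g ^ i)") auto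
    hence "u (a i ^ ?M) = u ((a j * g ^ (j - i)) ^ ?M)" by (rule u_power_cong)
    also have "\<dots> = u ((a j ^ N2) ^ N1) + u (g ^ ((j - i) * ?M))"
      by (simp add: power_mult_distrib u_mult power_mult[symmetric] mult.commute)
    also have "u ((a j ^ N2) ^ N1) = u ([:c2:] ^ N1)" using 2 by (intro u_power_cong)
    also have "u (a i ^ ?M) = u ((a i ^ N1) ^ N2)" by (simp add: power_mult)
    also have "\<dots> = u ([:c1:] ^ N2)" using 1 by (intro u_power_cong)
    also have "[:c1:] ^ N2 = [:c2:] ^ N1 * [:c1 ^ N2 / c2 ^ N1:]" using 2 by (simp add: poly_const_pow)
    also have "u \<dots> = u ([:c2:] ^ N1) + u [:c1 ^ N2 / c2 ^ N1:]" by (rule u_mult)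
    finally have eq: "u ([:c2:] ^ N1) + u [:c1 ^ N2 / c2 ^ N1:] = u ([:c2:] ^ N1) + u (g ^ ((j - i) * ?M))" .
    have "u ([:c2:] ^ N1) \<noteq> Infty" using 2 v0_finite by (simp add: poly_const_pow u_const)
    hence "u (g ^ ((j - i) * ?M)) = u [:c1 ^ N2 / c2 ^ N1:]"
      using eq by (cases "u ([:c2:] ^ N1)"; cases "u [:c1 ^ N2 / c2 ^ N1:]"; cases "u (g ^ ((j - i) * ?M))") auto
    thus ?thesis using 1 2 ij by (intro exI[of _ "(j - i) * ?M"] conjI exI[of _ "c1 ^ N2 / c2 ^ N1"]) auto
  qed
qed

lemma torsion:
  assumes "u g \<noteq> Infty"
  shows "\<exists>N>0. \<exists>c. c \<noteq> 0 \<and> u (g ^ N) = u [:c:]"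
proof -
  have "g mod f \<noteq> 0" "degree (g mod f) < d"
    using assms u_mod_f[of g] f_degree by (auto simp: degree_mod_lt)
  from torsion_small[OF this] show ?thesis using u_power_cong[OF u_mod_f[of g]] by simp
qed

text \<open>
  A multiple \<open>H\<close> of \<open>f\<close> that is a monic polynomial in \<open>\<phi>\<close> with constant coefficients is obtained from an integral
  equation for \<open>\<phi>\<^sup>N/c\<close>, an element of value \<open>0\<close>; its leading index is the full degree \<open>Nr\<close> in \<open>\<phi>\<close>.
  Write \<open>H = f q\<close>. Leading indices of \<open>f\<close> and \<open>q\<close> add up to \<open>Nr\<close>, and each, times the degree of \<open>\<phi>\<close>, is at
  most the degree of the factor. The degrees add up as well, so both bounds are equalities.
\<close>

lemma leading_index_f:
  assumes \<phi>: "abstract_key \<phi>" and fin: "u \<phi> \<noteq> Infty"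
  obtains e where "d = e * degree \<phi>" "leading_index \<phi> f e" "trunc \<phi> f = u (\<phi> ^ e)"
proof -
  note k = abstract_keyD[OF \<phi>]
  obtain N c where N: "N > 0" "c \<noteq> 0" "u (\<phi> ^ N) = u [:c:]" using torsion[OF fin] by blast
  define h where "h = \<phi> ^ N * [:1 / c:]"
  have "u h + u [:c:] = u (\<phi> ^ N)" using N(2) by (simp add: h_def u_mult[symmetric] mult.assoc)
  hence "u h = 0" using N v0_finite[OF N(2)] by (cases "u h"; cases "u [:c:]") (auto simp: u_const)
  then obtain G where G: "lead_coeff G = 1" "\<forall>i. 0 \<le> v0 (poly.coeff G i)" "f dvd pcompose G h"
    using integral by blast
  define r where "r = degree G"
  define t where "t i = [:poly.coeff G i * c ^ (r - i):] * \<phi> ^ (N * i)" for i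
  define H where "H = (\<Sum>i\<le>r. t i)"
  have "[:c ^ r:] * pcompose G h = H"
  proof -
    have "pcompose G h = (\<Sum>i\<le>r. [:poly.coeff G i:] * h ^ i)"
      by (simp add: pcompose_altdef poly_altdef r_def degree_map_poly coeff_map_poly)
    moreover have "[:c ^ r:] * ([:poly.coeff G i:] * h ^ i) = t i" if "i \<le> r" for i
    proof -
      have "c ^ r = c ^ (r - i) * c ^ i" using that by (simp add: power_add[symmetric])
      thus ?thesis using N(2)
        by (simp add: h_def t_def power_mult_distrib poly_const_pow power_mult[symmetric] power_divide mult.commute smult_power)
    qed
    ultimately show ?thesis by (simp add: H_def sum_distrib_left)
  qed
  with G(3) obtain q where q: "H = f * q" by (metis dvd_mult dvdE)
  have tmH: "exp_term \<phi> H n = (\<Sum>i\<le>r. if n = N * i then t i else 0)" for n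
  proof -
    have "exp_term \<phi> (t i) n = (if n = N * i then t i else 0)" for i
      unfolding t_def using k(2) by (intro exp_term_monomial) simp
    thus ?thesis using k(2) by (simp add: H_def exp_term_sum)
  qed
  have top: "t r = \<phi> ^ (N * r)" using G(1) by (simp add: t_def r_def flip: one_pCons)
  have tge: "u (\<phi> ^ (N * r)) \<le> u (t i)" if "i \<le> r" for i
  proof -
    have "u (\<phi> ^ (N * r)) = u ([:c:] ^ r)" using u_power_cong[OF N(3), of r] by (simp add: power_mult)
    also have "\<dots> = 0 + (u ([:c:] ^ (r - i)) + u ([:c:] ^ i))"
      using that by (simp add: u_mult[symmetric] power_add[symmetric])
    also have "u ([:c:] ^ i) = u ((\<phi> ^ N) ^ i)" using u_power_cong[OF N(3), of i] by simp
    also have "0 + (u ([:c:] ^ (r - i)) + u ((\<phi> ^ N) ^ i)) \<le>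
        u [:poly.coeff G i:] + (u ([:c:] ^ (r - i)) + u ((\<phi> ^ N) ^ i))"
      using G(2) by (intro add_right_mono) (simp add: u_const)
    also have "\<dots> = u (t i)"
      by (simp add: t_def poly_const_pow power_mult u_mult[symmetric] mult.assoc[symmetric] mult.commute)
    finally show ?thesis .
  qed
  have p: "u (\<phi> ^ i) \<noteq> Infty" for i using fin by (induction i) (auto simp: u_mult)
  have tmr: "exp_term \<phi> H (N * r) = \<phi> ^ (N * r)"
    using N(1) top by (simp add: tmH sum.delta)
  have WH: "trunc \<phi> H = u (\<phi> ^ (N * r))"
  proof (rule antisym)
    show "trunc \<phi> H \<le> u (\<phi> ^ (N * r))" using trunc_le[of \<phi> H "N * r"] tmr by simp
    show "u (\<phi> ^ (N * r)) \<le> trunc \<phi> H" unfolding le_trunc_iff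
    proof
      fix n show "u (\<phi> ^ (N * r)) \<le> u (exp_term \<phi> H n)"
        unfolding tmH using tge by (intro u_sum_ge) auto
    qed
  qed
  have "exp_term \<phi> H i = 0" if "i > N * r" for i
    unfolding tmH using that by (intro sum.neutral) (auto simp: leD)
  hence leadH: "leading_index \<phi> H (N * r)" using WH tmr p by (simp add: leading_index_def)
  have H0: "H \<noteq> 0" using WH p trunc_0[OF k(2)] by metis
  hence f0: "f \<noteq> 0" "q \<noteq> 0" using q by auto
  obtain s1 s2 where s: "leading_index \<phi> f s1" "leading_index \<phi> q s2" using leading_index_exists trunc_finite[OF k(2,3) fin] f0 by meson
  have sum: "s1 + s2 = N * r" using leading_index_mult(1)[OF \<phi> fin s] leadH leading_index_unique q by metis
  have ne: "exp_term \<phi> f s1 \<noteq> 0" "exp_term \<phi> q s2 \<noteq> 0" using s by (auto simp: leading_index_def)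
  have le: "s1 * degree \<phi> \<le> d" "s2 * degree \<phi> \<le> degree q"
    using exp_term_degree_le(1)[OF k(2,1)] ne by auto
  have "degree H \<le> N * r * degree \<phi>"
    unfolding H_def
  proof (rule degree_sum_le)
    fix i assume i: "i \<in> {..r}"
    have "degree (t i) \<le> degree (\<phi> ^ (N * i))" by (simp add: t_def)
    also have "\<dots> = N * i * degree \<phi>" using k(4) by (simp add: degree_power_eq)
    also have "\<dots> \<le> N * r * degree \<phi>" using i by simp
    finally show "degree (t i) \<le> N * r * degree \<phi>" .
  qed simp
  moreover have "degree H = d + degree q" using f0 by (simp add: q degree_mult_eq)
  ultimately have "d + degree q \<le> s1 * degree \<phi> + s2 * degree \<phi>"
    using sum by (simp add: add_mult_distrib[symmetric])
  hence d: "d = s1 * degree \<phi>" using le by linarith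
  moreover have "exp_term \<phi> f s1 = \<phi> ^ s1" using exp_term_degree_le(2)[OF k(2,1) ne(1)] d f_monic by simp
  hence "trunc \<phi> f = u (\<phi> ^ s1)" using s(1) by (simp add: leading_index_def)
  ultimately show ?thesis using s(1) that by blast
qed

lemma trunc_jump_power:
  assumes "abstract_key \<phi>" "u \<phi> \<noteq> Infty" "jump \<phi> \<psi>" "k > 0"
  shows "trunc \<phi> (\<psi> ^ k) < u (\<psi> ^ k)"
  using jump_mult[OF assms(1-3), of "\<psi> ^ (k - 1)"] jump_simps(3)[OF assms(1-3)] assms(4)
  by (simp add: power_Suc2[symmetric])

lemma infinite_jump:
  assumes "abstract_key \<psi>" "u \<psi> = Infty"
  shows "\<psi> = f"
proof -
  note k = abstract_keyD[OF assms(1)]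
  obtain q where q: "\<psi> = f * q" using assms(2) u_Infty by auto
  hence q0: "f \<noteq> 0" "q \<noteq> 0" using k(4) by auto
  hence "degree q = 0" using k(3) q by (simp add: degree_mult_eq)
  then obtain c where "q = [:c:]" by (rule degree_eq_zeroE)
  moreover have "lead_coeff q = 1" using k(1) f_monic q by (simp add: lead_coeff_mult)
  ultimately have "q = 1" by (simp add: one_pCons)
  thus ?thesis using q by simp
qed

text \<open>
  For the truncation at \<open>\<phi>\<close>, \<open>f\<close> is equivalent to a power of \<open>\<psi>\<close>: in the expansion of \<open>f\<close> in powers of \<open>\<psi>\<close> the
  other terms are at least as large as the top one for \<open>u\<close>, and become strictly larger when \<open>\<psi>\<close> is given
  its smaller truncated value. Comparing leading indices of \<open>f\<close> and of that power gives the
  divisibility.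
\<close>

lemma jump_degree_dvd:
  assumes "abstract_key \<phi>" "u \<phi> \<noteq> Infty" "jump \<phi> \<psi>"
  shows "degree \<phi> dvd degree \<psi>"
proof -
  note k = abstract_keyD[OF assms(1)]
  note \<psi> = jump_abstract_key[OF assms] and j = jump_simps[OF assms]
  obtain e where e: "d = e * degree \<phi>" "leading_index \<phi> f e" using leading_index_f[OF assms(1,2)] by blast
  show ?thesis
  proof (cases "u \<psi> = Infty")
    case True
    thus ?thesis using infinite_jump[OF \<psi>] e by simp
  next
    case False
    obtain e' where e': "d = e' * degree \<psi>" "leading_index \<psi> f e'" "trunc \<psi> f = u (\<psi> ^ e')"
      using leading_index_f[OF \<psi> False] by blast
    note k' = abstract_keyD[OF \<psi>]
    have p: "u (\<psi> ^ i) \<noteq> Infty" for i using False by (induction i) (auto simp: u_mult)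
    have Wp: "trunc \<phi> (\<psi> ^ i) \<noteq> Infty" for i using trunc_fin[OF assms] j(3) by simp
    define a where "a = poly.coeff (phi_expansion \<psi> f)"
    have t: "exp_term \<psi> f i = a i * \<psi> ^ i" for i by (simp add: exp_term_def a_def)
    have da: "degree (a i) < degree \<psi>" for i
      using phi_expansion(1)[OF k'(2)] by (simp add: is_expansion_def a_def)
    have top: "exp_term \<psi> f e' = \<psi> ^ e'"
    proof -
      have "exp_term \<psi> f e' \<noteq> 0" using e'(2) by (auto simp: leading_index_def)
      from exp_term_degree_le(2)[OF k'(2,1) this] show ?thesis using e'(1) f_monic by simp
    qed
    have small: "trunc \<phi> (\<psi> ^ e') < trunc \<phi> (exp_term \<psi> f i)" if "i < e'" for i
    proof -
      have "u (\<psi> ^ (e' - i)) + u (\<psi> ^ i) = u (\<psi> ^ e')"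
        using that by (simp add: u_mult[symmetric] power_add[symmetric])
      also have "\<dots> \<le> u (exp_term \<psi> f i)" using e'(3) trunc_le by metis
      also have "\<dots> = u (a i) + u (\<psi> ^ i)" by (simp add: t u_mult)
      finally have "u (\<psi> ^ (e' - i)) \<le> u (a i)"
        using p[of i] by (cases "u (\<psi> ^ (e' - i))"; cases "u (a i)"; cases "u (\<psi> ^ i)") auto
      hence "trunc \<phi> (\<psi> ^ (e' - i)) < trunc \<phi> (a i)"
        using trunc_jump_power[OF assms, of "e' - i"] that j(4)[OF da] by simp
      hence "trunc \<phi> (\<psi> ^ (e' - i)) + trunc \<phi> (\<psi> ^ i) < trunc \<phi> (a i) + trunc \<phi> (\<psi> ^ i)"
        using Wp by (intro ext_add_strict_right)
      thus ?thesis using that by (simp add: trunc_mult[OF assms(1,2), symmetric] t power_add[symmetric])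
    qed
    have n: "degree (phi_expansion \<psi> f) \<le> e'"
    proof (rule ccontr)
      assume c: "\<not> ?thesis"
      hence "phi_expansion \<psi> f \<noteq> 0" by auto
      hence "a (degree (phi_expansion \<psi> f)) \<noteq> 0" by (simp add: a_def)
      hence "exp_term \<psi> f (degree (phi_expansion \<psi> f)) \<noteq> 0" using k'(4) by (simp add: t)
      from exp_term_degree_le(1)[OF k'(2,1) this] e'(1) c k'(2) show False by simp
    qed
    have "f = (\<Sum>i\<le>e'. exp_term \<psi> f i)"
      by (subst sum_exp_term[OF k'(2)]) (rule sum.mono_neutral_left, use n exp_term_gt_degree in auto)
    hence "f = (\<Sum>i<e'. exp_term \<psi> f i) + \<psi> ^ e'" using top by (simp add: lessThan_Suc_atMost[symmetric])
    hence "f - \<psi> ^ e' = (\<Sum>i<e'. exp_term \<psi> f i)" by (metis add_diff_cancel_right')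
    hence gt: "trunc \<phi> (\<psi> ^ e') < trunc \<phi> (f - \<psi> ^ e')" using Wp by (auto intro!: trunc_sum_gt[OF k(2)] small)
    obtain s where s: "leading_index \<phi> \<psi> s" using leading_index_exists trunc_fin[OF assms] j(3) by meson
    have "leading_index \<phi> (\<psi> ^ i) (i * s)" for i
    proof (induction i)
      case 0
      have "exp_term \<phi> 1 0 = 1" "\<And>i. i > 0 \<Longrightarrow> exp_term \<phi> 1 i = 0" using k(2) by (simp_all add: exp_term_small)
      thus ?case using trunc_small[OF k(2), of 1] k(2) by (simp add: leading_index_def)
    next
      case (Suc i)
      thus ?case using leading_index_mult(1)[OF assms(1,2) s Suc] by simp
    qed
    hence "leading_index \<phi> f (e' * s)" using leading_index_equiv[OF k(2) _ gt] by blast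
    hence "e' * s = e" using e leading_index_unique by blast
    hence "e' * degree \<psi> = e' * (s * degree \<phi>)" using e e' by simp
    moreover have "e' > 0" using e'(1) f_degree by (cases e') auto
    ultimately have "degree \<psi> = s * degree \<phi>" by simp
    thus ?thesis by simp
  qed
qed

lemma jump_exists:
  assumes "abstract_key \<phi>" "u \<phi> \<noteq> Infty"
  shows "\<exists>\<psi>. jump \<phi> \<psi>"
proof -
  note k = abstract_keyD[OF assms(1)]
  let ?P = "\<lambda>n. \<exists>g. degree g = n \<and> trunc \<phi> g < u g"
  have "f \<noteq> 0" using f_degree by auto
  hence "trunc \<phi> f < u f" using trunc_finite[OF k(2,3) assms(2)] u_Infty[of f] by simp
  hence "\<exists>n. ?P n" by blast
  from exists_least_iff[THEN iffD1, OF this]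
  obtain n where n: "?P n" "\<And>m. m < n \<Longrightarrow> \<not> ?P m" by blast
  then obtain g where g: "degree g = n" "trunc \<phi> g < u g" by blast
  have g0: "g \<noteq> 0" using g(2) trunc_0[OF k(2)] by auto
  define c where "c = 1 / lead_coeff g"
  have c: "c \<noteq> 0" using g0 by (simp add: c_def)
  have "trunc \<phi> ([:c:] * g) = trunc \<phi> [:c:] + trunc \<phi> g" by (rule trunc_mult[OF assms])
  also have "\<dots> < u [:c:] + u g"
    using g(2) c trunc_small[OF k(2)] k(2) v0_finite by (intro ext_add_le_less) (auto simp: u_const)
  also have "\<dots> = u ([:c:] * g)" by (rule u_mult[symmetric])
  finally have lt: "trunc \<phi> ([:c:] * g) < u ([:c:] * g)" .
  have "trunc \<phi> h = u h" if "degree h < degree ([:c:] * g)" for h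
    using n(2)[of "degree h"] that c g(1) trunc_le_u[OF k(2), of h] by (auto simp: less_le)
  moreover have "lead_coeff ([:c:] * g) = 1" using g0 by (simp add: c_def)
  ultimately have "jump \<phi> ([:c:] * g)" using lt by (simp add: jump_def)
  thus ?thesis ..
qed

end

section \<open>Approximate roots\<close>

lemma power_sum_coeff:
  fixes \<psi>1 \<psi>2 :: "'k::field poly"
  assumes "lead_coeff \<psi>1 = 1" "lead_coeff \<psi>2 = 1"
    "degree \<psi>1 = D" "degree \<psi>2 = D"
  shows "degree (\<Sum>i<e. \<psi>1 ^ (e - Suc i) * \<psi>2 ^ i) \<le> (e - 1) * D"
    "poly.coeff (\<Sum>i<e. \<psi>1 ^ (e - Suc i) * \<psi>2 ^ i) ((e - 1) * D) = of_nat e"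
proof -
  have ne: "\<psi>1 \<noteq> 0" "\<psi>2 \<noteq> 0" using assms by auto
  have deg: "degree (\<psi>1 ^ (e - Suc i) * \<psi>2 ^ i) = (e - 1) * D" if "i < e" for i
  proof -
    have "degree (\<psi>1 ^ (e - Suc i) * \<psi>2 ^ i) = (e - Suc i) * D + i * D"
      using ne assms by (simp add: degree_mult_eq degree_power_eq)
    also have "\<dots> = (e - 1) * D" using that by (simp add: add_mult_distrib[symmetric])
    finally show ?thesis .
  qed
  thus "degree (\<Sum>i<e. \<psi>1 ^ (e - Suc i) * \<psi>2 ^ i) \<le> (e - 1) * D"
    by (intro degree_sum_le) auto
  have "poly.coeff (\<psi>1 ^ (e - Suc i) * \<psi>2 ^ i) ((e - 1) * D) = 1" if "i < e" for i
    using deg[OF that] assms(1,2) by (metis lead_coeff_mult lead_coeff_power mult_1 power_one)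
  thus "poly.coeff (\<Sum>i<e. \<psi>1 ^ (e - Suc i) * \<psi>2 ^ i) ((e - 1) * D) = of_nat e"
    by (simp add: coeff_sum)
qed

lemma coeff_mult_top:
  fixes p q :: "'k::field poly"
  assumes "degree p \<le> m" "degree q \<le> n"
  shows "poly.coeff (p * q) (m + n) = poly.coeff p m * poly.coeff q n"
proof (cases "degree p = m \<and> degree q = n")
  case True
  thus ?thesis using coeff_mult_degree_sum[of p q] by simp
next
  case False
  hence lt: "degree p < m \<or> degree q < n" using assms by auto
  have "degree (p * q) < m + n" using lt assms degree_mult_le[of p q] by linarith
  hence "poly.coeff (p * q) (m + n) = 0" by (rule coeff_eq_0)
  moreover have "poly.coeff p m = 0 \<or> poly.coeff q n = 0" using lt by (auto simp: coeff_eq_0)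
  ultimately show ?thesis by auto
qed

text \<open>
  Changing \<open>\<psi>\<close> by \<open>b\<close> changes the \<open>e\<close>-th power, in its top degrees, by \<open>e b \<psi>\<^sup>e\<^sup>-\<^sup>1\<close> only. Thus the
  coefficients of an \<open>e\<close>-th root can be corrected one at a time from the top, dividing by \<open>e\<close>.
\<close>

lemma power_add_coeff:
  fixes \<psi> b :: "'k::field poly"
  assumes "lead_coeff \<psi> = 1" "degree \<psi> = D" "degree b \<le> i" "i < D"
  shows "poly.coeff ((\<psi> + b) ^ e - \<psi> ^ e) ((e - 1) * D + i) = of_nat e * poly.coeff b i"
    "j > (e - 1) * D + i \<Longrightarrow> poly.coeff ((\<psi> + b) ^ e - \<psi> ^ e) j = 0"
proof -
  let ?S = "\<Sum>i<e. \<psi> ^ (e - Suc i) * (\<psi> + b) ^ i"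
  have lt: "degree b < degree \<psi>" using assms by simp
  have m: "lead_coeff (\<psi> + b) = 1" "degree (\<psi> + b) = D"
    using lt assms degree_add_eq_left[OF lt] by (auto simp: coeff_eq_0)
  note S = power_sum_coeff[OF assms(1) m(1) assms(2) m(2), of e]
  have eq: "(\<psi> + b) ^ e - \<psi> ^ e = b * ?S" by (simp add: power_diff_sumr2)
  show "poly.coeff ((\<psi> + b) ^ e - \<psi> ^ e) ((e - 1) * D + i) = of_nat e * poly.coeff b i"
    unfolding eq using coeff_mult_top[OF assms(3) S(1)] S(2) by (simp add: add.commute mult.commute)
  assume "j > (e - 1) * D + i"
  moreover have "degree (b * ?S) \<le> i + (e - 1) * D"
    using degree_mult_le[of b ?S] assms(3) S(1) by linarith
  ultimately show "poly.coeff ((\<psi> + b) ^ e - \<psi> ^ e) j = 0"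
    unfolding eq by (intro coeff_eq_0) simp
qed

lemma polys_over_mult:
  assumes "subring A (cring_class_ops :: 'k::field ring)" "p \<in> polys_over A" "q \<in> polys_over A"
  shows "p * q \<in> polys_over A"
  unfolding polys_over_def
proof (intro CollectI allI)
  fix i
  have A: "0 \<in> A" "\<And>a b. a \<in> A \<Longrightarrow> b \<in> A \<Longrightarrow> a + b \<in> A" "\<And>a b. a \<in> A \<Longrightarrow> b \<in> A \<Longrightarrow> a * b \<in> A"
    using subringE[OF assms(1)] by (auto simp: cring_class_ops_def)
  have s: "(\<And>i. i \<in> I \<Longrightarrow> g i \<in> A) \<Longrightarrow> sum g I \<in> A" for g :: "nat \<Rightarrow> 'k" and I
    by (induction I rule: infinite_finite_induct) (auto simp: A)
  show "poly.coeff (p * q) i \<in> A"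
    unfolding coeff_mult using assms by (intro s A) (auto simp: polys_over_def)
qed

locale tame_val = integral_val f u v0
  for f :: "'k::field poly" and u :: "'k poly \<Rightarrow> 'g::linordered_ab_group_add ext_value" and v0 +
  fixes A :: "'k set"
  assumes A_subring: "subring A (cring_class_ops :: 'k ring)"
    and A_nonneg: "a \<in> A \<Longrightarrow> 0 \<le> v0 a"
    and f_over: "f \<in> polys_over A"
    and degree_inverse: "e dvd degree f \<Longrightarrow> (of_nat e :: 'k) \<noteq> 0 \<and> inverse (of_nat e) \<in> A"
begin

lemma A_closed: "0 \<in> A" "1 \<in> A" "a \<in> A \<Longrightarrow> b \<in> A \<Longrightarrow> a + b \<in> A" "a \<in> A \<Longrightarrow> b \<in> A \<Longrightarrow> a * b \<in> A"
  "a \<in> A \<Longrightarrow> - a \<in> A" "a \<in> A \<Longrightarrow> b \<in> A \<Longrightarrow> a - b \<in> A"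
  "of_nat n \<in> A"
proof -
  show 1: "0 \<in> A" "1 \<in> A" "a \<in> A \<Longrightarrow> b \<in> A \<Longrightarrow> a + b \<in> A" "a \<in> A \<Longrightarrow> b \<in> A \<Longrightarrow> a * b \<in> A" for a b
    using subringE[OF A_subring] by (auto simp: cring_class_ops_def)
  show 2: "a \<in> A \<Longrightarrow> - a \<in> A" for a using subringE(5)[OF A_subring] by (simp add: uminus_class)
  show "a \<in> A \<Longrightarrow> b \<in> A \<Longrightarrow> a - b \<in> A" using 1(3)[of a "- b"] 2 by simp
  show "of_nat n \<in> A" by (induction n) (auto intro: 1)
qed

lemma over_closed: "0 \<in> polys_over A" "1 \<in> polys_over A"
  "p \<in> polys_over A \<Longrightarrow> q \<in> polys_over A \<Longrightarrow> p + q \<in> polys_over A"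
  "p \<in> polys_over A \<Longrightarrow> q \<in> polys_over A \<Longrightarrow> p - q \<in> polys_over A"
  "p \<in> polys_over A \<Longrightarrow> q \<in> polys_over A \<Longrightarrow> p * q \<in> polys_over A"
  "a \<in> A \<Longrightarrow> Polynomial.monom a n \<in> polys_over A"
  "p \<in> polys_over A \<Longrightarrow> p ^ n \<in> polys_over A"
proof -
  show 1: "1 \<in> polys_over A" by (auto simp: polys_over_def A_closed coeff_1)
  show 2: "p \<in> polys_over A \<Longrightarrow> q \<in> polys_over A \<Longrightarrow> p * q \<in> polys_over A" for p q
    by (rule polys_over_mult[OF A_subring])
  show "p \<in> polys_over A \<Longrightarrow> p ^ n \<in> polys_over A" by (induction n) (auto intro: 1 2)
qed (auto simp: polys_over_def A_closed coeff_monom)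

text \<open>
  The degree condition on \<open>f - \<psi>\<^sup>e\<close> defining an approximate root, written with coefficients so that
  it also covers \<open>f = \<psi>\<^sup>e\<close>.
\<close>

definition approx_root :: "nat \<Rightarrow> 'k poly \<Rightarrow> bool" where
  "approx_root e \<psi> \<longleftrightarrow> (\<forall>j\<ge>(e - 1) * degree \<psi>. poly.coeff (f - \<psi> ^ e) j = 0)"

lemma approx_root_exists:
  assumes "d = e * D"
  shows "\<exists>P \<in> polys_over A. lead_coeff P = 1 \<and> degree P = D \<and> approx_root e P"
proof -
  have e: "e > 0" using assms f_degree by (cases e) auto
  have D: "D > 0" using assms f_degree by (cases D) auto
  have eD: "e * D = (e - 1) * D + D" using e by (cases e) auto
  have "\<exists>P \<in> polys_over A. lead_coeff P = 1 \<and> degree P = D \<and>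
      (\<forall>j\<ge>e * D - k. poly.coeff (f - P ^ e) j = 0)" if "k \<le> D" for k
    using that
  proof (induction k)
    case 0
    let ?P = "Polynomial.monom 1 D :: 'k poly"
    have "poly.coeff (f - ?P ^ e) j = 0" if "j \<ge> e * D" for j
      using that assms f_monic by (cases "j = e * D") (auto simp: monom_power coeff_monom coeff_eq_0 mult.commute)
    thus ?case using D by (intro bexI[of _ ?P]) (auto simp: degree_monom_eq over_closed A_closed)
  next
    case (Suc k)
    then obtain P where P: "P \<in> polys_over A" "lead_coeff P = 1" "degree P = D"
      "\<forall>j\<ge>e * D - k. poly.coeff (f - P ^ e) j = 0" by auto
    define i where "i = D - Suc k"
    have i: "i < D" "e * D - Suc k = (e - 1) * D + i" using Suc.prems eD D by (auto simp: i_def)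
    define c where "c = poly.coeff (f - P ^ e) ((e - 1) * D + i)"
    have c: "c \<in> A" using over_closed(4)[OF f_over over_closed(7)[OF P(1), of e]]
      by (simp add: c_def polys_over_def del: coeff_diff)
    note inv = degree_inverse[of e] assms
    define b where "b = Polynomial.monom (inverse (of_nat e) * c) i"
    have b: "b \<in> polys_over A" using inv c by (simp add: b_def over_closed A_closed)
    have db: "degree b \<le> i" by (simp add: b_def degree_monom_le)
    note pc = power_add_coeff[OF P(2,3) db i(1), of e]
    have "degree b < degree P" using db i P by simp
    hence P': "lead_coeff (P + b) = 1" "degree (P + b) = D"
      using P degree_add_eq_left[of b P] by (auto simp: coeff_eq_0)
    have "poly.coeff (f - (P + b) ^ e) j = 0" if "j \<ge> e * D - Suc k" for j
    proof -
      have eq: "f - (P + b) ^ e = (f - P ^ e) - ((P + b) ^ e - P ^ e)" by simp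
      show ?thesis
      proof (cases "j = (e - 1) * D + i")
        case True
        thus ?thesis unfolding eq coeff_diff[of "f - P ^ e"] using pc(1) inv by (simp add: b_def c_def)
      next
        case False
        hence "j > (e - 1) * D + i" "j \<ge> e * D - k" using that i(2) Suc.prems by auto
        thus ?thesis unfolding eq coeff_diff[of "f - P ^ e"] using pc(2) P(4) by simp
      qed
    qed
    thus ?case using P' P b by (intro bexI[of _ "P + b"]) (auto simp: over_closed)
  qed
  from this[of D] obtain P where P: "P \<in> polys_over A" "lead_coeff P = 1" "degree P = D"
      "\<forall>j\<ge>e * D - D. poly.coeff (f - P ^ e) j = 0" by auto
  thus ?thesis using eD by (auto simp: approx_root_def)
qed

lemma approx_root_unique:
  assumes "d = e * D" "lead_coeff P = 1" "degree P = D" "approx_root e P"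
    "lead_coeff Q = 1" "degree Q = D" "approx_root e Q"
  shows "P = Q"
proof (rule ccontr)
  assume ne: "P \<noteq> Q"
  let ?S = "\<Sum>i<e. Q ^ (e - Suc i) * P ^ i"
  note S = power_sum_coeff[OF assms(5,2,6,3), of e]
  let ?j = "degree (P - Q) + (e - 1) * D"
  have eq: "(f - Q ^ e) - (f - P ^ e) = (P - Q) * ?S" by (simp add: power_diff_sumr2[symmetric])
  have "poly.coeff ((P - Q) * ?S) ?j = lead_coeff (P - Q) * of_nat e"
    using coeff_mult_top[OF order_refl S(1)] S(2) by simp
  moreover have "poly.coeff ((f - Q ^ e) - (f - P ^ e)) ?j = 0"
    using assms by (simp add: approx_root_def del: diff_diff_eq2 add_diff_cancel)
  ultimately have "lead_coeff (P - Q) * of_nat e = 0" using eq by simp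
  moreover have "lead_coeff (P - Q) \<noteq> 0" using ne by (simp del: coeff_diff)
  ultimately show False using degree_inverse[of e] assms(1) by (simp del: coeff_diff)
qed

lemma u_of_nat:
  assumes "e dvd d"
  shows "u [:inverse (of_nat e):] = 0"
proof -
  have "0 \<le> v0 (of_nat e)" "0 \<le> v0 (inverse (of_nat e))" using degree_inverse[OF assms] A_nonneg A_closed by auto
  moreover have "v0 (of_nat e) + v0 (inverse (of_nat e)) = 0"
    using degree_inverse[OF assms] u_1 by (simp add: u_const[symmetric] u_mult[symmetric] one_pCons)
  ultimately show ?thesis unfolding u_const
    by (cases "v0 (of_nat e)"; cases "v0 (inverse (of_nat e))") (auto simp: zero_ext_value_def add_nonneg_eq_0_iff)
qed

text \<open>
  Tschirnhausen transformations. The coefficient \<open>a\<close> of \<open>\<psi>\<^sup>e\<^sup>-\<^sup>1\<close> in \<open>f\<close> has value at least \<open>u \<psi>\<close> by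
  \<open>leading_index_f\<close>, and \<open>e\<close> has value \<open>0\<close>, so \<open>\<psi> + a/e\<close> is again a candidate of no smaller value. It
  agrees with an \<open>e\<close>-th root of \<open>f\<close> in one more coefficient, which gives the induction on \<open>m\<close>.
\<close>

lemma approx_root_jump:
  assumes \<phi>: "abstract_key \<phi>" "u \<phi> \<noteq> Infty"
    and d: "d = e * D"
  shows "jump \<phi> \<psi> \<Longrightarrow> degree \<psi> = D \<Longrightarrow> \<forall>j\<ge>m. poly.coeff (f - \<psi> ^ e) j = 0 \<Longrightarrow> m \<le> e * D \<Longrightarrow>
    \<exists>\<psi>'. jump \<phi> \<psi>' \<and> degree \<psi>' = D \<and> approx_root e \<psi>'"
proof (induction m arbitrary: \<psi>)
  case 0
  thus ?case by (auto simp: approx_root_def)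
next
  case (Suc m)
  note k = abstract_keyD[OF \<phi>(1)]
  note j = jump_simps[OF \<phi> Suc.prems(1)]
  have e0: "e > 0" using d f_degree by (cases e) auto
  show ?case
  proof (cases "Suc m \<le> (e - 1) * D")
    case True
    thus ?thesis using Suc.prems by (auto simp: approx_root_def)
  next
    case False
    hence m: "(e - 1) * D \<le> m" by simp
    have eD: "e * D = (e - 1) * D + D" using e0 by (cases e) auto
    define \<Delta> where "\<Delta> = f - \<psi> ^ e"
    show ?thesis
    proof (cases "poly.coeff \<Delta> m = 0")
      case True
      have "\<forall>j\<ge>m. poly.coeff (f - \<psi> ^ e) j = 0"
        using True Suc.prems(3) unfolding \<Delta>_def by (metis le_neq_implies_less Suc_leI)
      thus ?thesis using Suc by simp
    next
      case nz: False
      have d\<Delta>: "degree \<Delta> = m"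
        using nz Suc.prems(3) by (intro antisym degree_le le_degree) (auto simp: \<Delta>_def Suc_le_eq)
      have fin: "u \<psi> \<noteq> Infty"
      proof
        assume "u \<psi> = Infty"
        hence "\<psi> = f" using infinite_jump jump_abstract_key[OF \<phi> Suc.prems(1)] by blast
        moreover from this have "e = 1" using d Suc.prems(2) f_degree by auto
        ultimately show False using nz by (simp add: \<Delta>_def)
      qed
      have ak: "abstract_key \<psi>" by (rule jump_abstract_key[OF \<phi> Suc.prems(1)])
      note k' = abstract_keyD[OF ak]
      obtain e' where e': "d = e' * degree \<psi>" "trunc \<psi> f = u (\<psi> ^ e')" using leading_index_f[OF ak fin] by blast
      have ee: "e' = e" using e'(1) d Suc.prems(2) k'(2) by simp
      define x where "x = phi_expansion \<psi> \<Delta>"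
      have x0: "x \<noteq> 0" using nz phi_expansion(2)[OF k'(2), of \<Delta>] by (auto simp: x_def)
      note ex = phi_expansion[OF k'(2), of \<Delta>, folded x_def]
      note dx = expansion_degree[OF k'(2,1) ex(1) x0, unfolded ex(2)]
      have dl: "degree (lead_coeff x) < D"
        using ex(1) Suc.prems(2) by (simp add: is_expansion_def)
      have mD: "m = degree x * D + degree (lead_coeff x)"
        using dx(1) d\<Delta> Suc.prems(2) by simp
      have "m div D = degree x" using dl by (simp add: mD)
      moreover have "m div D = e - 1"
        using m Suc.prems(4) eD dl by (intro div_nat_eqI) (auto simp: mult.commute)
      ultimately have dxe: "degree x = e - 1" by simp
      define a where "a = lead_coeff x"
      define b where "b = [:inverse (of_nat e):] * a"
      define i where "i = degree a"
      have i: "i < D" "m = (e - 1) * D + i" using dl mD dxe by (auto simp: a_def i_def)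
      have db: "degree b \<le> i" by (simp add: b_def i_def)
      have tmx: "exp_term \<psi> \<Delta> (e - 1) = a * \<psi> ^ (e - 1)" by (simp add: exp_term_def x_def[symmetric] a_def dxe)
      have p: "u (\<psi> ^ i) \<noteq> Infty" for i using fin by (induction i) (auto simp: u_mult)
      have "u (\<psi> ^ e) \<le> trunc \<psi> \<Delta>"
        using trunc_diff[OF k'(2), of f "\<psi> ^ e"] trunc_self[OF k'(2)] e'(2) by (simp add: ee \<Delta>_def)
      also have "\<dots> \<le> u (exp_term \<psi> \<Delta> (e - 1))" by (rule trunc_le)
      also have "\<dots> = u a + u (\<psi> ^ (e - 1))" by (simp only: tmx u_mult)
      finally have "u \<psi> + u (\<psi> ^ (e - 1)) \<le> u a + u (\<psi> ^ (e - 1))"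
        using e0 by (simp add: u_mult[symmetric] power_Suc[symmetric] del: power_Suc)
      hence "u \<psi> \<le> u a" using p[of "e - 1"] by (cases "u \<psi>"; cases "u a"; cases "u (\<psi> ^ (e - 1))") auto
      moreover have "u b = u a" using u_of_nat[of e] d unfolding b_def by (simp only: u_mult) simp
      ultimately have ub: "u \<psi> \<le> u b" by simp
      have "degree b < degree \<psi>" using db i(1) Suc.prems(2) by simp
      hence \<psi>': "lead_coeff (\<psi> + b) = 1" "degree (\<psi> + b) = D" and Wb: "trunc \<phi> b = u b"
        using j Suc.prems(2) degree_add_eq_left[of b \<psi>] by (auto simp: coeff_eq_0)
      have lt: "trunc \<phi> \<psi> < trunc \<phi> b" using Wb ub j(2) by simp
      have "trunc \<phi> (\<psi> + b) = trunc \<phi> \<psi>"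
      proof -
        show ?thesis using trunc_diff_eq(1)[OF k(2), where g = \<psi> and h = "- b"] lt trunc_uminus[OF k(2)] by simp
      qed
      moreover have "u \<psi> \<le> u (\<psi> + b)" using ub u_add[of \<psi> b] by simp
      ultimately have jump': "jump \<phi> (\<psi> + b)"
        using \<psi>' j Suc.prems(2) by (simp add: jump_def)
      note pc = power_add_coeff[OF j(1) Suc.prems(2) db i(1), of e]
      have "poly.coeff (f - (\<psi> + b) ^ e) j = 0" if "j \<ge> m" for j
      proof -
        have eq: "f - (\<psi> + b) ^ e = \<Delta> - ((\<psi> + b) ^ e - \<psi> ^ e)" by (simp add: \<Delta>_def)
        show ?thesis
        proof (cases "j = m")
          case True
          have "poly.coeff \<Delta> m = poly.coeff a i" using dx(2) d\<Delta> by (simp add: a_def i_def)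
          thus ?thesis unfolding eq coeff_diff[of \<Delta>] using pc(1) True i(2) degree_inverse[of e] d
            by (simp add: b_def)
        next
          case False
          thus ?thesis unfolding eq coeff_diff[of \<Delta>] using pc(2) that i(2) d\<Delta> by (simp add: coeff_eq_0)
        qed
      qed
      thus ?thesis using Suc.IH[OF jump' \<psi>'(2)] Suc.prems(4) by simp
    qed
  qed
qed

lemma next_key:
  assumes \<phi>: "abstract_key \<phi>" "u \<phi> \<noteq> Infty"
  obtains \<psi> e where "jump \<phi> \<psi>" "\<psi> \<in> polys_over A" "d = e * degree \<psi>" "approx_root e \<psi>"
proof -
  obtain \<psi>0 where j0: "jump \<phi> \<psi>0" using jump_exists[OF \<phi>] by blast
  note ak = jump_abstract_key[OF \<phi> j0]
  have "\<exists>e. d = e * degree \<psi>0"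
  proof (cases "u \<psi>0 = Infty")
    case True
    thus ?thesis using infinite_jump[OF ak] by (auto intro: exI[of _ 1])
  next
    case False
    thus ?thesis using leading_index_f[OF ak False] by metis
  qed
  then obtain e where e: "d = e * degree \<psi>0" by blast
  have \<psi>0: "\<psi>0 \<noteq> 0" using jump_simps[OF \<phi> j0] by simp
  have "poly.coeff (f - \<psi>0 ^ e) j = 0" if "j \<ge> e * degree \<psi>0" for j
  proof (cases "j = e * degree \<psi>0")
    case True
    have "poly.coeff (\<psi>0 ^ e) j = 1"
      using jump_simps(1)[OF \<phi> j0] True \<psi>0 by (metis degree_power_eq lead_coeff_power power_one)
    thus ?thesis using f_monic True e by simp
  next
    case False
    thus ?thesis using that e \<psi>0 by (simp add: coeff_eq_0 degree_power_eq)
  qed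
  from approx_root_jump[OF \<phi> e j0 refl, of "e * degree \<psi>0"] this obtain \<psi>
    where \<psi>: "jump \<phi> \<psi>" "degree \<psi> = degree \<psi>0" "approx_root e \<psi>" by auto
  obtain P where P: "P \<in> polys_over A" "lead_coeff P = 1" "degree P = degree \<psi>0" "approx_root e P"
    using approx_root_exists[OF e] by blast
  have "\<psi> = P" using approx_root_unique[OF e _ \<psi>(2,3) P(2,3,4)] jump_simps[OF \<phi> \<psi>(1)] by simp
  thus ?thesis using that \<psi> P e by metis
qed

definition is_approx :: "'k poly \<Rightarrow> bool" where
  "is_approx \<psi> \<longleftrightarrow> (\<exists>e. d = e * degree \<psi> \<and> approx_root e \<psi>)"

text \<open>
  If \<open>\<phi>\<close> is already an approximate root, a candidate of the same degree would lead to the same approximate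
  root \<open>\<phi>\<close>, on which the truncation at \<open>\<phi>\<close> and \<open>u\<close> agree. So degrees grow from then on; the second
  summand of the measure accounts for the first polynomial, which need not be an approximate root.
\<close>

lemma chain_exists:
  "abstract_key \<phi> \<Longrightarrow> \<phi> \<in> polys_over A \<Longrightarrow>
   \<exists>n s. 1 \<le> n \<and> s 1 = \<phi> \<and> s n = f \<and> (\<forall>k\<in>{1..n}. abstract_key (s k) \<and> s k \<in> polys_over A) \<and>
     (\<forall>k\<in>{1..<n}. u (s k) \<noteq> Infty \<and> jump (s k) (s (Suc k)))"
proof (induction "2 * (d - degree \<phi>) + (if is_approx \<phi> then 0 else 1)" arbitrary: \<phi> rule: less_induct)
  case less
  show ?case
  proof (cases "u \<phi> = Infty")
    case True
    thus ?thesis using infinite_jump[OF less.prems(1)] less.prems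
      by (intro exI[of _ 1] exI[of _ "\<lambda>_. f"]) auto
  next
    case False
    obtain \<psi> e where \<psi>: "jump \<phi> \<psi>" "\<psi> \<in> polys_over A" "d = e * degree \<psi>" "approx_root e \<psi>"
      using next_key[OF less.prems(1) False] by blast
    note ak = jump_abstract_key[OF less.prems(1) False \<psi>(1)]
    have a\<psi>: "is_approx \<psi>" using \<psi> by (auto simp: is_approx_def)
    have le: "degree \<phi> \<le> degree \<psi>" "degree \<psi> \<le> d"
      using jump_degree[OF less.prems(1) False \<psi>(1)] abstract_keyD[OF ak] by auto
    have "degree \<phi> < degree \<psi>" if "is_approx \<phi>"
    proof (rule ccontr)
      assume "\<not> ?thesis"
      hence eq: "degree \<phi> = degree \<psi>" using le by simp
      from \<open>is_approx \<phi>\<close> obtain e' where e': "d = e' * degree \<phi>" "approx_root e' \<phi>"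
        unfolding is_approx_def by blast
      hence "e' = e" using \<psi>(3) eq abstract_keyD(2)[OF less.prems(1)] by simp
      hence "\<phi> = \<psi>"
        using approx_root_unique[OF \<psi>(3) _ eq _ _ refl \<psi>(4)] e' abstract_keyD(1)[OF less.prems(1)] abstract_keyD(1)[OF ak] by simp
      thus False using jump_simps(2)[OF less.prems(1) False \<psi>(1)] trunc_self[OF abstract_keyD(2)[OF less.prems(1)], of 1] by simp
    qed
    hence "2 * (d - degree \<psi>) + (if is_approx \<psi> then 0 else 1) <
        2 * (d - degree \<phi>) + (if is_approx \<phi> then 0 else 1)"
      using a\<psi> le by auto
    from less.hyps[OF this ak \<psi>(2)] obtain n s where
      s: "1 \<le> n" "s 1 = \<psi>" "s n = f" "\<forall>k\<in>{1..n}. abstract_key (s k) \<and> s k \<in> polys_over A"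
        "\<forall>k\<in>{1..<n}. u (s k) \<noteq> Infty \<and> jump (s k) (s (Suc k))" by blast
    define s' where "s' k = (if k \<le> 1 then \<phi> else s (k - 1))" for k
    have "abstract_key (s' k) \<and> s' k \<in> polys_over A" if "k \<in> {1..Suc n}" for k
    proof (cases "k \<le> 1")
      case False
      hence "k - 1 \<in> {1..n}" using that by auto
      thus ?thesis using s(4) False by (simp add: s'_def)
    qed (use less.prems in \<open>simp add: s'_def\<close>)
    moreover have "u (s' k) \<noteq> Infty \<and> jump (s' k) (s' (Suc k))" if "k \<in> {1..<Suc n}" for k
    proof (cases "k = 1")
      case True
      thus ?thesis using s(2) \<psi>(1) False by (simp add: s'_def)
    next
      case False
      hence k: "k - 1 \<in> {1..<n}" "Suc (k - 1) = k" using that by auto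
      have "u (s (k - 1)) \<noteq> Infty \<and> jump (s (k - 1)) (s (Suc (k - 1)))" using s(5) k(1) by blast
      thus ?thesis using k by (simp add: s'_def)
    qed
    moreover have "s' 1 = \<phi>" "s' (Suc n) = f" using s by (auto simp: s'_def)
    ultimately show ?thesis by (intro exI[of _ "Suc n"] exI[of _ s'] conjI ballI) auto
  qed
qed

lemma abstract_key_X: "abstract_key [:0, 1:]"
  unfolding abstract_key_def
proof (intro conjI allI impI)
  fix g h :: "'k poly"
  assume gh: "g \<noteq> 0" "h \<noteq> 0" "degree g < degree [:0, 1::'k:]" "degree h < degree [:0, 1::'k:]"
  then obtain a b where ab: "g = [:a:]" "h = [:b:]" by (auto elim!: degree_eq_zeroE)
  hence "g * h div [:0, 1:] = 0" by (simp add: div_poly_less)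
  moreover have "u (g * h) \<noteq> Infty" using gh f_degree ab by (intro u_finite) auto
  ultimately show "u (g * h) < u (g * h div [:0, 1:] * [:0, 1:])" by simp
qed (use f_degree in auto)

lemma first_value_eq: "first_value v0 (u [:0, 1:]) = trunc [:0, 1:]"
proof
  fix g :: "'k poly"
  have "is_expansion [:0, 1:] (map_poly (\<lambda>c. [:c:]) g)"
    by (auto simp: is_expansion_def coeff_map_poly)
  moreover have "poly (map_poly (\<lambda>c. [:c:]) g) [:0, 1:] = g"
    using pcompose_altdef[of g "[:0, 1:]"] by (simp add: pcompose_idR)
  ultimately have "phi_expansion [:0, 1:] g = map_poly (\<lambda>c. [:c:]) g" by (rule phi_expansion_eqI)
  thus "first_value v0 (u [:0, 1:]) g = trunc [:0, 1:] g"
    by (simp add: first_value_def trunc_def exp_term_def degree_map_poly coeff_map_poly u_mult[of "[:_:]"] u_power u_const del: mult_pCons_left)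
qed

lemma augmented_value_eq:
  assumes "0 < degree \<phi>" "\<And>g. degree g < degree \<phi> \<Longrightarrow> w g = u g"
  shows "augmented_value w \<phi> (u \<phi>) = trunc \<phi>"
proof
  fix g
  have "w (poly.coeff (phi_expansion \<phi> g) i) = u (poly.coeff (phi_expansion \<phi> g) i)" for i
    using phi_expansion(1)[OF assms(1), of g] assms(2) by (simp add: is_expansion_def)
  thus "augmented_value w \<phi> (u \<phi>) g = trunc \<phi> g"
    by (simp add: augmented_value_def Let_def trunc_def exp_term_def u_mult u_power)
qed

text \<open>
  At \<open>\<phi> = f\<close> all terms except the remainder modulo \<open>f\<close> have infinite value.
\<close>

lemma trunc_f: "trunc f g = u g"
proof (rule antisym)
  show "trunc f g \<le> u g" using f_degree by (rule trunc_le_u)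
  define n where "n = degree (phi_expansion f g)"
  have inf: "u (exp_term f g i) = Infty" if "i > 0" for i
    using that u_Infty[of f] by (cases i) (auto simp: exp_term_def u_mult)
  have g: "g = exp_term f g 0 + (\<Sum>i\<in>{..n} - {0}. exp_term f g i)"
    using sum_exp_term[OF f_degree, of g] by (simp add: n_def sum.remove[of _ 0])
  have "u (\<Sum>i\<in>{..n} - {0}. exp_term f g i) = Infty"
    using u_sum_ge[of "{..n} - {0}" Infty "exp_term f g"] inf by simp
  hence "u g \<le> u (exp_term f g 0)"
    using u_diff[of g "\<Sum>i\<in>{..n} - {0}. exp_term f g i"] g by (metis add_diff_cancel_right' ext_order_simps(3) min.absorb1)
  thus "u g \<le> trunc f g"
    unfolding le_trunc_iff using inf by (metis ext_order_simps(3) gr0I)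
qed

theorem key_sequence:
  "\<exists>n s. inductive_values v0 n s (\<lambda>k. u (s k)) (\<lambda>k. trunc (s k)) \<and> s n = f \<and>
    (\<forall>k\<in>{1..n}. abstract_key (s k) \<and> s k \<in> polys_over A) \<and>
    (\<forall>k\<in>{1..<n}. u (s k) \<noteq> Infty \<and> jump (s k) (s (Suc k)))"
proof -
  have "[:0, 1:] \<in> polys_over A"
    by (auto simp: polys_over_def A_closed coeff_pCons split: nat.splits)
  from chain_exists[OF abstract_key_X this] obtain n s where
    s: "1 \<le> n" "s 1 = [:0, 1:]" "s n = f" "\<forall>k\<in>{1..n}. abstract_key (s k) \<and> s k \<in> polys_over A"
        "\<forall>k\<in>{1..<n}. u (s k) \<noteq> Infty \<and> jump (s k) (s (Suc k))" by blast
  have "key_polynomial (trunc (s (k - 1))) (s (k - 1)) (s k) (u (s k)) \<and>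
      trunc (s k) = augmented_value (trunc (s (k - 1))) (s k) (u (s k))" if "k \<in> {2..n}" for k
  proof -
    have k: "k - 1 \<in> {1..<n}" "k - 1 \<in> {1..n}" "Suc (k - 1) = k" using that by auto
    have *: "abstract_key (s (k - 1))" "u (s (k - 1)) \<noteq> Infty" "jump (s (k - 1)) (s k)" using s(4,5) k by metis+
    show ?thesis
      using jump_key_polynomial[OF *] augmented_value_eq[OF jump_degree(2)[OF *], of "trunc (s (k - 1))"] jump_simps(4)[OF *]
      by simp
  qed
  hence "inductive_values v0 n s (\<lambda>k. u (s k)) (\<lambda>k. trunc (s k))"
    using s first_value_eq by (simp add: inductive_values_def)
  thus ?thesis using s by blast
qed

end

section \<open>Chevalley's extension theorem modulo a maximal ideal\<close>

text \<open>
  Subrings of a ring given by a type class; the valuation ring found below is built from sums and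
  polynomials over such a ring.
\<close>

definition subr :: "'r::comm_ring_1 set \<Rightarrow> bool" where
  "subr R \<longleftrightarrow> 1 \<in> R \<and> (\<forall>a\<in>R. \<forall>b\<in>R. a - b \<in> R \<and> a * b \<in> R)"

inductive_set ideal_gen :: "'r::comm_ring_1 set \<Rightarrow> 'r set \<Rightarrow> 'r set" for J R where
  zero: "0 \<in> ideal_gen J R"
| add: "x \<in> ideal_gen J R \<Longrightarrow> j \<in> J \<Longrightarrow> r \<in> R \<Longrightarrow> x + j * r \<in> ideal_gen J R"

lemma subrD:
  assumes "subr R"
  shows "1 \<in> R" "0 \<in> R" "a \<in> R \<Longrightarrow> b \<in> R \<Longrightarrow> a - b \<in> R" "a \<in> R \<Longrightarrow> b \<in> R \<Longrightarrow> a * b \<in> R"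
    "a \<in> R \<Longrightarrow> b \<in> R \<Longrightarrow> a + b \<in> R" "a \<in> R \<Longrightarrow> - a \<in> R" "a \<in> R \<Longrightarrow> a ^ n \<in> R"
proof -
  have 1: "1 \<in> R" "\<And>a b. a \<in> R \<Longrightarrow> b \<in> R \<Longrightarrow> a - b \<in> R" "\<And>a b. a \<in> R \<Longrightarrow> b \<in> R \<Longrightarrow> a * b \<in> R"
    using assms by (auto simp: subr_def)
  have 0: "0 \<in> R" using 1(2)[OF 1(1) 1(1)] by simp
  have m: "- a \<in> R" if "a \<in> R" for a using 1(2)[OF 0 that] by simp
  show "1 \<in> R" "0 \<in> R" "a \<in> R \<Longrightarrow> b \<in> R \<Longrightarrow> a - b \<in> R" "a \<in> R \<Longrightarrow> b \<in> R \<Longrightarrow> a * b \<in> R"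
    "a \<in> R \<Longrightarrow> - a \<in> R" using 0 1 m by auto
  show "a \<in> R \<Longrightarrow> b \<in> R \<Longrightarrow> a + b \<in> R" using 1(2)[of a "- b"] m by simp
  show "a \<in> R \<Longrightarrow> a ^ n \<in> R" by (induction n) (auto intro: 1)
qed

lemma subr_sum: "subr R \<Longrightarrow> (\<And>i. i \<in> I \<Longrightarrow> g i \<in> R) \<Longrightarrow> sum g I \<in> R"
  by (induction I rule: infinite_finite_induct) (auto intro: subrD)

lemma ideal_gen_add:
  assumes "x \<in> ideal_gen J R" "y \<in> ideal_gen J R"
  shows "x + y \<in> ideal_gen J R"
  using assms(2)
proof (induction y rule: ideal_gen.induct)
  case (add y j r)
  from ideal_gen.add[OF add.IH add.hyps(2,3)] show ?case by (simp add: add.assoc)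
qed (simp add: assms(1))

lemma ideal_gen_mult:
  assumes "subr R" "x \<in> ideal_gen J R" "r \<in> R"
  shows "r * x \<in> ideal_gen J R"
  using assms(2)
proof (induction x rule: ideal_gen.induct)
  case (add x j s)
  have "r * x + j * (r * s) \<in> ideal_gen J R" using add assms by (intro ideal_gen.add) (auto intro: subrD)
  thus ?case by (simp add: algebra_simps)
qed (auto intro: ideal_gen.zero)

lemma ideal_gen_mem: "j \<in> J \<Longrightarrow> r \<in> R \<Longrightarrow> j * r \<in> ideal_gen J R"
  using ideal_gen.add[OF ideal_gen.zero] by fastforce

lemma ideal_gen_base: "subr R \<Longrightarrow> j \<in> J \<Longrightarrow> j \<in> ideal_gen J R"
  using ideal_gen_mem[of j J 1 R] by (simp add: subrD)

lemma ideal_gen_sum: "(\<And>i. i \<in> I \<Longrightarrow> g i \<in> ideal_gen J R) \<Longrightarrow> sum g I \<in> ideal_gen J R"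
  by (induction I rule: infinite_finite_induct) (auto intro: ideal_gen_add ideal_gen.zero)

lemma ideal_gen_subset:
  assumes "subr R" "J \<subseteq> R" "x \<in> ideal_gen J R"
  shows "x \<in> R"
  using assms(3) by (induction x rule: ideal_gen.induct) (use assms(1,2) in \<open>auto intro: subrD\<close>)

lemma ideal_gen_mono: "x \<in> ideal_gen J R \<Longrightarrow> R \<subseteq> R' \<Longrightarrow> x \<in> ideal_gen J R'"
  by (induction x rule: ideal_gen.induct) (auto intro: ideal_gen.intros)

lemma ideal_gen_chain:
  assumes "C \<noteq> {}" "\<And>X Y. X \<in> C \<Longrightarrow> Y \<in> C \<Longrightarrow> X \<subseteq> Y \<or> Y \<subseteq> X"
  shows "x \<in> ideal_gen J (\<Union>C) \<Longrightarrow> \<exists>R\<in>C. x \<in> ideal_gen J R"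
proof (induction x rule: ideal_gen.induct)
  case zero
  thus ?case using assms(1) by (auto intro: ideal_gen.zero)
next
  case (add x j r)
  then obtain R S where RS: "R \<in> C" "x \<in> ideal_gen J R" "S \<in> C" "r \<in> S" by auto
  show ?case
  proof (cases "R \<subseteq> S")
    case True
    thus ?thesis using RS add.hyps(2) ideal_gen_mono by (blast intro: ideal_gen.add)
  next
    case False
    hence "S \<subseteq> R" using assms(2) RS by blast
    thus ?thesis using RS add.hyps(2) by (blast intro: ideal_gen.add)
  qed
qed

definition adjoin :: "'r::comm_ring_1 set \<Rightarrow> 'r \<Rightarrow> 'r set" where
  "adjoin R y = {poly p y | p. \<forall>i. poly.coeff p i \<in> R}"

lemma adjoin_subr:
  assumes "subr R"
  shows "subr (adjoin R y)" "R \<subseteq> adjoin R y" "y \<in> adjoin R y"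
proof -
  have "1 \<in> adjoin R y"
    unfolding adjoin_def using assms by (auto intro!: exI[of _ 1] simp: coeff_1 intro: subrD)
  moreover have "a - b \<in> adjoin R y" if ab: "a \<in> adjoin R y" "b \<in> adjoin R y" for a b
  proof -
    obtain p q where pq: "a = poly p y" "b = poly q y"
      "\<forall>i. poly.coeff p i \<in> R" "\<forall>i. poly.coeff q i \<in> R" using ab by (auto simp: adjoin_def)
    hence "a - b = poly (p - q) y" "\<forall>i. poly.coeff (p - q) i \<in> R" using assms by (auto intro: subrD)
    thus ?thesis unfolding adjoin_def by blast
  qed
  moreover have "a * b \<in> adjoin R y" if ab: "a \<in> adjoin R y" "b \<in> adjoin R y" for a b
  proof -
    obtain p q where pq: "a = poly p y" "b = poly q y"
      "\<forall>i. poly.coeff p i \<in> R" "\<forall>i. poly.coeff q i \<in> R" using ab by (auto simp: adjoin_def)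
    hence "a * b = poly (p * q) y" "\<forall>i. poly.coeff (p * q) i \<in> R"
      using assms by (auto simp: coeff_mult intro: subrD subr_sum)
    thus ?thesis unfolding adjoin_def by blast
  qed
  ultimately show "subr (adjoin R y)" by (auto simp: subr_def)
  have "r = poly [:r:] y" "\<forall>i. poly.coeff [:r:] i \<in> R" if "r \<in> R" for r
    using that assms by (auto simp: coeff_pCons split: nat.splits intro: subrD)
  thus "R \<subseteq> adjoin R y" unfolding adjoin_def by blast
  have "y = poly [:0, 1:] y" "\<forall>i. poly.coeff [:0, 1:] i \<in> R"
    using assms by (auto simp: coeff_pCons split: nat.splits intro: subrD)
  thus "y \<in> adjoin R y" unfolding adjoin_def by blast
qed

text \<open>
  After adjoining \<open>y\<close>, membership of \<open>1\<close> in the ideal becomes a polynomial relation for \<open>y\<close> with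
  coefficients in the ideal of the smaller ring.
\<close>

lemma ideal_gen_adjoin:
  assumes "x \<in> ideal_gen J (adjoin R y)"
  shows "\<exists>p. (\<forall>i. poly.coeff p i \<in> ideal_gen J R) \<and> x = poly p y"
  using assms
proof (induction x rule: ideal_gen.induct)
  case zero
  show ?case by (intro exI[of _ 0]) (auto intro: ideal_gen.zero)
next
  case (add x j r)
  then obtain p where p: "\<forall>i. poly.coeff p i \<in> ideal_gen J R" "x = poly p y" by blast
  obtain q where q: "\<forall>i. poly.coeff q i \<in> R" "r = poly q y" using add.hyps(3) by (auto simp: adjoin_def)
  show ?case using p q add.hyps(2)
    by (intro exI[of _ "p + Polynomial.smult j q"]) (auto intro: ideal_gen_add ideal_gen_mem)
qed

text \<open>
  A field is presented as a ring modulo a maximal ideal \<open>N\<close>. Its subrings are the subrings of the ring that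
  contain \<open>N\<close>, so the whole argument takes place among polynomials and no inverses are needed.
\<close>

locale max_ideal_of =
  fixes N :: "'r::comm_ring_1 set"
  assumes N0: "0 \<in> N"
    and N_add: "a \<in> N \<Longrightarrow> b \<in> N \<Longrightarrow> a + b \<in> N"
    and N_mult: "a \<in> N \<Longrightarrow> c * a \<in> N"
    and N_inverse: "y \<notin> N \<Longrightarrow> \<exists>z. y * z - 1 \<in> N"
begin

definition cong :: "'r \<Rightarrow> 'r \<Rightarrow> bool" (infix \<open>\<cong>\<^sub>N\<close> 50) where "a \<cong>\<^sub>N b \<longleftrightarrow> a - b \<in> N"

lemma N_uminus: "a \<in> N \<Longrightarrow> - a \<in> N" using N_mult[of a "- 1"] by simp

lemma cong_refl [simp]: "a \<cong>\<^sub>N a" by (simp add: cong_def N0)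

lemma cong_sym: "a \<cong>\<^sub>N b \<Longrightarrow> b \<cong>\<^sub>N a" using N_uminus[of "a - b"] by (simp add: cong_def)

lemma cong_trans [trans]: "a \<cong>\<^sub>N b \<Longrightarrow> b \<cong>\<^sub>N c \<Longrightarrow> a \<cong>\<^sub>N c"
  using N_add[of "a - b" "b - c"] by (simp add: cong_def)

lemma cong_eq_trans [trans]: "a \<cong>\<^sub>N b \<Longrightarrow> b = c \<Longrightarrow> a \<cong>\<^sub>N c" "a = b \<Longrightarrow> b \<cong>\<^sub>N c \<Longrightarrow> a \<cong>\<^sub>N c"
  by auto

lemma cong_add: "a \<cong>\<^sub>N b \<Longrightarrow> c \<cong>\<^sub>N e \<Longrightarrow> a + c \<cong>\<^sub>N b + e"
  using N_add[of "a - b" "c - e"] by (simp add: cong_def algebra_simps)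

lemma cong_mult: "a \<cong>\<^sub>N b \<Longrightarrow> c * a \<cong>\<^sub>N c * b"
  using N_mult[of "a - b" c] by (simp add: cong_def algebra_simps)

lemma cong_sum: "(\<And>i. i \<in> I \<Longrightarrow> g i \<cong>\<^sub>N h i) \<Longrightarrow> sum g I \<cong>\<^sub>N sum h I"
  by (induction I rule: infinite_finite_induct) (auto intro: cong_add)

lemma cong_inverse_power:
  assumes "y * z \<cong>\<^sub>N 1"
  shows "(y * z) ^ i \<cong>\<^sub>N 1"
proof (induction i)
  case (Suc i)
  have "(y * z) ^ Suc i = y * z * (y * z) ^ i" by simp
  also have "\<dots> \<cong>\<^sub>N y * z * 1" by (rule cong_mult[OF Suc])
  also have "y * z * 1 \<cong>\<^sub>N 1" using assms by simp
  finally show ?case .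
qed simp

lemma reverse_poly:
  assumes "y * z \<cong>\<^sub>N 1" "degree p \<le> n"
  shows "y ^ n * poly p z \<cong>\<^sub>N (\<Sum>i\<le>n. poly.coeff p i * y ^ (n - i))"
proof -
  have "poly p z = (\<Sum>i\<le>n. poly.coeff p i * z ^ i)"
    unfolding poly_altdef using assms(2) by (intro sum.mono_neutral_left) (auto simp: coeff_eq_0)
  hence "y ^ n * poly p z = (\<Sum>i\<le>n. y ^ n * (poly.coeff p i * z ^ i))" by (simp add: sum_distrib_left)
  also have "\<dots> \<cong>\<^sub>N (\<Sum>i\<le>n. poly.coeff p i * y ^ (n - i))"
  proof (rule cong_sum)
    fix i assume "i \<in> {..n}"
    hence "y ^ n = y ^ (n - i) * y ^ i" by (simp add: power_add[symmetric])
    hence "y ^ n * (poly.coeff p i * z ^ i) = poly.coeff p i * y ^ (n - i) * (y * z) ^ i"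
      by (simp add: power_mult_distrib ac_simps)
    also have "\<dots> \<cong>\<^sub>N poly.coeff p i * y ^ (n - i) * 1" by (intro cong_mult cong_inverse_power assms)
    finally show "y ^ n * (poly.coeff p i * z ^ i) \<cong>\<^sub>N poly.coeff p i * y ^ (n - i)" by simp
  qed
  finally show ?thesis .
qed

text \<open>
  Take a subring \<open>R\<close> that is maximal among those in which \<open>J\<close> generates a proper ideal \<open>M\<close>. Then \<open>1 - m\<close> is a
  unit of \<open>R\<close> for every \<open>m \<in> M\<close>. If \<open>y\<close> and its inverse \<open>z\<close> are both outside \<open>R\<close>, maximality gives relations
  expressing \<open>1\<close> as a polynomial in \<open>y\<close> and as one in \<open>z\<close> with coefficients in \<open>M\<close>. The relation of
  smaller degree lowers the degree of the other one, which cannot go on.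
\<close>

theorem chevalley:
  assumes R0: "subr R0" "J \<subseteq> R0" "N \<subseteq> J" "1 \<notin> ideal_gen J R0"
  obtains R where "subr R" "R0 \<subseteq> R" "1 \<notin> ideal_gen J R" "\<And>y z. y * z \<cong>\<^sub>N 1 \<Longrightarrow> y \<in> R \<or> z \<in> R"
proof -
  define \<A> where "\<A> = {R. subr R \<and> R0 \<subseteq> R \<and> 1 \<notin> ideal_gen J R}"
  have "\<exists>M\<in>\<A>. \<forall>X\<in>\<A>. M \<subseteq> X \<longrightarrow> X = M"
  proof (rule subset_Zorn_nonempty)
    show "\<A> \<noteq> {}" using R0 by (auto simp: \<A>_def)
    fix C assume C: "C \<noteq> {}" "subset.chain \<A> C"
    have sub: "C \<subseteq> \<A>" using C(2) by (rule subset.chain_def[THEN iffD1, THEN conjunct1])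
    have tot: "X \<subseteq> Y \<or> Y \<subseteq> X" if "X \<in> C" "Y \<in> C" for X Y
      using C(2) that unfolding subset.chain_def by blast
    have "subr (\<Union>C)"
      unfolding subr_def
    proof (intro conjI ballI)
      show "1 \<in> \<Union>C" using C(1) sub by (auto simp: \<A>_def intro: subrD)
      fix a b assume "a \<in> \<Union>C" "b \<in> \<Union>C"
      then obtain X Y where XY: "X \<in> C" "a \<in> X" "Y \<in> C" "b \<in> Y" by blast
      then obtain Z where Z: "Z \<in> C" "a \<in> Z" "b \<in> Z" using tot by blast
      hence "subr Z" using sub by (auto simp: \<A>_def)
      thus "a - b \<in> \<Union>C" "a * b \<in> \<Union>C" using Z by (auto intro: subrD)
    qed
    moreover have "R0 \<subseteq> \<Union>C" using C(1) sub by (auto simp: \<A>_def)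
    moreover have "1 \<notin> ideal_gen J (\<Union>C)" using ideal_gen_chain[OF C(1) tot] sub by (auto simp: \<A>_def)
    ultimately show "\<Union>C \<in> \<A>" by (simp add: \<A>_def)
  qed
  then obtain R where "R \<in> \<A>" and max: "\<And>X. X \<in> \<A> \<Longrightarrow> R \<subseteq> X \<Longrightarrow> X = R" by blast
  hence R: "subr R" "R0 \<subseteq> R" "1 \<notin> ideal_gen J R" by (auto simp: \<A>_def)
  define M where "M = ideal_gen J R"
  have JR: "J \<subseteq> R" using R R0 by blast
  have NM: "N \<subseteq> M" using R0(3) ideal_gen_base[OF R(1)] by (auto simp: M_def)
  have MR: "M \<subseteq> R" using ideal_gen_subset[OF R(1) JR] by (auto simp: M_def)
  have M1: "1 \<notin> M" using R(3) by (simp add: M_def)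
  have M_cong: "a \<in> M" if "b \<in> M" "a \<cong>\<^sub>N b" for a b
    using ideal_gen_add[of "a - b" J R b] that NM by (auto simp: M_def cong_def)
  have outside: "\<exists>p. (\<forall>i. poly.coeff p i \<in> M) \<and> 1 = poly p y" if "y \<notin> R" for y
  proof -
    have "adjoin R y \<notin> \<A>" using max[of "adjoin R y"] adjoin_subr[OF R(1), of y] that by blast
    hence "1 \<in> ideal_gen J (adjoin R y)" using adjoin_subr[OF R(1), of y] R(2) by (auto simp: \<A>_def)
    from ideal_gen_adjoin[OF this] show ?thesis by (simp add: M_def)
  qed
  have unit: "\<exists>r\<in>R. (1 - m) * r \<cong>\<^sub>N 1" if m: "m \<in> M" for m
  proof -
    have "1 - m \<notin> N" using ideal_gen_add[of "1 - m" J R m] m NM M1 by (auto simp: M_def)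
    then obtain z where z: "(1 - m) * z \<cong>\<^sub>N 1" using N_inverse by (auto simp: cong_def)
    have "z \<in> R"
    proof (rule ccontr)
      assume "z \<notin> R"
      then obtain p where p: "\<forall>i. poly.coeff p i \<in> M" "1 = poly p z" using outside by blast
      define n where "n = degree p"
      have mR: "1 - m \<in> R" using m MR R(1) by (auto intro: subrD)
      have "(1 - m) ^ n * poly p z \<cong>\<^sub>N (\<Sum>i\<le>n. poly.coeff p i * (1 - m) ^ (n - i))"
        by (rule reverse_poly[OF z]) (simp add: n_def)
      moreover have "(\<Sum>i\<le>n. poly.coeff p i * (1 - m) ^ (n - i)) \<in> M"
      proof -
        have "(1 - m) ^ (n - i) * poly.coeff p i \<in> M" for i
          using p(1) mR R(1) unfolding M_def by (intro ideal_gen_mult) (auto intro: subrD)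
        thus ?thesis unfolding M_def by (intro ideal_gen_sum) (simp add: mult.commute)
      qed
      ultimately have 1: "(1 - m) ^ n \<in> M" using M_cong p(2) by simp
      have "1 - (1 - m) ^ k \<in> M" for k
      proof (induction k)
        case 0
        show ?case by (simp add: M_def ideal_gen.zero)
      next
        case (Suc k)
        have "(1 - m) ^ k * m \<in> M" using m mR R(1) unfolding M_def by (intro ideal_gen_mult) (auto intro: subrD)
        hence "(1 - (1 - m) ^ k) + (1 - m) ^ k * m \<in> M" using Suc unfolding M_def by (intro ideal_gen_add)
        thus ?case by (simp add: algebra_simps)
      qed
      from ideal_gen_add[OF this[of n, unfolded M_def] 1[unfolded M_def]] M1 show False by (simp add: M_def)
    qed
    thus ?thesis using z by blast
  qed
  define rel where "rel y n \<longleftrightarrow> (\<exists>p. degree p \<le> n \<and> (\<forall>i. poly.coeff p i \<in> M) \<and> poly p y \<cong>\<^sub>N 1)" for y n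
  have step: "\<exists>n'<n. rel y n'" if yz: "y * z \<cong>\<^sub>N 1" and rel: "rel y n" "rel z m" and mn: "m \<le> n" for y z n m
  proof -
    obtain p where p: "degree p \<le> n" "\<forall>i. poly.coeff p i \<in> M" "poly p y \<cong>\<^sub>N 1" using rel by (auto simp: rel_def)
    obtain q where q: "degree q \<le> m" "\<forall>i. poly.coeff q i \<in> M" "poly q z \<cong>\<^sub>N 1" using rel by (auto simp: rel_def)
    have m0: "m > 0"
    proof (rule ccontr)
      assume "\<not> ?thesis"
      hence "degree q = 0" using q(1) by simp
      then obtain c where "q = [:c:]" by (rule degree_eq_zeroE)
      hence "c \<in> M" "c \<cong>\<^sub>N 1" using q(2,3) by (auto dest: spec[of _ 0])
      thus False using M1 M_cong cong_sym by blast
    qed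
    obtain r where r: "r \<in> R" "(1 - poly.coeff q 0) * r \<cong>\<^sub>N 1" using unit q(2) by blast
    define q' where "q' = (\<Sum>j\<in>{1..m}. Polynomial.monom (r * poly.coeff q j) (m - j))"
    have q'M: "poly.coeff q' i \<in> M" for i
    proof -
      have "r * poly.coeff q j \<in> M" for j using q(2) r(1) R(1) by (auto simp: M_def intro: ideal_gen_mult)
      thus ?thesis unfolding q'_def coeff_sum coeff_monom M_def by (intro ideal_gen_sum) (auto intro: ideal_gen.zero)
    qed
    have dq': "degree q' \<le> m - 1"
      unfolding q'_def
    proof (rule degree_sum_le)
      fix j assume "j \<in> {1..m}"
      hence "m - j \<le> m - 1" by auto
      thus "degree (Polynomial.monom (r * poly.coeff q j) (m - j)) \<le> m - 1"
        by (rule order_trans[OF degree_monom_le])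
    qed simp
    have "y ^ m * 1 \<cong>\<^sub>N y ^ m * poly q z" by (rule cong_mult[OF cong_sym[OF q(3)]])
    also have "\<dots> \<cong>\<^sub>N (\<Sum>i\<le>m. poly.coeff q i * y ^ (m - i))" by (rule reverse_poly[OF yz q(1)])
    also have "\<dots> = poly.coeff q 0 * y ^ m + (\<Sum>i\<in>{1..m}. poly.coeff q i * y ^ (m - i))"
      by (simp add: atMost_atLeast0 sum.atLeast_Suc_atMost)
    finally have "y ^ m * (1 - poly.coeff q 0) \<cong>\<^sub>N (\<Sum>i\<in>{1..m}. poly.coeff q i * y ^ (m - i))"
      by (simp add: cong_def algebra_simps)
    from cong_mult[OF this, of r]
    have a: "r * (y ^ m * (1 - poly.coeff q 0)) \<cong>\<^sub>N poly q' y"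
      by (simp add: q'_def poly_sum poly_monom sum_distrib_left ac_simps)
    have "y ^ m = y ^ m * 1" by simp
    also have "\<dots> \<cong>\<^sub>N y ^ m * ((1 - poly.coeff q 0) * r)" by (rule cong_mult[OF cong_sym[OF r(2)]])
    also have "\<dots> = r * (y ^ m * (1 - poly.coeff q 0))" by (simp add: ac_simps)
    also note a
    finally have ym: "y ^ m \<cong>\<^sub>N poly q' y" .
    define c where "c = poly.coeff p n"
    define s where "s = Polynomial.monom c (n - m) * q'"
    define p' where "p' = p - Polynomial.monom c n + s"
    have cM: "c \<in> M" using p(2) by (simp add: c_def)
    have sM: "poly.coeff s i \<in> M" for i
    proof -
      have "poly.coeff q' (i - (n - m)) * c \<in> M" using q'M MR cM R(1) unfolding M_def by (intro ideal_gen_mult) auto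
      thus ?thesis by (auto simp: s_def coeff_monom_mult M_def ideal_gen.zero mult.commute[of c])
    qed
    have ds: "degree s \<le> n - 1"
      unfolding s_def using degree_mult_le[of "Polynomial.monom c (n - m)" q'] degree_monom_le[of c "n - m"] dq' m0 mn by linarith
    have "poly.coeff p' i = 0" if "i > n - 1" for i
      using that p(1) ds by (cases "i = n") (auto simp: p'_def c_def coeff_eq_0)
    hence dp': "degree p' \<le> n - 1" by (intro degree_le) auto
    have "poly.coeff p' i \<in> M" for i
    proof (cases "i = n")
      case True
      thus ?thesis using sM[of i] by (simp add: p'_def c_def)
    next
      case False
      thus ?thesis using sM[of i] p(2) by (simp add: p'_def M_def ideal_gen_add)
    qed
    moreover have "poly p' y \<cong>\<^sub>N 1"
    proof -
      have "poly p' y = (poly p y - c * y ^ n) + c * y ^ (n - m) * poly q' y"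
        by (simp add: p'_def s_def poly_monom)
      also have "\<dots> \<cong>\<^sub>N (poly p y - c * y ^ n) + c * y ^ (n - m) * y ^ m"
        by (intro cong_add cong_mult cong_sym[OF ym]) simp
      also have "\<dots> = poly p y" using mn by (simp add: mult.assoc power_add[symmetric])
      also note p(3)
      finally show ?thesis .
    qed
    ultimately have "rel y (n - 1)" using dp' unfolding rel_def by blast
    thus ?thesis using m0 mn by (intro exI[of _ "n - 1"]) auto
  qed
  have no_rel: "\<not> (rel y n \<and> rel z m)" if "y * z \<cong>\<^sub>N 1" for y z n m
    using that
  proof (induction "n + m" arbitrary: n m rule: less_induct)
    case less
    show ?case
    proof
      assume rl: "rel y n \<and> rel z m"
      show False
      proof (cases "m \<le> n")
        case True
        then obtain n' where "n' < n" "rel y n'" using step less.prems rl by blast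
        thus False using less.hyps[of n' m] less.prems rl by simp
      next
        case False
        have "z * y \<cong>\<^sub>N 1" using less.prems by (simp add: mult.commute)
        then obtain m' where "m' < m" "rel z m'" using step[of z y m n] False rl by auto
        thus False using less.hyps[of n m'] less.prems rl by simp
      qed
    qed
  qed
  have rel_outside: "\<exists>n. rel y n" if y: "y \<notin> R" for y
  proof -
    obtain p where p: "\<forall>i. poly.coeff p i \<in> M" "1 = poly p y" using outside[OF y] by blast
    have "poly p y \<cong>\<^sub>N 1" unfolding p(2)[symmetric] by (rule cong_refl)
    thus ?thesis using p(1) unfolding rel_def by blast
  qed
  have "y \<in> R \<or> z \<in> R" if "y * z \<cong>\<^sub>N 1" for y z
    using no_rel[OF that] rel_outside by blast
  thus ?thesis using that R by blast
qed

end

section \<open>The valuation of a valuation ring\<close>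

context field
begin

context
  fixes B :: "'a set"
  assumes B: "subring B R" and val: "\<And>x. x \<in> Units R \<Longrightarrow> x \<in> B \<or> inv\<^bsub>units_of R\<^esub> x \<in> B"
begin

text \<open>
  A valuation ring \<open>B\<close> of a field gives a valuation with values in the units of the field modulo the units of
  \<open>B\<close>; \<open>y\<close> is at least as large as \<open>x\<close> when \<open>y/x\<close> lies in \<open>B\<close>.
\<close>

definition "unit_group = {x \<in> Units R. x \<in> B \<and> inv\<^bsub>units_of R\<^esub> x \<in> B}"
definition "val_of x = unit_group #>\<^bsub>units_of R\<^esub> x"
definition "val_order = {(val_of x, val_of y) | x y. x \<in> Units R \<and> y \<in> Units R \<and> y \<otimes> inv\<^bsub>units_of R\<^esub> x \<in> B}"

lemmas BE = subringE[OF B]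

interpretation U: comm_group "units_of R"
  rewrites "carrier (units_of R) = Units R" and "monoid.mult (units_of R) = monoid.mult R" and "monoid.one (units_of R) = \<one>"
  by (rule units_comm_group) (simp_all add: units_of_def)

lemma unit_group_subgroup: "subgroup unit_group (units_of R)"
proof (rule U.subgroupI)
  show "unit_group \<subseteq> Units R" by (auto simp: unit_group_def)
  have "\<one> \<in> unit_group" using BE by (simp add: unit_group_def)
  thus "unit_group \<noteq> {}" by blast
  fix a assume a: "a \<in> unit_group"
  thus "inv\<^bsub>units_of R\<^esub> a \<in> unit_group" by (auto simp: unit_group_def)
  fix b assume b: "b \<in> unit_group"
  show "a \<otimes> b \<in> unit_group"
    using a b BE(6) by (auto simp: unit_group_def U.inv_mult)
qed

lemma val_of_eq:
  assumes "x \<in> Units R" "y \<in> Units R"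
  shows "val_of x = val_of y \<longleftrightarrow> y \<otimes> inv\<^bsub>units_of R\<^esub> x \<in> unit_group"
proof -
  interpret H: subgroup unit_group "units_of R" by (rule unit_group_subgroup)
  have m: "y \<in> val_of x \<longleftrightarrow> y \<otimes> inv\<^bsub>units_of R\<^esub> x \<in> unit_group"
    using H.rcos_module[OF U.is_group, of x y] assms by (simp add: val_of_def units_of_def)
  moreover have "y \<in> val_of x \<longleftrightarrow> val_of x = val_of y"
    using U.repr_independence[of y unit_group x] U.rcos_self[of y unit_group] assms unit_group_subgroup
    unfolding val_of_def by auto
  ultimately show ?thesis by simp
qed

lemma val_order_iff:
  assumes "x \<in> Units R" "y \<in> Units R"
  shows "(val_of x, val_of y) \<in> val_order \<longleftrightarrow> y \<otimes> inv\<^bsub>units_of R\<^esub> x \<in> B"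
proof
  assume "(val_of x, val_of y) \<in> val_order"
  then obtain x' y' where e: "val_of x = val_of x'" "val_of y = val_of y'"
    and x': "x' \<in> Units R" and y': "y' \<in> Units R" and yx: "y' \<otimes> inv\<^bsub>units_of R\<^esub> x' \<in> B"
    by (auto simp: val_order_def)
  have 1: "x' \<otimes> inv\<^bsub>units_of R\<^esub> x \<in> B" using e(1) val_of_eq[OF assms(1) x'] by (simp add: unit_group_def)
  have 2: "y \<otimes> inv\<^bsub>units_of R\<^esub> y' \<in> B" using e(2) val_of_eq[OF y' assms(2)] by (simp add: unit_group_def)
  have "y \<otimes> inv\<^bsub>units_of R\<^esub> x = (y \<otimes> inv\<^bsub>units_of R\<^esub> y') \<otimes> ((y' \<otimes> inv\<^bsub>units_of R\<^esub> x') \<otimes> (x' \<otimes> inv\<^bsub>units_of R\<^esub> x))"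
  proof -
    have "(y' \<otimes> inv\<^bsub>units_of R\<^esub> x') \<otimes> (x' \<otimes> inv\<^bsub>units_of R\<^esub> x) = y' \<otimes> inv\<^bsub>units_of R\<^esub> x"
      using assms x' y' by (metis U.inv_closed U.inv_solve_right U.l_cancel_one' U.m_assoc U.m_closed U.l_inv U.l_one)
    moreover have "(y \<otimes> inv\<^bsub>units_of R\<^esub> y') \<otimes> (y' \<otimes> inv\<^bsub>units_of R\<^esub> x) = y \<otimes> inv\<^bsub>units_of R\<^esub> x"
      using assms x' y' by (metis U.inv_closed U.inv_solve_right U.l_cancel_one' U.m_assoc U.m_closed U.l_inv U.l_one)
    ultimately show ?thesis by simp
  qed
  thus "y \<otimes> inv\<^bsub>units_of R\<^esub> x \<in> B" using 1 2 yx BE(6) by simp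
next
  assume "y \<otimes> inv\<^bsub>units_of R\<^esub> x \<in> B"
  thus "(val_of x, val_of y) \<in> val_order" using assms by (auto simp: val_order_def)
qed

lemma inv_quot: "x \<in> Units R \<Longrightarrow> y \<in> Units R \<Longrightarrow>
    inv\<^bsub>units_of R\<^esub> (y \<otimes> inv\<^bsub>units_of R\<^esub> x) = x \<otimes> inv\<^bsub>units_of R\<^esub> y"
  by (simp add: U.inv_mult U.m_comm)

lemma val_group_ordered: "ordered_abelian_group (units_of R Mod unit_group) val_order"
proof -
  interpret N: normal unit_group "units_of R" by (rule U.subgroup_imp_normal[OF unit_group_subgroup])
  have car: "carrier (units_of R Mod unit_group) = val_of ` Units R"
    by (auto simp: FactGroup_def RCOSETS_def val_of_def units_of_carrier)
  have mult: "val_of x \<otimes>\<^bsub>units_of R Mod unit_group\<^esub> val_of y = val_of (x \<otimes> y)" if "x \<in> Units R" "y \<in> Units R" for x y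
    using N.rcos_sum[of x y] that by (simp add: FactGroup_def val_of_def units_of_def)
  have "linear_order_on (val_of ` Units R) val_order"
    unfolding linear_order_on_def partial_order_on_def preorder_on_def
  proof (intro conjI)
    show "val_order \<subseteq> val_of ` Units R \<times> val_of ` Units R" by (auto simp: val_order_def)
    show "refl_on (val_of ` Units R) val_order" using BE by (auto simp: refl_on_def val_order_iff)
    show "trans val_order"
    proof (rule transI)
      fix X Y Z assume XY: "(X, Y) \<in> val_order" and YZ: "(Y, Z) \<in> val_order"
      then obtain x y z where e: "X = val_of x" "Y = val_of y" "Z = val_of z"
        and u: "x \<in> Units R" "y \<in> Units R" "z \<in> Units R" by (auto simp: val_order_def)
      have 1: "y \<otimes> inv\<^bsub>units_of R\<^esub> x \<in> B" using XY e u by (simp add: val_order_iff)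
      have 2: "z \<otimes> inv\<^bsub>units_of R\<^esub> y \<in> B" using YZ e u by (simp add: val_order_iff)
      have "(z \<otimes> inv\<^bsub>units_of R\<^esub> y) \<otimes> (y \<otimes> inv\<^bsub>units_of R\<^esub> x) = z \<otimes> inv\<^bsub>units_of R\<^esub> x"
        using u by (metis U.inv_closed U.m_assoc U.m_closed U.l_inv U.l_one)
      thus "(X, Z) \<in> val_order" using BE(6)[OF 2 1] e u by (simp add: val_order_iff)
    qed
    show "antisym val_order"
    proof (rule antisymI)
      fix X Y assume XY: "(X, Y) \<in> val_order" "(Y, X) \<in> val_order"
      then obtain x y where e: "X = val_of x" "Y = val_of y"
        and u: "x \<in> Units R" "y \<in> Units R" by (auto simp: val_order_def)
      have "y \<otimes> inv\<^bsub>units_of R\<^esub> x \<in> B" "x \<otimes> inv\<^bsub>units_of R\<^esub> y \<in> B" using XY e u by (simp_all add: val_order_iff)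
      thus "X = Y" using u e by (simp add: val_of_eq unit_group_def inv_quot)
    qed
    show "total_on (val_of ` Units R) val_order"
    proof (rule total_onI)
      fix X Y assume XY: "X \<in> val_of ` Units R" "Y \<in> val_of ` Units R"
      then obtain x y where e: "X = val_of x" "Y = val_of y" and u: "x \<in> Units R" "y \<in> Units R" by auto
      show "(X, Y) \<in> val_order \<or> (Y, X) \<in> val_order"
        using val[of "y \<otimes> inv\<^bsub>units_of R\<^esub> x"] u e by (simp add: inv_quot val_order_iff)
    qed
  qed
  moreover have "(X \<otimes>\<^bsub>units_of R Mod unit_group\<^esub> Z, Y \<otimes>\<^bsub>units_of R Mod unit_group\<^esub> Z) \<in> val_order"
    if XYZ: "X \<in> val_of ` Units R" "Y \<in> val_of ` Units R" "Z \<in> val_of ` Units R" and r: "(X, Y) \<in> val_order" for X Y Z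
  proof -
    obtain x y z where e: "X = val_of x" "Y = val_of y" "Z = val_of z"
        and u: "x \<in> Units R" "y \<in> Units R" "z \<in> Units R" using XYZ by blast
    have "(y \<otimes> z) \<otimes> inv\<^bsub>units_of R\<^esub> (x \<otimes> z) = y \<otimes> inv\<^bsub>units_of R\<^esub> x"
    proof -
      have "(y \<otimes> z) \<otimes> inv\<^bsub>units_of R\<^esub> (x \<otimes> z) = y \<otimes> ((z \<otimes> inv\<^bsub>units_of R\<^esub> z) \<otimes> inv\<^bsub>units_of R\<^esub> x)"
        using u by (simp add: U.inv_mult U.m_assoc U.m_comm U.m_lcomm del: U.r_inv)
      thus ?thesis using u by simp
    qed
    hence "(val_of (x \<otimes> z), val_of (y \<otimes> z)) \<in> val_order" using r e u by (simp add: val_order_iff)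
    thus ?thesis unfolding e mult[OF u(1,3)] mult[OF u(2,3)] .
  qed
  ultimately show ?thesis
    unfolding ordered_abelian_group_def car using U.abelian_FactGroup[OF unit_group_subgroup] by blast
qed

lemma valuation_ring_valuation: "carrier_valuation R (units_of R Mod unit_group) val_order val_of"
  unfolding carrier_valuation_def field_Units[symmetric]
proof (intro conjI ballI impI)
  interpret N: normal unit_group "units_of R" by (rule U.subgroup_imp_normal[OF unit_group_subgroup])
  show "field R" by (rule field_axioms)
  show "ordered_abelian_group (units_of R Mod unit_group) val_order" by (rule val_group_ordered)
  show "val_of \<in> Units R \<rightarrow> carrier (units_of R Mod unit_group)"
    by (auto simp: FactGroup_def RCOSETS_def val_of_def units_of_carrier)
  fix x y assume u: "x \<in> Units R" "y \<in> Units R"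
  show "val_of (x \<otimes> y) = val_of x \<otimes>\<^bsub>units_of R Mod unit_group\<^esub> val_of y"
    using N.rcos_sum[of x y] u by (simp add: FactGroup_def val_of_def units_of_def)
  assume "x \<oplus> y \<noteq> \<zero>"
  hence s: "x \<oplus> y \<in> Units R" using u by (simp add: field_Units)
  have half: "(val_of a, val_of (a \<oplus> b)) \<in> val_order"
    if "a \<in> Units R" "b \<in> Units R" "a \<oplus> b \<in> Units R" "b \<otimes> inv\<^bsub>units_of R\<^esub> a \<in> B" for a b
  proof -
    have "(a \<oplus> b) \<otimes> inv\<^bsub>units_of R\<^esub> a = \<one> \<oplus> b \<otimes> inv\<^bsub>units_of R\<^esub> a"
      using that U.inv_closed[of a] by (simp add: l_distr Units_closed)
    thus ?thesis using that BE by (simp add: val_order_iff)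
  qed
  show "(val_of x, val_of (x \<oplus> y)) \<in> val_order \<or> (val_of y, val_of (x \<oplus> y)) \<in> val_order"
    using half[of x y] half[of y x] val[of "y \<otimes> inv\<^bsub>units_of R\<^esub> x"] u s
    by (auto simp: inv_quot a_comm Units_closed)
qed

end

end

section \<open>The field \<open>K[x]/(f)\<close>\<close>

lemma mem_PIdl: "g \<in> PIdl\<^bsub>cring_class_ops\<^esub> f \<longleftrightarrow> f dvd (g :: 'k::field poly)"
  by (auto simp: cgenideal_def cring_class_ops_def dvd_def mult.commute)

lemma PIdl_ideal: "ideal (PIdl\<^bsub>cring_class_ops\<^esub> (f :: 'k::field poly)) cring_class_ops"
  by (rule cring.cgenideal_ideal[OF cring_class]) (simp add: carrier_class)

lemma cls_eq_iff: "cls f g = cls f h \<longleftrightarrow> f dvd g - h"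
  using ring.quotient_eq_iff_same_a_r_cos[OF cring.axioms(1)[OF cring_class] PIdl_ideal, of g h f]
  by (simp add: cls_def carrier_class minus_class mem_PIdl)

lemma cls_hom: "cls f \<in> ring_hom cring_class_ops (quot_field f)"
  unfolding cls_def[abs_def] quot_field_def by (rule ideal.rcos_ring_hom[OF PIdl_ideal])

lemma quot_field_ops:
  "cls f g \<otimes>\<^bsub>quot_field f\<^esub> cls f h = cls f (g * h)"
  "cls f g \<oplus>\<^bsub>quot_field f\<^esub> cls f h = cls f (g + h)"
  "\<one>\<^bsub>quot_field f\<^esub> = cls f 1"
  using ring_hom_mult[OF cls_hom, of g h f] ring_hom_add[OF cls_hom, of g h f] ring_hom_one[OF cls_hom, of f]
  by (simp_all add: cring_class_ops_def)

lemma quot_field_carrier: "carrier (quot_field f) = range (cls f)"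
  by (auto simp: quot_field_def FactRing_def A_RCOSETS_def RCOSETS_def cls_def a_r_coset_def cring_class_ops_def)

lemma quot_field_zero: "\<zero>\<^bsub>quot_field f\<^esub> = cls f 0"
proof -
  have "cls f 0 = PIdl\<^bsub>cring_class_ops\<^esub> f"
    by (auto simp: cls_def a_r_coset_def r_coset_def cring_class_ops_def)
  thus ?thesis by (simp add: quot_field_def FactRing_def)
qed

lemma (in max_ideal_of) subr_plus_ideal:
  assumes S: "subr S"
  shows "subr {s + n | s n. s \<in> S \<and> n \<in> N}"
  unfolding subr_def
proof (intro conjI ballI)
  show "1 \<in> {s + n | s n. s \<in> S \<and> n \<in> N}" using subrD(1)[OF S] N0 by force
  fix a b assume "a \<in> {s + n | s n. s \<in> S \<and> n \<in> N}" "b \<in> {s + n | s n. s \<in> S \<and> n \<in> N}"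
  then obtain s n s' n' where e: "a = s + n" "b = s' + n'" "s \<in> S" "n \<in> N" "s' \<in> S" "n' \<in> N" by auto
  have "a - b = (s - s') + (n + - n')" using e by simp
  moreover have "n + - n' \<in> N" using e by (intro N_add N_uminus)
  ultimately show "a - b \<in> {s + n | s n. s \<in> S \<and> n \<in> N}" using subrD(3)[OF S] e by blast
  have "a * b = s * s' + (s * n' + (s' * n + n * n'))" using e by (simp add: algebra_simps)
  moreover have "s * n' + (s' * n + n * n') \<in> N" using e by (intro N_add N_mult)
  ultimately show "a * b \<in> {s + n | s n. s \<in> S \<and> n \<in> N}" using subrD(4)[OF S] e by blast
qed

section \<open>Uniqueness of the extension implies integrality\<close>

lemma quot_field_inverse:
  assumes "field (quot_field f)" "\<not> f dvd y"
  shows "\<exists>z. f dvd y * z - 1"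
proof -
  interpret L: field "quot_field f" by fact
  have "cls f y \<noteq> \<zero>\<^bsub>quot_field f\<^esub>" using assms(2) by (simp add: quot_field_zero cls_eq_iff)
  hence "cls f y \<in> Units (quot_field f)" by (simp add: L.field_Units quot_field_carrier)
  then obtain x where "x \<in> carrier (quot_field f)" "cls f y \<otimes>\<^bsub>quot_field f\<^esub> x = \<one>\<^bsub>quot_field f\<^esub>"
    by (auto simp: Units_def)
  thus ?thesis by (auto simp: quot_field_carrier quot_field_ops cls_eq_iff)
qed

lemma quot_field_inv:
  assumes "field (quot_field f)" "f dvd y * z - 1"
  shows "cls f y \<in> Units (quot_field f)" "inv\<^bsub>units_of (quot_field f)\<^esub> (cls f y) = cls f z"
proof -
  interpret L: field "quot_field f" by fact
  have 1: "cls f y \<otimes>\<^bsub>quot_field f\<^esub> cls f z = \<one>\<^bsub>quot_field f\<^esub>" using assms(2) by (simp add: quot_field_ops cls_eq_iff)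
  have c: "cls f y \<in> carrier (quot_field f)" "cls f z \<in> carrier (quot_field f)" by (simp_all add: quot_field_carrier)
  show u: "cls f y \<in> Units (quot_field f)" using c 1 L.m_comm[OF c] unfolding Units_def by (intro CollectI conjI bexI[of _ "cls f z"]) auto
  thus "inv\<^bsub>units_of (quot_field f)\<^esub> (cls f y) = cls f z"
    using c 1 by (simp add: L.units_of_inv L.comm_inv_char)
qed

lemma subring_cls:
  assumes "field (quot_field f)" "subr R"
  shows "subring (cls f ` R) (quot_field f)"
proof -
  interpret L: field "quot_field f" by fact
  show ?thesis
  proof (rule L.subringI)
    show "cls f ` R \<subseteq> carrier (quot_field f)" by (auto simp: quot_field_carrier)
    show "\<one>\<^bsub>quot_field f\<^esub> \<in> cls f ` R" using subrD(1)[OF assms(2)] by (simp add: quot_field_ops)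
    fix h assume "h \<in> cls f ` R"
    then obtain r where r: "r \<in> R" "h = cls f r" by blast
    have "cls f (- r) \<oplus>\<^bsub>quot_field f\<^esub> h = \<zero>\<^bsub>quot_field f\<^esub>" by (simp add: r quot_field_ops quot_field_zero)
    hence "\<ominus>\<^bsub>quot_field f\<^esub> h = cls f (- r)" using r by (intro L.minus_equality) (auto simp: quot_field_carrier)
    thus "\<ominus>\<^bsub>quot_field f\<^esub> h \<in> cls f ` R" using r subrD(6)[OF assms(2)] by simp
  qed (use subrD(4,5)[OF assms(2)] in \<open>auto simp: quot_field_ops\<close>)
qed

text \<open>
  Suppose \<open>g\<close> has value \<open>0\<close> but is not integral, and let \<open>b\<close> be its inverse modulo \<open>f\<close>. In the ring generated by
  \<open>b\<close> over the valuation ring, \<open>b\<close> and the elements of positive value generate a proper ideal: an equation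
  \<open>1 = \<Sum> a\<^sub>i b\<^sup>i\<close> with \<open>a\<^sub>0\<close> of positive value, multiplied by a power of \<open>g\<close>, would be an integral
  equation for \<open>g\<close>. A valuation ring dominating this ring restricts to that of \<open>v\<^sub>0\<close> and does
  not contain \<open>g\<close>. Its valuation extends \<open>v\<^sub>0\<close> and differs from \<open>v\<close>.
\<close>

theorem unique_extension_integral_val:
  fixes f :: "'k::field poly" and v0 :: "'k \<Rightarrow> 'g::linordered_ab_group_add ext_value"
  assumes val0: "valuation cring_class_ops v0"
    and uniq: "unique_extension cring_class_ops v0 (quot_field f) (\<lambda>a. cls f [:a:]) v"
    and f: "lead_coeff f = 1" "degree f > 0"
  shows "integral_val f (\<lambda>g. v (cls f g)) v0"
proof -
  define u where "u g = v (cls f g)" for g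
  have valL: "valuation (quot_field f) v" and const: "u [:a:] = v0 a" for a
    using uniq by (auto simp: unique_extension_def u_def carrier_class)
  interpret L: field "quot_field f" using valL by (simp add: valuation_def)
  have fieldL: "field (quot_field f)" by (rule L.field_axioms)
  interpret pseudo_val f u
  proof
    fix g h
    show "u g = Infty \<longleftrightarrow> f dvd g"
      using valL by (simp add: valuation_def u_def quot_field_carrier quot_field_zero cls_eq_iff)
    show "u (g * h) = u g + u h"
      using valL by (simp add: valuation_def u_def quot_field_carrier flip: quot_field_ops)
    show "min (u g) (u h) \<le> u (g + h)"
      using valL by (simp add: valuation_def u_def quot_field_carrier flip: quot_field_ops)
  qed (use f in auto)
  define N where "N = {h. f dvd h}"
  interpret N: max_ideal_of N
  proof
    show "\<exists>z. y * z - 1 \<in> N" if "y \<notin> N" for y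
      using quot_field_inverse[OF fieldL, of y] that by (simp add: N_def)
  qed (auto simp: N_def)
  define VR where "VR = {a. 0 \<le> v0 a}"
  have VR: "subr VR"
    unfolding subr_def VR_def
  proof (intro conjI ballI)
    show "1 \<in> {a. 0 \<le> v0 a}" using const[of 1] u_1 by (simp flip: one_pCons)
    fix a b assume ab: "a \<in> {a. 0 \<le> v0 a}" "b \<in> {a. 0 \<le> v0 a}"
    have "min (u [:a:]) (u [:b:]) \<le> u ([:a:] - [:b:])" by (rule u_diff)
    thus "a - b \<in> {a. 0 \<le> v0 a}" using ab const by (auto simp: min_def split: if_splits)
    have "u ([:a:] * [:b:]) = u [:a:] + u [:b:]" by (rule u_mult)
    hence "v0 (a * b) = v0 a + v0 b" using const by (simp add: mult.commute)
    thus "a * b \<in> {a. 0 \<le> v0 a}" using ab by (simp add: add_nonneg_nonneg)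
  qed
  define C where "C = (\<lambda>a. [:a:]) ` VR"
  have C: "subr C"
    unfolding subr_def C_def using subrD[OF VR] by (force simp: one_pCons)
  have uC: "0 \<le> u c" if "c \<in> C" for c using that const by (auto simp: C_def VR_def)
  have main: "\<exists>G. lead_coeff G = 1 \<and> (\<forall>i. 0 \<le> v0 (poly.coeff G i)) \<and> f dvd pcompose G g" if ug: "u g = 0" for g
  proof (rule ccontr)
    assume no: "\<not> ?thesis"
    have "g \<notin> N" using ug u_Infty[of g] by (auto simp: N_def)
    then obtain b where b: "g * b - 1 \<in> N" using N.N_inverse by blast
    hence gb: "N.cong (g * b) 1" by (simp add: N.cong_def)
    define R0 where "R0 = {s + n | s n. s \<in> adjoin C b \<and> n \<in> N}"
    have R0: "subr R0" unfolding R0_def by (intro N.subr_plus_ideal adjoin_subr C)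
    have sub: "adjoin C b \<subseteq> R0" "N \<subseteq> R0"
      using N.N0 subrD(2)[OF adjoin_subr(1)[OF C]] by (force simp: R0_def)+
    define J where "J = {[:a:] | a. 0 < v0 a} \<union> {b} \<union> N"
    have JR0: "J \<subseteq> R0"
    proof -
      have "[:a:] \<in> C" if "0 < v0 a" for a using that by (auto simp: C_def VR_def)
      thus ?thesis using sub adjoin_subr[OF C, of b] unfolding J_def by blast
    qed
    \<comment> \<open>elements of the ideal are polynomials in \<open>b\<close> whose constant term has positive value\<close>
    have low: "\<exists>p. (\<forall>i. poly.coeff p i \<in> C) \<and> 0 < u (poly.coeff p 0) \<and> x - poly p b \<in> N"
      if "x \<in> ideal_gen J R0" for x
      using that
    proof (induction x rule: ideal_gen.induct)
      case zero
      show ?case using subrD(2)[OF C] N.N0 by (intro exI[of _ 0]) auto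
    next
      case (add x j r)
      then obtain p where p: "\<forall>i. poly.coeff p i \<in> C" "0 < u (poly.coeff p 0)" "x - poly p b \<in> N" by blast
      obtain q n where q: "\<forall>i. poly.coeff q i \<in> C" "n \<in> N" "r = poly q b + n"
        using add.hyps(3) by (auto simp: R0_def adjoin_def)
      have jn: "j * n \<in> N" using q(2) by (rule N.N_mult)
      consider a where "j = [:a:]" "0 < v0 a" | "j = b" | "j \<in> N" using add.hyps(2) by (auto simp: J_def)
      thus ?case
      proof cases
        case 1
        have jC: "j \<in> C" using 1 by (auto simp: C_def VR_def)
        let ?p = "p + Polynomial.smult j q"
        have "u (j * poly.coeff q 0) = u j + u (poly.coeff q 0)" by (rule u_mult)
        also have "0 + 0 < \<dots>" using 1 const uC q(1) ext_add_less_le[of 0 "u j" 0] by simp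
        finally have "0 < u (j * poly.coeff q 0)" by simp
        hence "0 < min (u (poly.coeff p 0)) (u (j * poly.coeff q 0))" using p(2) by simp
        also have "\<dots> \<le> u (poly.coeff ?p 0)" using u_add by simp
        finally have "0 < u (poly.coeff ?p 0)" .
        moreover have "(x + j * r) - poly ?p b = (x - poly p b) + j * n" using q(3) by (simp add: algebra_simps)
        hence "(x + j * r) - poly ?p b \<in> N" using N.N_add[OF p(3) jn] by (simp only:)
        moreover have "\<forall>i. poly.coeff ?p i \<in> C" using p(1) q(1) jC subrD[OF C] by simp
        ultimately show ?thesis by blast
      next
        case 2
        let ?p = "p + pCons 0 q"
        have "(x + j * r) - poly ?p b = (x - poly p b) + j * n" using q(3) 2 by (simp add: algebra_simps)
        hence "(x + j * r) - poly ?p b \<in> N" using N.N_add[OF p(3) jn] by (simp only:)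
        moreover have "\<forall>i. poly.coeff ?p i \<in> C" using p(1) q(1) subrD[OF C]
          by (auto simp: coeff_pCons split: nat.splits)
        moreover have "0 < u (poly.coeff ?p 0)" using p(2) by simp
        ultimately show ?thesis by blast
      next
        case 3
        have "(x + j * r) - poly p b = (x - poly p b) + r * j" by (simp add: algebra_simps)
        hence "(x + j * r) - poly p b \<in> N" using N.N_add[OF p(3) N.N_mult[OF 3]] by (simp only:)
        thus ?thesis using p by blast
      qed
    qed
    have "1 \<notin> ideal_gen J R0"
    proof
      assume "1 \<in> ideal_gen J R0"
      from low[OF this] obtain p where p: "\<forall>i. poly.coeff p i \<in> C" "0 < u (poly.coeff p 0)" "1 - poly p b \<in> N"
        by blast
      then have "\<exists>a. \<forall>i. a i \<in> VR \<and> poly.coeff p i = [:a i:]" unfolding C_def by (intro choice) blast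
      then obtain a where a: "\<And>i. a i \<in> VR" "\<And>i. poly.coeff p i = [:a i:]" by blast
      define n where "n = degree p"
      define t where "t = 1 - a 0"
      have a0: "0 < v0 (a 0)" using p(2) a(2) const by simp
      have "u 1 < u [:a 0:]" using a0 const by simp
      from u_diff_eq[OF this] have t0: "v0 t = 0"
        using const[of t] u_1[unfolded one_pCons] by (simp add: t_def one_pCons)
      have tne: "t \<noteq> 0" using t0 const[of 0] by auto
      have "u ([:t:] * [:1 / t:]) = u [:t:] + u [:1 / t:]" by (rule u_mult)
      hence "v0 (1 / t) = 0" using tne t0 const u_1 by (cases "v0 (1 / t)") (auto simp: one_pCons zero_ext_value_def)
      hence tO: "1 / t \<in> VR" by (simp add: VR_def)
      define S where "S = (\<Sum>i\<in>{1..n}. Polynomial.monom (1 / t * a i) (n - i))"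
      define G where "G = Polynomial.monom 1 n - S"
      have "a i / t \<in> VR" for i using subrD(4)[OF VR tO a(1)[of i]] by simp
      hence SO: "poly.coeff S k \<in> VR" for k
        unfolding S_def coeff_sum coeff_monom using subrD(2)[OF VR] by (intro subr_sum[OF VR]) auto
      have S0: "poly.coeff S k = 0" if "k \<ge> n" for k
        unfolding S_def coeff_sum coeff_monom using that by (intro sum.neutral) auto
      have GO: "poly.coeff G k \<in> VR" for k
        using SO subrD[OF VR] by (auto simp: G_def)
      have "poly.coeff G n = 1" "\<And>k. k > n \<Longrightarrow> poly.coeff G k = 0" using S0 by (auto simp: G_def)
      moreover from this have "degree G = n" by (intro antisym degree_le le_degree) auto
      ultimately have lc: "lead_coeff G = 1" by simp
      have "N.cong (g ^ n * 1) (g ^ n * poly p b)" using p(3) by (intro N.cong_mult) (simp add: N.cong_def)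
      also have "N.cong (g ^ n * poly p b) (\<Sum>i\<le>n. poly.coeff p i * g ^ (n - i))"
        by (rule N.reverse_poly[OF gb]) (simp add: n_def)
      also have "(\<Sum>i\<le>n. poly.coeff p i * g ^ (n - i)) = [:a 0:] * g ^ n + (\<Sum>i\<in>{1..n}. [:a i:] * g ^ (n - i))"
        by (simp add: a(2) atMost_atLeast0 sum.atLeast_Suc_atMost)
      finally have "g ^ n - ([:a 0:] * g ^ n + (\<Sum>i\<in>{1..n}. [:a i:] * g ^ (n - i))) \<in> N" by (simp add: N.cong_def)
      moreover have "[:t:] * pcompose G g = g ^ n - ([:a 0:] * g ^ n + (\<Sum>i\<in>{1..n}. [:a i:] * g ^ (n - i)))"
      proof -
        have "pcompose (Polynomial.monom c k) g = [:c:] * g ^ k" for c k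
          by (simp add: pcompose_altdef map_poly_monom poly_monom)
        hence "pcompose G g = g ^ n - (\<Sum>i\<in>{1..n}. [:1 / t * a i:] * g ^ (n - i))"
          by (simp add: G_def S_def pcompose_diff pcompose_sum)
        hence "[:t:] * pcompose G g = [:t:] * g ^ n - (\<Sum>i\<in>{1..n}. [:t:] * ([:1 / t * a i:] * g ^ (n - i)))"
          by (simp only: right_diff_distrib sum_distrib_left)
        moreover have "[:t:] * ([:1 / t * a i:] * g ^ (n - i)) = [:a i:] * g ^ (n - i)" for i using tne by simp
        moreover have "[:t:] * g ^ n = g ^ n - [:a 0:] * g ^ n" by (simp add: t_def smult_diff_left)
        ultimately show ?thesis by simp
      qed
      ultimately have "f dvd [:t:] * pcompose G g" by (simp add: N_def)
      hence "f dvd pcompose G g" using tne by (simp add: dvd_smult_iff)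
      thus False using no lc GO by (auto simp: VR_def)
    qed
    from N.chevalley[OF R0 JR0 _ this] obtain R where R: "subr R" "R0 \<subseteq> R" "1 \<notin> ideal_gen J R"
      and tot: "\<And>y z. N.cong (y * z) 1 \<Longrightarrow> y \<in> R \<or> z \<in> R"
      by (auto simp: J_def)
    have JR: "J \<subseteq> R" and NR: "N \<subseteq> R" using JR0 R(2) sub by auto
    have clsR: "cls f h \<in> cls f ` R \<longleftrightarrow> h \<in> R" for h
    proof
      assume "cls f h \<in> cls f ` R"
      then obtain r where r: "r \<in> R" "f dvd h - r" by (auto simp: cls_eq_iff)
      hence "h - r \<in> R" using NR by (auto simp: N_def)
      from subrD(5)[OF R(1) r(1) this] show "h \<in> R" by simp
    qed simp
    have gR: "g \<notin> R"
    proof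
      assume "g \<in> R"
      hence "b * g \<in> ideal_gen J R" by (intro ideal_gen_mem) (auto simp: J_def)
      moreover have "- (g * b - 1) \<in> J" using N.N_uminus[OF b] unfolding J_def by blast
      hence "- (g * b - 1) \<in> ideal_gen J R" by (rule ideal_gen_base[OF R(1)])
      ultimately have "b * g + - (g * b - 1) \<in> ideal_gen J R" by (rule ideal_gen_add)
      thus False using R(3) by (simp add: mult.commute)
    qed
    have constR: "[:a:] \<in> R \<longleftrightarrow> 0 \<le> v0 a" for a
    proof
      assume "0 \<le> v0 a"
      hence "[:a:] \<in> adjoin C b" using adjoin_subr(2)[OF C] by (auto simp: C_def VR_def)
      thus "[:a:] \<in> R" using sub R by blast
    next
      assume aR: "[:a:] \<in> R"
      show "0 \<le> v0 a"
      proof (rule ccontr)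
        assume "\<not> 0 \<le> v0 a"
        hence neg: "v0 a < 0" by simp
        hence a0: "a \<noteq> 0" using const[of 0] by auto
        have "u ([:a:] * [:1 / a:]) = u [:a:] + u [:1 / a:]" by (rule u_mult)
        hence "v0 a + v0 (1 / a) = 0" using a0 const u_1 by (simp add: one_pCons)
        hence "0 < v0 (1 / a)" using neg
          by (cases "v0 a"; cases "v0 (1 / a)") (auto simp: zero_ext_value_def neg_eq_iff_add_eq_0[symmetric])
        hence "[:1 / a:] * [:a:] \<in> ideal_gen J R" using aR by (intro ideal_gen_mem) (auto simp: J_def)
        thus False using R(3) a0 by (simp add: one_pCons)
      qed
    qed
    note BL = subring_cls[OF fieldL R(1)]
    have BV: "x \<in> cls f ` R \<or> inv\<^bsub>units_of (quot_field f)\<^esub> x \<in> cls f ` R" if x: "x \<in> Units (quot_field f)" for x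
    proof -
      obtain y where y: "x = cls f y" using x by (auto simp: Units_def quot_field_carrier)
      have "\<not> f dvd y" using x y by (simp add: L.field_Units quot_field_zero cls_eq_iff)
      then obtain z where z: "f dvd y * z - 1" using quot_field_inverse[OF fieldL] by blast
      hence "y * z - 1 \<in> N" by (simp add: N_def)
      hence "N.cong (y * z) 1" by (simp only: N.cong_def)
      hence "y \<in> R \<or> z \<in> R" by (rule tot)
      thus ?thesis using quot_field_inv[OF fieldL z] y by auto
    qed
    define G where "G = units_of (quot_field f) Mod L.unit_group (cls f ` R)"
    define r where "r = L.val_order (cls f ` R)"
    define w where "w = L.val_of (cls f ` R)"
    have cv: "carrier_valuation (quot_field f) G r w"
      unfolding G_def r_def w_def by (rule L.valuation_ring_valuation[OF BL BV])
    have order: "(w x, w y) \<in> r \<longleftrightarrow> y \<otimes>\<^bsub>quot_field f\<^esub> inv\<^bsub>units_of (quot_field f)\<^esub> x \<in> cls f ` R"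
      if "x \<in> Units (quot_field f)" "y \<in> Units (quot_field f)" for x y
      unfolding r_def w_def by (rule L.val_order_iff[OF BL BV that])
    have ext: "(w (cls f [:a:]), w (cls f [:c:])) \<in> r \<longleftrightarrow> v0 a \<le> v0 c" if ac: "a \<noteq> 0" "c \<noteq> 0" for a c
    proof -
      have 1: "f dvd [:a:] * [:1 / a:] - 1" "f dvd [:c:] * [:1 / c:] - 1" using ac by (simp_all add: one_pCons)
      have "(w (cls f [:a:]), w (cls f [:c:])) \<in> r \<longleftrightarrow> [:c / a:] \<in> R"
        using order[OF quot_field_inv(1)[OF fieldL 1(1)] quot_field_inv(1)[OF fieldL 1(2)]]
        by (simp add: quot_field_inv(2)[OF fieldL 1(1)] quot_field_ops clsR)
      also have "\<dots> \<longleftrightarrow> 0 \<le> v0 (c / a)" by (rule constR)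
      also have "\<dots> \<longleftrightarrow> v0 a \<le> v0 c"
      proof -
        have "u ([:c / a:] * [:a:]) = u [:c / a:] + u [:a:]" by (rule u_mult)
        hence "v0 c = v0 (c / a) + v0 a" using ac const by simp
        moreover have "v0 a \<noteq> Infty" using ac const[of a] u_finite[of "[:a:]"] f by simp
        ultimately show ?thesis by (cases "v0 a"; cases "v0 (c / a)") (auto simp: zero_ext_value_def)
      qed
      finally show ?thesis .
    qed
    have "\<forall>x\<in>carrier (quot_field f) - {\<zero>\<^bsub>quot_field f\<^esub>}. \<forall>y\<in>carrier (quot_field f) - {\<zero>\<^bsub>quot_field f\<^esub>}.
           (w x, w y) \<in> r \<longleftrightarrow> v x \<le> v y"
      using uniq[unfolded unique_extension_def, THEN conjunct2, THEN conjunct2, rule_format, of G r w] cv ext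
      by (simp add: cring_class_ops_def)
    moreover have U: "cls f 1 \<in> Units (quot_field f)" "cls f g \<in> Units (quot_field f)"
      using quot_field_inv(1)[OF fieldL, of 1 1] quot_field_inv(1)[OF fieldL, of g b] b by (auto simp: N_def)
    ultimately have "(w (cls f 1), w (cls f g)) \<in> r \<longleftrightarrow> v (cls f 1) \<le> v (cls f g)"
      unfolding L.field_Units by blast
    hence "(w (cls f 1), w (cls f g)) \<in> r" using ug u_1 by (simp add: u_def)
    hence "cls f g \<in> cls f ` R"
      using order[OF U] quot_field_inv(2)[OF fieldL, of 1 1] by (simp add: quot_field_ops)
    thus False using clsR gR by simp
  qed
  have "integral_val f u v0" by standard (use const main in auto)
  thus ?thesis by (simp add: u_def[abs_def])
qed

section \<open>Graded rings as images of Rees algebras\<close>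

lemma cring_of_surjection:
  assumes "cring R" "h \<in> ring_hom R S" "h ` carrier R = carrier S" "h \<zero>\<^bsub>R\<^esub> = \<zero>\<^bsub>S\<^esub>"
  shows "cring S"
proof -
  interpret R: cring R by fact
  have "ring (S \<lparr>carrier := h ` carrier R, zero := h \<zero>\<^bsub>R\<^esub>\<rparr>)"
    by (rule R.ring_hom_imp_img_ring[OF assms(2)])
  hence r: "ring S" using assms(3,4) by simp
  interpret S: ring S by (rule r)
  have "comm_monoid S"
  proof (rule S.monoid_comm_monoidI)
    fix x y assume "x \<in> carrier S" "y \<in> carrier S"
    then obtain a b where ab: "a \<in> carrier R" "b \<in> carrier R" "x = h a" "y = h b" using assms(3) by blast
    thus "x \<otimes>\<^bsub>S\<^esub> y = y \<otimes>\<^bsub>S\<^esub> x" using ring_hom_mult[OF assms(2)] R.m_comm by metis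
  qed
  thus ?thesis by (rule cringI[OF S.abelian_group_axioms _ S.l_distr])
qed

lemma subr_subring: "subr Q \<Longrightarrow> subring Q (cring_class_ops :: 'r::comm_ring_1 ring)"
  using subrD[of Q]
  by (intro ring.subringI[OF cring.axioms(1)[OF cring_class]]) (auto simp: carrier_class class_simps)

lemma subr_cring:
  assumes "subr Q"
  shows "cring (cring_class_ops \<lparr>carrier := Q\<rparr> :: 'r::comm_ring_1 ring)"
proof -
  interpret Q: ring "cring_class_ops \<lparr>carrier := Q\<rparr> :: 'r ring"
    by (rule ring.subring_is_ring[OF cring.axioms(1)[OF cring_class] subr_subring[OF assms]])
  have "comm_monoid (cring_class_ops \<lparr>carrier := Q\<rparr> :: 'r ring)"
    by (rule Q.monoid_comm_monoidI) (simp add: cring_class_ops_def mult.commute)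
  thus ?thesis by (rule cringI[OF Q.abelian_group_axioms _ Q.l_distr])
qed

text \<open>
  The graded ring of \<open>R\<close> is the quotient of the Rees algebra, the elements \<open>\<Sum> a\<^sub>\<gamma> T\<^sup>\<gamma>\<close> of the group algebra
  with \<open>w(a\<^sub>\<gamma>) \<ge> \<gamma>\<close>, by those with \<open>w(a\<^sub>\<gamma>) > \<gamma>\<close>. The map \<open>\<pi>\<close> from a type \<open>'r\<close> allows coefficients
  to be represented in a type-class ring: constants for \<open>A\<close>, polynomials for \<open>A[x]/(f)\<close>.
\<close>

locale gr_rep =
  fixes F :: "('a, 'm) ring_scheme" and w :: "'a \<Rightarrow> 'g::linordered_ab_group_add ext_value"
    and \<pi> :: "'r::comm_ring_1 \<Rightarrow> 'a" and R' :: "'r set" and R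
  assumes val: "valuation F w" and hom: "\<pi> \<in> ring_hom cring_class_ops F" and sub: "subr R'"
    and R: "R = \<pi> ` R'"
begin

abbreviation "\<Gamma> \<equiv> value_group F w"

definition "\<omega> r = w (\<pi> r)"

lemma field_F: "field F" using val by (simp add: valuation_def)

interpretation F: field F by (rule field_F)

lemma shows hom_simps [simp]:
  "\<pi> r \<in> carrier F" "\<pi> r \<oplus>\<^bsub>F\<^esub> \<pi> s = \<pi> (r + s)" "\<pi> r \<otimes>\<^bsub>F\<^esub> \<pi> s = \<pi> (r * s)"
  and hom_one: "\<one>\<^bsub>F\<^esub> = \<pi> 1"
  using ring_hom_closed[OF hom, of r] ring_hom_add[OF hom, of r s] ring_hom_mult[OF hom, of r s] ring_hom_one[OF hom]
  by (simp_all add: cring_class_ops_def)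

lemma hom_zero: "\<pi> 0 = \<zero>\<^bsub>F\<^esub>"
  using ring_hom_zero[OF hom cring.axioms(1)[OF cring_class] F.ring_axioms] by (simp add: zero_class)

lemma \<pi>_diff_cong: "\<pi> r = \<pi> t \<Longrightarrow> \<pi> (r - s) = \<pi> (t - s)"
  using hom_simps(2)[of r "- s"] hom_simps(2)[of t "- s"] by simp

lemma \<omega>_mult: "\<omega> (r * s) = \<omega> r + \<omega> s"
  using val by (simp add: \<omega>_def valuation_def flip: hom_simps(3))

lemma \<omega>_add: "min (\<omega> r) (\<omega> s) \<le> \<omega> (r + s)"
  using val by (simp add: \<omega>_def valuation_def flip: hom_simps(2))

lemma \<omega>_0 [simp]: "\<omega> 0 = Infty"
  using val hom_zero by (simp add: \<omega>_def valuation_def)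

lemma \<omega>_1 [simp]: "\<omega> 1 = 0"
proof -
  have "\<pi> 1 \<noteq> \<pi> 0" using F.one_not_zero hom_zero hom_one by simp
  hence "\<omega> 1 \<noteq> Infty" using val hom_zero by (simp add: \<omega>_def valuation_def)
  moreover have "\<omega> 1 = \<omega> 1 + \<omega> 1" using \<omega>_mult[of 1 1] by simp
  ultimately show ?thesis by (cases "\<omega> 1") auto
qed

lemma \<omega>_uminus [simp]: "\<omega> (- r) = \<omega> r"
proof -
  have "\<omega> (-1) + \<omega> (-1) = 0" using \<omega>_mult[of "-1" "-1"] by simp
  hence "\<omega> (-1) = 0" by (cases "\<omega> (-1)") (auto simp: double_zero)
  thus ?thesis using \<omega>_mult[of "-1" r] by simp
qed

lemma \<omega>_gt_add: "\<gamma> < \<omega> r \<Longrightarrow> \<gamma> < \<omega> s \<Longrightarrow> \<gamma> < \<omega> (r + s)"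
  using less_le_trans[OF _ \<omega>_add] by simp

lemma \<omega>_ge_add: "\<gamma> \<le> \<omega> r \<Longrightarrow> \<gamma> \<le> \<omega> s \<Longrightarrow> \<gamma> \<le> \<omega> (r + s)"
  using order_trans[OF _ \<omega>_add] by simp

lemma \<omega>_gt_diff: "\<gamma> < \<omega> r \<Longrightarrow> \<gamma> < \<omega> s \<Longrightarrow> \<gamma> < \<omega> (r - s)"
  using \<omega>_gt_add[of \<gamma> r "- s"] by simp

lemma \<omega>_gt_sum: "(\<And>i. i \<in> I \<Longrightarrow> Fin \<gamma> < \<omega> (g i)) \<Longrightarrow> Fin \<gamma> < \<omega> (sum g I)"
  by (induction I rule: infinite_finite_induct) (auto intro: \<omega>_gt_add)

lemma \<omega>_ge_sum: "(\<And>i. i \<in> I \<Longrightarrow> \<gamma> \<le> \<omega> (g i)) \<Longrightarrow> \<gamma> \<le> \<omega> (sum g I)"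
  by (induction I rule: infinite_finite_induct) (auto intro: \<omega>_ge_add)

lemma value_group_diff:
  assumes "\<alpha> \<in> \<Gamma>" "\<beta> \<in> \<Gamma>"
  shows "\<alpha> - \<beta> \<in> \<Gamma>"
proof -
  obtain x y where x: "x \<in> carrier F" "w x = Fin \<alpha>" and y: "y \<in> carrier F" "w y = Fin \<beta>"
    using assms by (force simp: value_group_def)
  have "y \<noteq> \<zero>\<^bsub>F\<^esub>" using val y by (force simp: valuation_def)
  hence yU: "y \<in> Units F" using y by (simp add: F.field_Units)
  let ?z = "x \<otimes>\<^bsub>F\<^esub> inv\<^bsub>F\<^esub> y"
  have z: "?z \<in> carrier F" using x yU by simp
  have "?z \<otimes>\<^bsub>F\<^esub> y = x" using x y yU by (simp add: F.m_assoc)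
  hence "w x = w ?z + w y" using val z y by (metis valuation_def)
  hence "w ?z = Fin (\<alpha> - \<beta>)" using x y by (cases "w ?z") auto
  thus ?thesis using z by (force simp: value_group_def)
qed

definition residue_coset :: "'g \<Rightarrow> 'r \<Rightarrow> 'a set" where
  "residue_coset \<gamma> r = P_gt w R \<gamma> +>\<^bsub>F\<^esub> \<pi> r"

lemma P_gt_eq: "P_gt w R \<gamma> = \<pi> ` {h \<in> R'. Fin \<gamma> < \<omega> h}"
  by (auto simp: P_gt_def R \<omega>_def)

lemma P_ge_eq: "P_ge w R \<gamma> = \<pi> ` {h \<in> R'. Fin \<gamma> \<le> \<omega> h}"
  by (auto simp: P_ge_def R \<omega>_def)

lemma residue_coset_eq: "r \<in> R' \<Longrightarrow> residue_coset \<gamma> r = \<pi> ` {s \<in> R'. Fin \<gamma> < \<omega> (s - r)}"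
proof -
  assume r: "r \<in> R'"
  have "residue_coset \<gamma> r = (\<lambda>h. \<pi> (h + r)) ` {h \<in> R'. Fin \<gamma> < \<omega> h}"
    by (auto simp: residue_coset_def a_r_coset_def r_coset_def P_gt_eq)
  also have "\<dots> = \<pi> ` ((\<lambda>h. h + r) ` {h \<in> R'. Fin \<gamma> < \<omega> h})" by (simp add: image_image)
  also have "(\<lambda>h. h + r) ` {h \<in> R'. Fin \<gamma> < \<omega> h} = {s \<in> R'. Fin \<gamma> < \<omega> (s - r)}"
  proof (rule antisym; rule subsetI)
    fix s assume "s \<in> {s \<in> R'. Fin \<gamma> < \<omega> (s - r)}"
    thus "s \<in> (\<lambda>h. h + r) ` {h \<in> R'. Fin \<gamma> < \<omega> h}"
      using subrD(3)[OF sub] r by (intro image_eqI[of _ _ "s - r"]) auto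
  qed (use subrD(5)[OF sub] r in auto)
  finally show ?thesis .
qed

lemma residue_coset_cong: "r \<in> R' \<Longrightarrow> s \<in> R' \<Longrightarrow> residue_coset \<gamma> r = residue_coset \<gamma> s \<longleftrightarrow> Fin \<gamma> < \<omega> (r - s)"
proof
  assume rs: "r \<in> R'" "s \<in> R'"
  { assume "residue_coset \<gamma> r = residue_coset \<gamma> s"
    moreover have "\<pi> r \<in> residue_coset \<gamma> r" using rs by (auto simp: residue_coset_eq)
    ultimately obtain t where "\<pi> r = \<pi> t" "Fin \<gamma> < \<omega> (t - s)" using rs by (auto simp: residue_coset_eq)
    thus "Fin \<gamma> < \<omega> (r - s)" unfolding \<omega>_def using \<pi>_diff_cong[of r t s] by argo }
  { assume l: "Fin \<gamma> < \<omega> (r - s)"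
    have "Fin \<gamma> < \<omega> (t - r) \<longleftrightarrow> Fin \<gamma> < \<omega> (t - s)" for t
      using \<omega>_gt_add[of _ "t - r" "r - s"] \<omega>_gt_diff[of _ "t - s" "r - s"] l by auto
    hence "{t \<in> R'. Fin \<gamma> < \<omega> (t - r)} = {t \<in> R'. Fin \<gamma> < \<omega> (t - s)}" by blast
    thus "residue_coset \<gamma> r = residue_coset \<gamma> s" unfolding residue_coset_eq[OF rs(1)] residue_coset_eq[OF rs(2)] by (rule arg_cong) }
qed

lemma residue_coset_0: "residue_coset \<gamma> 0 = P_gt w R \<gamma>"
  using residue_coset_eq[of 0] subrD(2)[OF sub] by (simp add: P_gt_eq)

lemma residue_coset_eq_0_iff: "r \<in> R' \<Longrightarrow> residue_coset \<gamma> r = P_gt w R \<gamma> \<longleftrightarrow> Fin \<gamma> < \<omega> r"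
  using residue_coset_cong[of r 0] subrD(2)[OF sub] by (simp add: residue_coset_0)

lemma residue_coset_add: "r \<in> R' \<Longrightarrow> s \<in> R' \<Longrightarrow> residue_coset \<gamma> r <#>\<^bsub>add_monoid F\<lparr>carrier := X\<rparr>\<^esub> residue_coset \<gamma> s = residue_coset \<gamma> (r + s)"
proof -
  assume rs: "r \<in> R'" "s \<in> R'"
  have rs': "r + s \<in> R'" using subrD(5)[OF sub] rs .
  show ?thesis
    unfolding residue_coset_eq[OF rs(1)] residue_coset_eq[OF rs(2)] residue_coset_eq[OF rs'] set_mult_def
  proof (rule antisym; rule subsetI)
    fix x assume "x \<in> (\<Union>h\<in>\<pi> ` {t \<in> R'. Fin \<gamma> < \<omega> (t - r)}. \<Union>k\<in>\<pi> ` {t \<in> R'. Fin \<gamma> < \<omega> (t - s)}.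
      {h \<otimes>\<^bsub>add_monoid F\<lparr>carrier := X\<rparr>\<^esub> k})"
    then obtain t1 t2 where t: "t1 \<in> R'" "t2 \<in> R'" "Fin \<gamma> < \<omega> (t1 - r)" "Fin \<gamma> < \<omega> (t2 - s)" "x = \<pi> (t1 + t2)" by auto
    have "t1 + t2 - (r + s) = (t1 - r) + (t2 - s)" by simp
    hence "Fin \<gamma> < \<omega> (t1 + t2 - (r + s))" using \<omega>_gt_add t by metis
    thus "x \<in> \<pi> ` {t \<in> R'. Fin \<gamma> < \<omega> (t - (r + s))}" using t subrD(5)[OF sub] by blast
  next
    fix x assume "x \<in> \<pi> ` {t \<in> R'. Fin \<gamma> < \<omega> (t - (r + s))}"
    then obtain t where t: "t \<in> R'" "Fin \<gamma> < \<omega> (t - (r + s))" "x = \<pi> t" by blast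
    have ts: "t - s \<in> R'" "t - s - r = t - (r + s)" using t rs subrD(3)[OF sub] by auto
    show "x \<in> (\<Union>h\<in>\<pi> ` {t \<in> R'. Fin \<gamma> < \<omega> (t - r)}. \<Union>k\<in>\<pi> ` {t \<in> R'. Fin \<gamma> < \<omega> (t - s)}.
      {h \<otimes>\<^bsub>add_monoid F\<lparr>carrier := X\<rparr>\<^esub> k})"
    proof (rule UN_I[of "\<pi> (t - s)"], goal_cases)
      case 1
      have "Fin \<gamma> < \<omega> (t - s - r)" unfolding ts(2) by (rule t(2))
      thus ?case using ts(1) by blast
    next
      case 2
      show ?case
      proof (rule UN_I[of "\<pi> s"], goal_cases)
        case 1
        show ?case using rs by (intro imageI) simp
      next
        case 2
        show ?case using t by simp
      qed
    qed
  qed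
qed

lemma r_coset_eq_residue_coset: "monoid.mult G = (\<oplus>\<^bsub>F\<^esub>) \<Longrightarrow> P_gt w R \<gamma> #>\<^bsub>G\<^esub> \<pi> r = residue_coset \<gamma> r"
  by (simp add: residue_coset_def a_r_coset_def r_coset_def)

lemma gr_piece_simps:
  "carrier (gr_piece F w R \<gamma>) = residue_coset \<gamma> ` {r \<in> R'. Fin \<gamma> \<le> \<omega> r}"
  "\<one>\<^bsub>gr_piece F w R \<gamma>\<^esub> = residue_coset \<gamma> 0"
  "r \<in> R' \<Longrightarrow> s \<in> R' \<Longrightarrow> residue_coset \<gamma> r \<otimes>\<^bsub>gr_piece F w R \<gamma>\<^esub> residue_coset \<gamma> s = residue_coset \<gamma> (r + s)"
proof -
  show "carrier (gr_piece F w R \<gamma>) = residue_coset \<gamma> ` {r \<in> R'. Fin \<gamma> \<le> \<omega> r}"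
    unfolding gr_piece_def FactGroup_def RCOSETS_def
    by (auto simp: P_ge_eq r_coset_eq_residue_coset)
  show "\<one>\<^bsub>gr_piece F w R \<gamma>\<^esub> = residue_coset \<gamma> 0" by (simp add: gr_piece_def FactGroup_def residue_coset_0)
  show "r \<in> R' \<Longrightarrow> s \<in> R' \<Longrightarrow> residue_coset \<gamma> r \<otimes>\<^bsub>gr_piece F w R \<gamma>\<^esub> residue_coset \<gamma> s = residue_coset \<gamma> (r + s)"
    using residue_coset_add[where r = r and s = s and \<gamma> = \<gamma>] by (simp add: gr_piece_def FactGroup_def)
qed

lemma gr_piece_comm_group: "comm_group (gr_piece F w R \<gamma>)"
proof (rule comm_groupI)
  note s = subrD[OF sub]
  show "\<one>\<^bsub>gr_piece F w R \<gamma>\<^esub> \<in> carrier (gr_piece F w R \<gamma>)"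
    using s by (auto simp: gr_piece_simps intro!: imageI)
  fix x y z assume "x \<in> carrier (gr_piece F w R \<gamma>)" "y \<in> carrier (gr_piece F w R \<gamma>)"
  then obtain a b where ab: "x = residue_coset \<gamma> a" "y = residue_coset \<gamma> b" "a \<in> R'" "b \<in> R'" "Fin \<gamma> \<le> \<omega> a" "Fin \<gamma> \<le> \<omega> b"
    by (auto simp: gr_piece_simps)
  show "x \<otimes>\<^bsub>gr_piece F w R \<gamma>\<^esub> y \<in> carrier (gr_piece F w R \<gamma>)"
    using ab s by (auto simp: gr_piece_simps intro!: imageI \<omega>_ge_add)
  show "x \<otimes>\<^bsub>gr_piece F w R \<gamma>\<^esub> y = y \<otimes>\<^bsub>gr_piece F w R \<gamma>\<^esub> x"
    using ab by (simp add: gr_piece_simps add.commute)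
  show "\<one>\<^bsub>gr_piece F w R \<gamma>\<^esub> \<otimes>\<^bsub>gr_piece F w R \<gamma>\<^esub> x = x" using ab s by (simp add: gr_piece_simps)
  show "\<exists>y\<in>carrier (gr_piece F w R \<gamma>). y \<otimes>\<^bsub>gr_piece F w R \<gamma>\<^esub> x = \<one>\<^bsub>gr_piece F w R \<gamma>\<^esub>"
    using ab s by (intro bexI[of _ "residue_coset \<gamma> (- a)"]) (auto simp: gr_piece_simps)
  assume "z \<in> carrier (gr_piece F w R \<gamma>)"
  then obtain c where c: "z = residue_coset \<gamma> c" "c \<in> R'" by (auto simp: gr_piece_simps)
  show "x \<otimes>\<^bsub>gr_piece F w R \<gamma>\<^esub> y \<otimes>\<^bsub>gr_piece F w R \<gamma>\<^esub> z = x \<otimes>\<^bsub>gr_piece F w R \<gamma>\<^esub> (y \<otimes>\<^bsub>gr_piece F w R \<gamma>\<^esub> z)"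
    using ab c s by (simp add: gr_piece_simps add.assoc)
qed

lemma finprod_residue_coset:
  assumes "finite I" "\<And>i. i \<in> I \<Longrightarrow> r i \<in> R' \<and> Fin \<gamma> \<le> \<omega> (r i)" "\<And>i. i \<in> I \<Longrightarrow> X i = residue_coset \<gamma> (r i)"
  shows "finprod (gr_piece F w R \<gamma>) X I = residue_coset \<gamma> (\<Sum>i\<in>I. r i)"
  using assms
proof (induction I)
  case empty
  interpret G: comm_group "gr_piece F w R \<gamma>" by (rule gr_piece_comm_group)
  show ?case by (simp add: gr_piece_simps)
next
  case (insert i I)
  interpret G: comm_group "gr_piece F w R \<gamma>" by (rule gr_piece_comm_group)
  have "X \<in> I \<rightarrow> carrier (gr_piece F w R \<gamma>)" "X i \<in> carrier (gr_piece F w R \<gamma>)"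
    using insert.prems by (auto simp: gr_piece_simps)
  hence "finprod (gr_piece F w R \<gamma>) X (insert i I) = X i \<otimes>\<^bsub>gr_piece F w R \<gamma>\<^esub> finprod (gr_piece F w R \<gamma>) X I"
    using insert.hyps by (intro G.finprod_insert)
  also have "\<dots> = residue_coset \<gamma> (r i) \<otimes>\<^bsub>gr_piece F w R \<gamma>\<^esub> residue_coset \<gamma> (\<Sum>i\<in>I. r i)" using insert by simp
  also have "\<dots> = residue_coset \<gamma> (r i + (\<Sum>i\<in>I. r i))"
    using insert.prems by (intro gr_piece_simps subr_sum[OF sub]) auto
  finally show ?case using insert.hyps by simp
qed

text \<open>
  The product of cosets does not depend on representatives: changing one factor within its coset
  changes the product by an element of value above \<open>\<gamma>\<close>.
\<close>

lemma rcoset_mult_residue_coset: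
  assumes "r \<in> R'" "s \<in> R'" "Fin \<alpha> \<le> \<omega> r" "Fin (\<gamma> - \<alpha>) \<le> \<omega> s"
  shows "rcoset_mult F (P_gt w R \<gamma>) (residue_coset \<alpha> r) (residue_coset (\<gamma> - \<alpha>) s) = residue_coset \<gamma> (r * s)"
proof -
  have "P_gt w R \<gamma> +>\<^bsub>F\<^esub> (a \<otimes>\<^bsub>F\<^esub> b) = residue_coset \<gamma> (r * s)" if ab: "a \<in> residue_coset \<alpha> r" "b \<in> residue_coset (\<gamma> - \<alpha>) s" for a b
  proof -
    obtain r' s' where r': "r' \<in> R'" "Fin \<alpha> < \<omega> (r' - r)" "a = \<pi> r'" and s': "s' \<in> R'" "Fin (\<gamma> - \<alpha>) < \<omega> (s' - s)" "b = \<pi> s'"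
      using ab assms by (auto simp: residue_coset_eq)
    have "Fin \<alpha> \<le> \<omega> r'" using \<omega>_ge_add[of "Fin \<alpha>" r "r' - r"] assms(3) r'(2) by (simp add: less_imp_le)
    hence "Fin \<alpha> + Fin (\<gamma> - \<alpha>) < \<omega> r' + \<omega> (s' - s)" using s' by (intro ext_add_le_less) auto
    hence 1: "Fin \<gamma> < \<omega> (r' * (s' - s))" by (simp add: \<omega>_mult)
    have "Fin \<alpha> + Fin (\<gamma> - \<alpha>) < \<omega> (r' - r) + \<omega> s" using r' assms by (intro ext_add_less_le) auto
    hence 2: "Fin \<gamma> < \<omega> ((r' - r) * s)" by (simp add: \<omega>_mult)
    have "r' * s' - r * s = r' * (s' - s) + (r' - r) * s" by (simp add: algebra_simps)
    hence "Fin \<gamma> < \<omega> (r' * s' - r * s)" using \<omega>_gt_add[OF 1 2] by simp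
    hence "residue_coset \<gamma> (r' * s') = residue_coset \<gamma> (r * s)" using assms r' s' subrD(4)[OF sub] by (simp add: residue_coset_cong)
    thus ?thesis using r' s' by (simp add: residue_coset_def)
  qed
  moreover have "\<pi> r \<in> residue_coset \<alpha> r" "\<pi> s \<in> residue_coset (\<gamma> - \<alpha>) s" using assms by (auto simp: residue_coset_eq)
  ultimately show ?thesis unfolding rcoset_mult_def by blast
qed

definition Rees :: "('g \<Rightarrow>\<^sub>0 'r) set" where
  "Rees = {a. \<forall>\<gamma>. lookup a \<gamma> \<in> R' \<and> Fin \<gamma> \<le> \<omega> (lookup a \<gamma>)}"

definition \<rho> :: "('g \<Rightarrow>\<^sub>0 'r) \<Rightarrow> 'g \<Rightarrow> 'a set" where
  "\<rho> a = (\<lambda>\<gamma>\<in>\<Gamma>. residue_coset \<gamma> (lookup a \<gamma>))"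

lemma ReesD: "a \<in> Rees \<Longrightarrow> lookup a \<gamma> \<in> R'" "a \<in> Rees \<Longrightarrow> Fin \<gamma> \<le> \<omega> (lookup a \<gamma>)"
  by (auto simp: Rees_def)

end

lemma lookup_mult_group:
  fixes a b :: "'g::ab_group_add \<Rightarrow>\<^sub>0 'r::comm_ring_1"
  shows "lookup (a * b) \<gamma> = (\<Sum>\<alpha>\<in>keys a. lookup a \<alpha> * lookup b (\<gamma> - \<alpha>))"
proof -
  have "(\<Sum>q. lookup b q when \<gamma> = l + q) = lookup b (\<gamma> - l)" for l
  proof -
    have "(\<lambda>q. lookup b q when \<gamma> = l + q) = (\<lambda>q. lookup b q when q = \<gamma> - l)"
      by (auto simp: when_def fun_eq_iff)
    thus ?thesis by (simp only: Sum_any_when_equal)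
  qed
  hence "lookup (a * b) \<gamma> = (\<Sum>l. lookup a l * lookup b (\<gamma> - l))" by (simp add: lookup_mult)
  also have "\<dots> = (\<Sum>\<alpha>\<in>keys a. lookup a \<alpha> * lookup b (\<gamma> - \<alpha>))"
    by (rule Sum_any.expand_superset) (auto simp: in_keys_iff)
  finally show ?thesis .
qed

context gr_rep
begin

interpretation F: field F by (rule field_F)

lemma single_Rees: "r \<in> R' \<Longrightarrow> Fin \<gamma> \<le> \<omega> r \<Longrightarrow> single \<gamma> r \<in> Rees"
  using subrD(2)[OF sub] by (auto simp: Rees_def lookup_single when_def)

lemma Rees_subr: "subr Rees"
  unfolding subr_def
proof (intro conjI ballI)
  have "single 0 1 \<in> Rees" using subrD(1)[OF sub] by (intro single_Rees) (auto simp: zero_ext_value_def[symmetric])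
  thus "1 \<in> Rees" by simp
  fix a b assume ab: "a \<in> Rees" "b \<in> Rees"
  show "a - b \<in> Rees"
    unfolding Rees_def
  proof (intro CollectI allI conjI)
    fix \<gamma>
    show "lookup (a - b) \<gamma> \<in> R'" using ReesD[OF ab(1)] ReesD[OF ab(2)] subrD[OF sub] by (simp add: lookup_minus)
    show "Fin \<gamma> \<le> \<omega> (lookup (a - b) \<gamma>)"
      using \<omega>_ge_add[of "Fin \<gamma>" "lookup a \<gamma>" "- lookup b \<gamma>"] ReesD[OF ab(1)] ReesD[OF ab(2)] by (simp add: lookup_minus)
  qed
  show "a * b \<in> Rees"
    unfolding Rees_def
  proof (intro CollectI allI conjI)
    fix \<gamma>
    show "lookup (a * b) \<gamma> \<in> R'"
      unfolding lookup_mult_group by (intro subr_sum[OF sub] subrD(4)[OF sub] ReesD ab)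
    have "Fin \<gamma> \<le> \<omega> (lookup a \<alpha> * lookup b (\<gamma> - \<alpha>))" for \<alpha>
      using add_mono[OF ReesD(2)[OF ab(1), of \<alpha>] ReesD(2)[OF ab(2), of "\<gamma> - \<alpha>"]] by (simp add: \<omega>_mult)
    thus "Fin \<gamma> \<le> \<omega> (lookup (a * b) \<gamma>)" unfolding lookup_mult_group by (intro \<omega>_ge_sum)
  qed
qed

lemma gr_carrier: "carrier (gr F w R) =
    {x \<in> \<Pi>\<^sub>E \<gamma>\<in>\<Gamma>. residue_coset \<gamma> ` {r \<in> R'. Fin \<gamma> \<le> \<omega> r}. finite {\<gamma> \<in> \<Gamma>. x \<gamma> \<noteq> residue_coset \<gamma> 0}}"
  unfolding gr_def using carrier_sum_group[of \<Gamma> "gr_piece F w R"] comm_group.axioms(2)[OF gr_piece_comm_group]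
  by (simp add: gr_piece_simps)

lemma gr_ops:
  "x \<oplus>\<^bsub>gr F w R\<^esub> y = (\<lambda>\<gamma>\<in>\<Gamma>. x \<gamma> \<otimes>\<^bsub>gr_piece F w R \<gamma>\<^esub> y \<gamma>)"
  "\<zero>\<^bsub>gr F w R\<^esub> = (\<lambda>\<gamma>\<in>\<Gamma>. residue_coset \<gamma> 0)"
  "x \<otimes>\<^bsub>gr F w R\<^esub> y = gr_mult F w R x y"
  "\<one>\<^bsub>gr F w R\<^esub> = initial_form F w R \<one>\<^bsub>F\<^esub>"
  by (simp_all add: gr_def gr_piece_simps)

lemma \<rho>_image: "\<rho> ` Rees = carrier (gr F w R)"
proof (rule antisym; rule subsetI)
  fix x assume "x \<in> \<rho> ` Rees"
  then obtain a where a: "a \<in> Rees" "x = \<rho> a" by blast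
  have "{\<gamma> \<in> \<Gamma>. \<rho> a \<gamma> \<noteq> residue_coset \<gamma> 0} \<subseteq> keys a" by (auto simp: \<rho>_def in_keys_iff)
  hence "finite {\<gamma> \<in> \<Gamma>. \<rho> a \<gamma> \<noteq> residue_coset \<gamma> 0}" by (rule finite_subset) simp
  thus "x \<in> carrier (gr F w R)" using a ReesD by (auto simp: gr_carrier \<rho>_def)
next
  fix x assume x: "x \<in> carrier (gr F w R)"
  let ?S = "{\<gamma> \<in> \<Gamma>. x \<gamma> \<noteq> residue_coset \<gamma> 0}"
  have fin: "finite ?S" and xP: "x \<in> (\<Pi>\<^sub>E \<gamma>\<in>\<Gamma>. residue_coset \<gamma> ` {r \<in> R'. Fin \<gamma> \<le> \<omega> r})" using x by (auto simp: gr_carrier)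
  have "\<forall>\<gamma>\<in>\<Gamma>. \<exists>r. r \<in> R' \<and> Fin \<gamma> \<le> \<omega> r \<and> x \<gamma> = residue_coset \<gamma> r" using xP by (auto simp: PiE_iff)
  then obtain r where r: "\<And>\<gamma>. \<gamma> \<in> \<Gamma> \<Longrightarrow> r \<gamma> \<in> R' \<and> Fin \<gamma> \<le> \<omega> (r \<gamma>) \<and> x \<gamma> = residue_coset \<gamma> (r \<gamma>)" by metis
  define a where "a = Abs_poly_mapping (\<lambda>\<gamma>. if \<gamma> \<in> ?S then r \<gamma> else 0)"
  have "finite {\<gamma>. (if \<gamma> \<in> ?S then r \<gamma> else 0) \<noteq> 0}" by (rule finite_subset[OF _ fin]) auto
  hence la: "lookup a \<gamma> = (if \<gamma> \<in> ?S then r \<gamma> else 0)" for \<gamma> by (simp add: a_def)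
  have "a \<in> Rees" using r subrD(2)[OF sub] by (auto simp: Rees_def la)
  moreover have "\<rho> a = x"
  proof
    fix \<gamma> show "\<rho> a \<gamma> = x \<gamma>"
      using r[of \<gamma>] xP by (cases "\<gamma> \<in> \<Gamma>") (auto simp: \<rho>_def la PiE_iff extensional_def)
  qed
  ultimately show "x \<in> \<rho> ` Rees" by blast
qed

lemma \<rho>_add: "a \<in> Rees \<Longrightarrow> b \<in> Rees \<Longrightarrow> \<rho> (a + b) = \<rho> a \<oplus>\<^bsub>gr F w R\<^esub> \<rho> b"
  by (auto simp: gr_ops \<rho>_def fun_eq_iff lookup_add gr_piece_simps ReesD)

lemma \<rho>_zero: "\<rho> 0 = \<zero>\<^bsub>gr F w R\<^esub>"
  by (simp add: gr_ops \<rho>_def)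

text \<open>
  Degrees outside the value group need no separate treatment: there \<open>w(a) \<ge> \<gamma>\<close> already means
  \<open>w(a) > \<gamma>\<close>.
\<close>

lemma \<rho>_eq_iff:
  assumes "a \<in> Rees" "b \<in> Rees"
  shows "\<rho> a = \<rho> b \<longleftrightarrow> (\<forall>\<gamma>. Fin \<gamma> < \<omega> (lookup a \<gamma> - lookup b \<gamma>))"
proof -
  have "\<rho> a = \<rho> b \<longleftrightarrow> (\<forall>\<gamma>\<in>\<Gamma>. Fin \<gamma> < \<omega> (lookup a \<gamma> - lookup b \<gamma>))"
    using assms by (auto simp: \<rho>_def fun_eq_iff residue_coset_cong ReesD restrict_def)
  moreover have "Fin \<gamma> < \<omega> (lookup a \<gamma> - lookup b \<gamma>)" if "\<gamma> \<notin> \<Gamma>" for \<gamma>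
  proof -
    have "a - b \<in> Rees" using assms subrD(3)[OF Rees_subr] by blast
    hence "Fin \<gamma> \<le> \<omega> (lookup a \<gamma> - lookup b \<gamma>)" using ReesD(2)[of "a - b" \<gamma>] by (simp add: lookup_minus)
    moreover have "\<omega> (lookup a \<gamma> - lookup b \<gamma>) \<noteq> Fin \<gamma>"
      using that unfolding value_group_def \<omega>_def by (metis (mono_tags, lifting) hom_simps(1) image_eqI mem_Collect_eq)
    ultimately show ?thesis by simp
  qed
  ultimately show ?thesis by blast
qed

lemma \<rho>_eq_zero_iff: "a \<in> Rees \<Longrightarrow> \<rho> a = \<zero>\<^bsub>gr F w R\<^esub> \<longleftrightarrow> (\<forall>\<gamma>. Fin \<gamma> < \<omega> (lookup a \<gamma>))"
  using \<rho>_eq_iff[of a 0] subrD(2)[OF Rees_subr] by (simp add: \<rho>_zero)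

text \<open>
  The product in the graded ring sums over the degrees at which the first factor is nonzero. The
  convolution in the group algebra has further terms, all of value above \<open>\<gamma>\<close>.
\<close>

lemma \<rho>_mult:
  assumes a: "a \<in> Rees" and b: "b \<in> Rees"
  shows "\<rho> (a * b) = \<rho> a \<otimes>\<^bsub>gr F w R\<^esub> \<rho> b"
proof
  fix \<gamma>
  show "\<rho> (a * b) \<gamma> = (\<rho> a \<otimes>\<^bsub>gr F w R\<^esub> \<rho> b) \<gamma>"
  proof (cases "\<gamma> \<in> \<Gamma>")
    case False
    thus ?thesis by (simp add: gr_ops gr_mult_def \<rho>_def)
  next
    case True
    let ?S = "{\<alpha> \<in> \<Gamma>. \<rho> a \<alpha> \<noteq> \<one>\<^bsub>gr_piece F w R \<alpha>\<^esub>}"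
    let ?t = "\<lambda>\<alpha>. lookup a \<alpha> * lookup b (\<gamma> - \<alpha>)"
    have S: "?S \<subseteq> keys a" by (auto simp: \<rho>_def in_keys_iff gr_piece_simps)
    have tR: "?t \<alpha> \<in> R'" for \<alpha> using ReesD(1)[OF a] ReesD(1)[OF b] subrD(4)[OF sub] by blast
    have tge: "Fin \<gamma> \<le> \<omega> (?t \<alpha>)" for \<alpha>
      using add_mono[OF ReesD(2)[OF a, of \<alpha>] ReesD(2)[OF b, of "\<gamma> - \<alpha>"]] by (simp add: \<omega>_mult)
    have fp: "finprod (gr_piece F w R \<gamma>) (\<lambda>\<alpha>. rcoset_mult F (P_gt w R \<gamma>) (\<rho> a \<alpha>) (\<rho> b (\<gamma> - \<alpha>))) ?S = residue_coset \<gamma> (sum ?t ?S)"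
    proof (rule finprod_residue_coset)
      show "finite ?S" using finite_subset[OF S] by simp
      fix \<alpha> assume \<alpha>: "\<alpha> \<in> ?S"
      show "?t \<alpha> \<in> R' \<and> Fin \<gamma> \<le> \<omega> (?t \<alpha>)" using tR tge by blast
      have "\<gamma> - \<alpha> \<in> \<Gamma>" using True \<alpha> value_group_diff by blast
      thus "rcoset_mult F (P_gt w R \<gamma>) (\<rho> a \<alpha>) (\<rho> b (\<gamma> - \<alpha>)) = residue_coset \<gamma> (?t \<alpha>)"
        using \<alpha> rcoset_mult_residue_coset[of "lookup a \<alpha>" "lookup b (\<gamma> - \<alpha>)" \<alpha> \<gamma>] ReesD[OF a] ReesD[OF b]
        by (simp add: \<rho>_def)
    qed
    have gt: "Fin \<gamma> < \<omega> (?t \<alpha>)" if "\<alpha> \<in> keys a - ?S" for \<alpha>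
    proof -
      have "Fin \<alpha> < \<omega> (lookup a \<alpha>)"
      proof (cases "\<alpha> \<in> \<Gamma>")
        case True
        thus ?thesis using that ReesD(1)[OF a] by (simp add: \<rho>_def gr_piece_simps residue_coset_0 residue_coset_eq_0_iff)
      next
        case False
        hence "\<omega> (lookup a \<alpha>) \<noteq> Fin \<alpha>"
          unfolding value_group_def \<omega>_def by (metis (mono_tags, lifting) hom_simps(1) image_eqI mem_Collect_eq)
        thus ?thesis using ReesD(2)[OF a, of \<alpha>] by simp
      qed
      hence "Fin \<alpha> + Fin (\<gamma> - \<alpha>) < \<omega> (lookup a \<alpha>) + \<omega> (lookup b (\<gamma> - \<alpha>))"
        using ReesD(2)[OF b] by (intro ext_add_less_le) auto
      thus ?thesis by (simp add: \<omega>_mult)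
    qed
    have "sum ?t (keys a) - sum ?t ?S = sum ?t (keys a - ?S)" using S by (simp add: sum_diff)
    hence "Fin \<gamma> < \<omega> (sum ?t (keys a) - sum ?t ?S)" using gt \<omega>_gt_sum[of "keys a - ?S" \<gamma> ?t] by simp
    hence "residue_coset \<gamma> (sum ?t (keys a)) = residue_coset \<gamma> (sum ?t ?S)" using tR by (simp add: residue_coset_cong subr_sum[OF sub])
    thus ?thesis using True fp by (simp add: gr_ops gr_mult_def \<rho>_def lookup_mult_group)
  qed
qed

lemma initial_form_eq:
  assumes "g \<in> R'" "\<omega> g = Fin \<mu>"
  shows "initial_form F w R (\<pi> g) = \<rho> (single \<mu> g)"
proof
  fix \<gamma>
  have w: "w (\<pi> g) = Fin \<mu>" using assms(2) by (simp add: \<omega>_def)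
  show "initial_form F w R (\<pi> g) \<gamma> = \<rho> (single \<mu> g) \<gamma>"
  proof (cases "\<gamma> = \<mu>")
    case True
    thus ?thesis by (simp add: initial_form_def \<rho>_def residue_coset_def w)
  next
    case False
    thus ?thesis by (simp add: initial_form_def \<rho>_def residue_coset_0 w lookup_single_not_eq)
  qed
qed

lemma \<rho>_one: "\<rho> 1 = \<one>\<^bsub>gr F w R\<^esub>"
  using initial_form_eq[of 1 0] subrD(1)[OF sub] by (simp add: gr_ops hom_one zero_ext_value_def[symmetric])

lemma \<rho>_hom: "\<rho> \<in> ring_hom (cring_class_ops \<lparr>carrier := Rees\<rparr>) (gr F w R)"
proof (rule ring_hom_memI)
qed (use \<rho>_image \<rho>_mult \<rho>_add \<rho>_one in \<open>auto simp: cring_class_ops_def\<close>)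

lemma gr_cring: "cring (gr F w R)"
  by (rule cring_of_surjection[OF subr_cring[OF Rees_subr] \<rho>_hom])
    (simp_all add: \<rho>_image \<rho>_zero cring_class_ops_def)

lemma \<rho>_homog_iff:
  "a \<in> Rees \<Longrightarrow> \<rho> a \<in> gr_homog F w R \<gamma> \<longleftrightarrow> (\<forall>\<delta>. \<delta> \<noteq> \<gamma> \<longrightarrow> Fin \<delta> < \<omega> (lookup a \<delta>))"
proof -
  assume a: "a \<in> Rees"
  have "Fin \<delta> < \<omega> (lookup a \<delta>)" if "\<delta> \<notin> \<Gamma>" for \<delta>
  proof -
    have "\<omega> (lookup a \<delta>) \<noteq> Fin \<delta>"
      using that unfolding value_group_def \<omega>_def by (metis (mono_tags, lifting) hom_simps(1) image_eqI mem_Collect_eq)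
    thus ?thesis using ReesD(2)[OF a, of \<delta>] by simp
  qed
  thus ?thesis using a \<rho>_image
    by (auto simp: gr_homog_def gr_piece_simps residue_coset_0 \<rho>_def residue_coset_eq_0_iff ReesD)
qed

lemma gr_homogE:
  assumes "x \<in> gr_homog F w R \<gamma>"
  obtains r where "r \<in> R'" "Fin \<gamma> \<le> \<omega> r" "x = \<rho> (single \<gamma> r)"
proof -
  have "x \<in> carrier (gr F w R)" using assms by (simp add: gr_homog_def)
  then obtain a where a: "a \<in> Rees" "x = \<rho> a" using \<rho>_image by auto
  have h: "Fin \<delta> < \<omega> (lookup a \<delta>)" if "\<delta> \<noteq> \<gamma>" for \<delta> using assms a \<rho>_homog_iff that by simp
  have s: "single \<gamma> (lookup a \<gamma>) \<in> Rees" using a ReesD by (intro single_Rees)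
  have "\<rho> a = \<rho> (single \<gamma> (lookup a \<gamma>))"
    unfolding \<rho>_eq_iff[OF a(1) s] using h by (auto simp: lookup_single when_def)
  thus ?thesis using that a ReesD by blast
qed

lemma single_homog: "r \<in> R' \<Longrightarrow> Fin \<gamma> \<le> \<omega> r \<Longrightarrow> \<rho> (single \<gamma> r) \<in> gr_homog F w R \<gamma>"
  using \<rho>_homog_iff[OF single_Rees] by (simp add: lookup_single when_def)

end

section \<open>Polynomial rings as images of monoid algebras\<close>

lemma finite_subset_mset: "finite {N. N \<subseteq># M}"
proof (induction M)
  case (add x M)
  have "{N. N \<subseteq># add_mset x M} \<subseteq> {N. N \<subseteq># M} \<union> add_mset x ` {N. N \<subseteq># M}"
  proof
    fix N assume "N \<in> {N. N \<subseteq># add_mset x M}"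
    hence N: "N \<subseteq># add_mset x M" by simp
    show "N \<in> {N. N \<subseteq># M} \<union> add_mset x ` {N. N \<subseteq># M}"
    proof (cases "x \<in># N")
      case True
      then obtain N' where N': "N = add_mset x N'" by (meson mset_add)
      hence "N' \<subseteq># M" using N by simp
      thus ?thesis using N' by blast
    next
      case False
      have "N \<subseteq># M"
      proof (rule mset_subset_eqI)
        fix a show "count N a \<le> count M a"
          using mset_subset_eq_count[OF N, of a] False by (cases "a = x") (auto simp: not_in_iff)
      qed
      thus ?thesis by simp
    qed
  qed
  thus ?case using add finite_subset by fastforce
qed simp

lemma lookup_mult_mset:
  fixes a b :: "'i multiset \<Rightarrow>\<^sub>0 'r::comm_ring_1"
  shows "lookup (a * b) M = (\<Sum>N\<in>{N. N \<subseteq># M}. lookup a N * lookup b (M - N))"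
proof -
  have "(\<Sum>q. lookup b q when M = l + q) = (if l \<subseteq># M then lookup b (M - l) else 0)" for l
  proof (cases "l \<subseteq># M")
    case True
    hence "(\<lambda>q. lookup b q when M = l + q) = (\<lambda>q. lookup b q when q = M - l)"
      by (auto simp: when_def fun_eq_iff subset_mset.add_diff_inverse)
    thus ?thesis using True by (simp only: Sum_any_when_equal if_True)
  next
    case False
    hence "(\<lambda>q. lookup b q when M = l + q) = (\<lambda>q. 0)"
      by (auto simp: when_def fun_eq_iff)
    hence "(\<Sum>q. lookup b q when M = l + q) = (\<Sum>q::'i multiset. 0)" by (rule arg_cong)
    thus ?thesis using False by simp
  qed
  hence "lookup (a * b) M =
      (\<Sum>l. lookup a l * (if l \<subseteq># M then lookup b (M - l) else 0))"
    by (simp add: lookup_mult)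
  also have "\<dots> = (\<Sum>N\<in>{N. N \<subseteq># M}. lookup a N * (if N \<subseteq># M then lookup b (M - N) else 0))"
    by (rule Sum_any.expand_superset[OF finite_subset_mset]) auto
  finally show ?thesis by simp
qed

lemma poly_mapping_sum_single: "p = (\<Sum>M\<in>keys p. single M (lookup p M))"
proof (rule poly_mapping_eqI)
  fix k
  show "lookup p k = lookup (\<Sum>M\<in>keys p. single M (lookup p M)) k"
    by (simp add: lookup_sum lookup_single when_def sum.delta in_keys_iff)
qed

text \<open>
  A surjection \<open>h\<close> from a subring \<open>Q\<close> of a type-class ring onto \<open>S\<close> extends coefficientwise to a surjection from a
  subring of a monoid algebra onto a polynomial ring over \<open>S\<close>.
\<close>

locale mpoly_rep =
  fixes S :: "('a, 'm) ring_scheme" and h :: "'r::comm_ring_1 \<Rightarrow> 'a" and Q :: "'r set" and I :: "'i set"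
  assumes S: "cring S" and Q: "subr Q" and h_hom: "h \<in> ring_hom (cring_class_ops \<lparr>carrier := Q\<rparr>) S"
    and h_onto: "h ` Q = carrier S" and h_zero: "h 0 = \<zero>\<^bsub>S\<^esub>"
begin

interpretation S: cring S by (rule S)

lemma h_simps:
  "a \<in> Q \<Longrightarrow> h a \<in> carrier S" "a \<in> Q \<Longrightarrow> b \<in> Q \<Longrightarrow> h (a + b) = h a \<oplus>\<^bsub>S\<^esub> h b"
  "a \<in> Q \<Longrightarrow> b \<in> Q \<Longrightarrow> h (a * b) = h a \<otimes>\<^bsub>S\<^esub> h b" "h 1 = \<one>\<^bsub>S\<^esub>"
  using ring_hom_closed[OF h_hom, of a] ring_hom_add[OF h_hom, of a b] ring_hom_mult[OF h_hom, of a b] ring_hom_one[OF h_hom]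
  by (simp_all add: cring_class_ops_def)

lemma h_sum: "finite X \<Longrightarrow> (\<And>i. i \<in> X \<Longrightarrow> t i \<in> Q) \<Longrightarrow> h (sum t X) = (\<Oplus>\<^bsub>S\<^esub>i\<in>X. h (t i))"
proof (induction X rule: finite_induct)
  case (insert i X)
  hence "sum t X \<in> Q" by (intro subr_sum[OF Q]) auto
  thus ?case using insert by (simp add: h_simps)
qed (simp add: h_zero)

definition lifts :: "('i multiset \<Rightarrow>\<^sub>0 'r) set" where
  "lifts = {p. \<forall>M. lookup p M \<in> Q \<and> (lookup p M \<noteq> 0 \<longrightarrow> set_mset M \<subseteq> I)}"

definition H :: "('i multiset \<Rightarrow>\<^sub>0 'r) \<Rightarrow> 'i multiset \<Rightarrow> 'a" where
  "H p = (\<lambda>M. h (lookup p M))"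

lemma liftsD: "p \<in> lifts \<Longrightarrow> lookup p M \<in> Q"
  "p \<in> lifts \<Longrightarrow> lookup p M \<noteq> 0 \<Longrightarrow> set_mset M \<subseteq> I"
  by (auto simp: lifts_def)

lemma single_lifts: "c \<in> Q \<Longrightarrow> set_mset M \<subseteq> I \<Longrightarrow> single M c \<in> lifts"
  using subrD(2)[OF Q] by (auto simp: lifts_def lookup_single when_def)

lemma lifts_subr: "subr lifts"
  unfolding subr_def
proof (intro conjI ballI)
  have "single {#} 1 \<in> lifts" using subrD(1)[OF Q] by (intro single_lifts) auto
  thus "1 \<in> lifts" by (simp flip: single_one)
  fix p q assume p: "p \<in> lifts" and q: "q \<in> lifts"
  show "p - q \<in> lifts"
    unfolding lifts_def
  proof (intro CollectI allI conjI impI)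
    fix M
    show "lookup (p - q) M \<in> Q"
      unfolding lookup_minus by (intro subrD(3)[OF Q] liftsD p q)
    assume "lookup (p - q) M \<noteq> 0"
    hence "lookup p M \<noteq> 0 \<or> lookup q M \<noteq> 0" by (auto simp: lookup_minus)
    thus "set_mset M \<subseteq> I" using liftsD p q by blast
  qed
  show "p * q \<in> lifts"
    unfolding lifts_def
  proof (intro CollectI allI conjI impI)
    fix M
    show "lookup (p * q) M \<in> Q"
      unfolding lookup_mult_mset by (intro subr_sum[OF Q] subrD(4)[OF Q] liftsD p q)
    assume "lookup (p * q) M \<noteq> 0"
    then obtain N where N: "N \<subseteq># M" "lookup p N * lookup q (M - N) \<noteq> 0"
      unfolding lookup_mult_mset by (auto dest: sum.not_neutral_contains_not_neutral)
    hence "lookup p N \<noteq> 0" "lookup q (M - N) \<noteq> 0"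
      by (metis mult_zero_left, metis mult_zero_right)
    hence "set_mset N \<subseteq> I" "set_mset (M - N) \<subseteq> I"
      using liftsD(2)[OF p, of N] liftsD(2)[OF q, of "M - N"] by auto
    moreover have "M = N + (M - N)" using N(1) by simp
    ultimately show "set_mset M \<subseteq> I" by (metis set_mset_union Un_subset_iff)
  qed
qed

lemma mpoly_ring_simps:
  "p \<otimes>\<^bsub>mpoly_ring S I\<^esub> q = (\<lambda>M. \<Oplus>\<^bsub>S\<^esub>N\<in>{N. N \<subseteq># M}. p N \<otimes>\<^bsub>S\<^esub> q (M - N))"
  "\<one>\<^bsub>mpoly_ring S I\<^esub> = mpoly_const S \<one>\<^bsub>S\<^esub>" "\<zero>\<^bsub>mpoly_ring S I\<^esub> = (\<lambda>M. \<zero>\<^bsub>S\<^esub>)"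
  "p \<oplus>\<^bsub>mpoly_ring S I\<^esub> q = (\<lambda>M. p M \<oplus>\<^bsub>S\<^esub> q M)"
  by (simp_all add: mpoly_ring_def)

lemma H_image: "H ` lifts = carrier (mpoly_ring S I)"
proof (rule antisym; rule subsetI)
  fix x assume "x \<in> H ` lifts"
  then obtain p where p: "p \<in> lifts" "x = H p" by blast
  have "{M. x M \<noteq> \<zero>\<^bsub>S\<^esub>} \<subseteq> keys p" using p(2) h_zero by (auto simp: H_def in_keys_iff)
  hence "finite {M. x M \<noteq> \<zero>\<^bsub>S\<^esub>}" by (rule finite_subset) simp
  moreover have "x M \<in> carrier S" for M using p liftsD(1) h_simps(1) by (auto simp: H_def)
  moreover have "set_mset M \<subseteq> I" if "x M \<noteq> \<zero>\<^bsub>S\<^esub>" for M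
  proof -
    have "lookup p M \<noteq> 0" using that p h_zero by (auto simp: H_def)
    thus ?thesis by (rule liftsD(2)[OF p(1)])
  qed
  ultimately show "x \<in> carrier (mpoly_ring S I)" by (simp add: mpoly_ring_def)
next
  fix x assume "x \<in> carrier (mpoly_ring S I)"
  hence x: "\<And>M. x M \<in> carrier S" "finite {M. x M \<noteq> \<zero>\<^bsub>S\<^esub>}" "\<And>M. x M \<noteq> \<zero>\<^bsub>S\<^esub> \<Longrightarrow> set_mset M \<subseteq> I"
    by (auto simp: mpoly_ring_def)
  have "\<forall>M. \<exists>r\<in>Q. h r = x M" using x(1) h_onto by (metis imageE)
  then obtain r where r: "\<And>M. r M \<in> Q" "\<And>M. h (r M) = x M" by metis
  define p where "p = Abs_poly_mapping (\<lambda>M. if x M \<noteq> \<zero>\<^bsub>S\<^esub> then r M else 0)"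
  have "finite {M. (if x M \<noteq> \<zero>\<^bsub>S\<^esub> then r M else 0) \<noteq> 0}" by (rule finite_subset[OF _ x(2)]) auto
  hence lp: "lookup p M = (if x M \<noteq> \<zero>\<^bsub>S\<^esub> then r M else 0)" for M by (simp add: p_def)
  have "p \<in> lifts" using r x(3) subrD(2)[OF Q] by (auto simp: lifts_def lp)
  moreover have "H p = x" using r h_zero by (auto simp: H_def lp fun_eq_iff)
  ultimately show "x \<in> H ` lifts" by blast
qed

lemma H_zero: "H 0 = \<zero>\<^bsub>mpoly_ring S I\<^esub>"
  by (simp add: H_def mpoly_ring_simps h_zero)

lemma H_const: "H (single {#} c) = mpoly_const S (h c)"
  by (auto simp: H_def mpoly_const_def lookup_single when_def h_zero)

lemma H_var: "H (single {#i#} 1) = mpoly_var S i"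
  by (auto simp: H_def mpoly_var_def lookup_single when_def h_zero h_simps)

lemma H_hom: "H \<in> ring_hom (cring_class_ops \<lparr>carrier := lifts\<rparr>) (mpoly_ring S I)"
proof (rule ring_hom_memI)
  fix p q assume "p \<in> carrier (cring_class_ops \<lparr>carrier := lifts\<rparr>)" "q \<in> carrier (cring_class_ops \<lparr>carrier := lifts\<rparr>)"
  hence p: "p \<in> lifts" and q: "q \<in> lifts" by simp_all
  show "H p \<in> carrier (mpoly_ring S I)" using p H_image by blast
  have "H (p * q) = H p \<otimes>\<^bsub>mpoly_ring S I\<^esub> H q"
  proof
    fix M
    have "h (\<Sum>N\<in>{N. N \<subseteq># M}. lookup p N * lookup q (M - N)) =
        (\<Oplus>\<^bsub>S\<^esub>N\<in>{N. N \<subseteq># M}. h (lookup p N * lookup q (M - N)))"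
      by (intro h_sum finite_subset_mset subrD(4)[OF Q] liftsD p q)
    also have "\<dots> = (\<Oplus>\<^bsub>S\<^esub>N\<in>{N. N \<subseteq># M}. h (lookup p N) \<otimes>\<^bsub>S\<^esub> h (lookup q (M - N)))"
      using p q by (intro S.finsum_cong') (auto simp: h_simps liftsD)
    finally show "H (p * q) M = (H p \<otimes>\<^bsub>mpoly_ring S I\<^esub> H q) M"
      by (simp add: H_def mpoly_ring_simps lookup_mult_mset)
  qed
  thus "H (p \<otimes>\<^bsub>cring_class_ops \<lparr>carrier := lifts\<rparr>\<^esub> q) = H p \<otimes>\<^bsub>mpoly_ring S I\<^esub> H q" by (simp add: cring_class_ops_def)
  show "H (p \<oplus>\<^bsub>cring_class_ops \<lparr>carrier := lifts\<rparr>\<^esub> q) = H p \<oplus>\<^bsub>mpoly_ring S I\<^esub> H q"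
    using p q by (simp add: cring_class_ops_def H_def mpoly_ring_simps lookup_add h_simps liftsD)
next
  show "H \<one>\<^bsub>cring_class_ops \<lparr>carrier := lifts\<rparr>\<^esub> = \<one>\<^bsub>mpoly_ring S I\<^esub>"
    using H_const[of 1] by (simp add: cring_class_ops_def mpoly_ring_simps h_simps)
qed

lemma lifts_cring: "cring (cring_class_ops \<lparr>carrier := lifts\<rparr>)"
  by (rule subr_cring[OF lifts_subr])

lemma mpoly_cring: "cring (mpoly_ring S I)"
  by (rule cring_of_surjection[OF lifts_cring H_hom]) (simp_all add: H_image H_zero cring_class_ops_def)

lemma H_simps:
  "p \<in> lifts \<Longrightarrow> H p \<in> carrier (mpoly_ring S I)"
  "p \<in> lifts \<Longrightarrow> q \<in> lifts \<Longrightarrow> H (p + q) = H p \<oplus>\<^bsub>mpoly_ring S I\<^esub> H q"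
  "p \<in> lifts \<Longrightarrow> q \<in> lifts \<Longrightarrow> H (p * q) = H p \<otimes>\<^bsub>mpoly_ring S I\<^esub> H q"
  "H 1 = \<one>\<^bsub>mpoly_ring S I\<^esub>"
  using ring_hom_closed[OF H_hom, of p] ring_hom_add[OF H_hom, of p q] ring_hom_mult[OF H_hom, of p q] ring_hom_one[OF H_hom]
  by (simp_all add: cring_class_ops_def)

lemma H_power: "p \<in> lifts \<Longrightarrow> H (p ^ k) = H p [^]\<^bsub>mpoly_ring S I\<^esub> k"
proof (induction k)
  case 0
  interpret P: cring "mpoly_ring S I" by (rule mpoly_cring)
  show ?case by (simp add: H_simps)
next
  case (Suc k)
  interpret P: cring "mpoly_ring S I" by (rule mpoly_cring)
  show ?case using Suc subrD(7)[OF lifts_subr] by (simp add: H_simps P.m_comm P.nat_pow_closed)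
qed

lemma H_sum: "finite X \<Longrightarrow> (\<And>i. i \<in> X \<Longrightarrow> t i \<in> lifts) \<Longrightarrow> H (sum t X) = finsum (mpoly_ring S I) (\<lambda>i. H (t i)) X"
proof (induction X rule: finite_induct)
  case empty
  interpret P: cring "mpoly_ring S I" by (rule mpoly_cring)
  show ?case by (simp add: H_zero)
next
  case (insert i X)
  interpret P: cring "mpoly_ring S I" by (rule mpoly_cring)
  have "sum t X \<in> lifts" using insert.prems by (intro subr_sum[OF lifts_subr]) auto
  thus ?case using insert by (simp add: H_simps)
qed

lemma H_prod: "finite X \<Longrightarrow> (\<And>i. i \<in> X \<Longrightarrow> t i \<in> lifts) \<Longrightarrow>
    H (prod t X) = finprod (mpoly_ring S I) (\<lambda>i. H (t i)) X \<and> prod t X \<in> lifts"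
proof (induction X rule: finite_induct)
  case empty
  interpret P: cring "mpoly_ring S I" by (rule mpoly_cring)
  show ?case by (simp add: H_simps subrD(1)[OF lifts_subr])
next
  case (insert i X)
  interpret P: cring "mpoly_ring S I" by (rule mpoly_cring)
  show ?case using insert subrD(4)[OF lifts_subr] by (simp add: H_simps)
qed

end

section \<open>Evaluation\<close>

locale evaluation =
  fixes l :: "'r::comm_ring_1 \<Rightarrow> 's::comm_ring_1" and X :: "'i \<Rightarrow> 's"
  assumes l_add: "l (a + b) = l a + l b" and l_mult: "l (a * b) = l a * l b" and l_one: "l 1 = 1"
begin

lemma l_zero [simp]: "l 0 = 0"
  using l_add[of 0 0] by simp

definition E :: "('i multiset \<Rightarrow>\<^sub>0 'r) \<Rightarrow> 's" where
  "E p = (\<Sum>M\<in>keys p. l (lookup p M) * prod_mset (image_mset X M))"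

lemma E_superset:
  "finite Y \<Longrightarrow> keys p \<subseteq> Y \<Longrightarrow>
    E p = (\<Sum>M\<in>Y. l (lookup p M) * prod_mset (image_mset X M))"
  unfolding E_def by (rule sum.mono_neutral_left) (auto simp: in_keys_iff)

lemma E_zero [simp]: "E 0 = 0" by (simp add: E_def)

lemma E_single: "E (single M c) = l c * prod_mset (image_mset X M)"
  by (cases "c = 0") (simp_all add: E_def)

lemma E_add: "E (p + q) = E p + E q"
proof -
  let ?Y = "keys p \<union> keys q"
  have "E (p + q) = (\<Sum>M\<in>?Y. l (lookup (p + q) M) * prod_mset (image_mset X M))"
    by (rule E_superset[OF _ keys_add]) simp
  also have "\<dots> = E p + E q"
    by (simp add: E_superset[of ?Y p] E_superset[of ?Y q] lookup_add l_add distrib_right sum.distrib)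
  finally show ?thesis .
qed

lemma E_sum: "E (sum t I) = (\<Sum>i\<in>I. E (t i))"
  by (induction I rule: infinite_finite_induct) (simp_all add: E_add)

lemma E_mult: "E (p * q) = E p * E q"
proof -
  have "p * q = (\<Sum>M\<in>keys p. \<Sum>N\<in>keys q.
      single (M + N) (lookup p M * lookup q N))"
    by (subst (1) poly_mapping_sum_single[of p], subst (1) poly_mapping_sum_single[of q])
      (simp add: sum_product mult_single)
  hence "E (p * q) = (\<Sum>M\<in>keys p. \<Sum>N\<in>keys q.
      l (lookup p M * lookup q N) * prod_mset (image_mset X (M + N)))"
    by (simp add: E_sum E_single)
  also have "\<dots> = E p * E q" by (simp add: E_def sum_product l_mult ac_simps)
  finally show ?thesis .
qed

lemma E_one: "E 1 = 1"
  using E_single[of "{#}" 1] by (simp add: l_one)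

end

section \<open>Induced homomorphisms\<close>

text \<open>
  A homomorphism that kills the kernel of a surjection \<open>H\<close> factors through \<open>H\<close>; the factor is evaluated on
  arbitrarily chosen preimages.
\<close>

lemma induced_hom:
  assumes R: "cring R" and P: "ring P" and T: "ring T"
    and H: "H \<in> ring_hom R P" "H ` carrier R = carrier P"
    and h: "h \<in> ring_hom R T"
    and ker: "\<And>x. x \<in> carrier R \<Longrightarrow> H x = \<zero>\<^bsub>P\<^esub> \<Longrightarrow> h x = \<zero>\<^bsub>T\<^esub>"
  obtains \<Phi> where "\<Phi> \<in> ring_hom P T" "\<And>x. x \<in> carrier R \<Longrightarrow> \<Phi> (H x) = h x"
proof -
  interpret R: cring R by (rule R)
  interpret P: ring P by (rule P)
  interpret T: ring T by (rule T)
  interpret H: ring_hom_ring R P H by (rule ring_hom_ringI2) (use H R.ring_axioms P in auto)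
  interpret h: ring_hom_ring R T h by (rule ring_hom_ringI2) (use h R.ring_axioms T in auto)
  define \<Phi> where "\<Phi> x = h (SOME p. p \<in> carrier R \<and> H p = x)" for x
  have \<Phi>: "\<Phi> (H x) = h x" if x: "x \<in> carrier R" for x
  proof -
    define y where "y = (SOME p. p \<in> carrier R \<and> H p = H x)"
    have "y \<in> carrier R \<and> H y = H x" unfolding y_def by (rule someI[of _ x]) (use x in simp)
    hence y: "y \<in> carrier R" "H y = H x" by auto
    have "H (y \<ominus>\<^bsub>R\<^esub> x) = \<zero>\<^bsub>P\<^esub>" using x y by (simp add: R.minus_eq P.r_neg)
    hence "h (y \<ominus>\<^bsub>R\<^esub> x) = \<zero>\<^bsub>T\<^esub>" using x y by (intro ker) auto
    hence "h y \<ominus>\<^bsub>T\<^esub> h x = \<zero>\<^bsub>T\<^esub>" using x y by (simp add: R.minus_eq T.minus_eq)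
    hence "h y = h x" using x y by (metis T.r_right_minus_eq h.hom_closed)
    thus ?thesis by (simp add: \<Phi>_def y_def)
  qed
  have "\<Phi> \<in> ring_hom P T"
  proof (rule ring_hom_memI)
    fix x y assume "x \<in> carrier P" "y \<in> carrier P"
    then obtain a b where ab: "a \<in> carrier R" "b \<in> carrier R" "x = H a" "y = H b" using H(2) by blast
    show "\<Phi> x \<in> carrier T" using ab by (simp add: \<Phi>)
    show "\<Phi> (x \<otimes>\<^bsub>P\<^esub> y) = \<Phi> x \<otimes>\<^bsub>T\<^esub> \<Phi> y" using ab \<Phi>[of "a \<otimes>\<^bsub>R\<^esub> b"] by (simp add: \<Phi>)
    show "\<Phi> (x \<oplus>\<^bsub>P\<^esub> y) = \<Phi> x \<oplus>\<^bsub>T\<^esub> \<Phi> y" using ab \<Phi>[of "a \<oplus>\<^bsub>R\<^esub> b"] by (simp add: \<Phi>)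
  next
    show "\<Phi> \<one>\<^bsub>P\<^esub> = \<one>\<^bsub>T\<^esub>" using \<Phi>[of "\<one>\<^bsub>R\<^esub>"] by simp
  qed
  thus ?thesis using that \<Phi> by blast
qed

section \<open>The basis of key monomials\<close>

lemma (in tame_val) div_mod_over:
  assumes \<phi>: "\<phi> \<in> polys_over A" "lead_coeff \<phi> = 1"
  shows "g \<in> polys_over A \<Longrightarrow> g mod \<phi> \<in> polys_over A \<and> g div \<phi> \<in> polys_over A"
proof (induction "degree g" arbitrary: g rule: less_induct)
  case less
  have \<phi>0: "\<phi> \<noteq> 0" using \<phi>(2) by auto
  show ?case
  proof (cases "degree g < degree \<phi> \<or> g = 0")
    case True
    thus ?thesis using less.prems over_closed(1) by (auto simp: mod_poly_less div_poly_less)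
  next
    case False
    define t where "t = Polynomial.monom (lead_coeff g) (degree g - degree \<phi>)"
    define h where "h = g - t * \<phi>"
    have tA: "t \<in> polys_over A" using less.prems unfolding t_def by (intro over_closed(6)) (simp add: polys_over_def)
    have hA: "h \<in> polys_over A" unfolding h_def using less.prems tA \<phi>(1) by (intro over_closed)
    have lg: "lead_coeff g \<noteq> 0" using False by simp
    have lt: "lead_coeff (t * \<phi>) = lead_coeff g"
      unfolding lead_coeff_mult \<phi>(2) t_def lead_coeff_monom by simp
    have t0: "t \<noteq> 0" using False by (simp add: t_def)
    have "degree (t * \<phi>) = degree g"
      using False lg \<phi>0 t0 by (simp add: degree_mult_eq) (simp add: t_def degree_monom_eq)
    note dt = this lt
    have eq: "g div \<phi> = t + h div \<phi>" "g mod \<phi> = h mod \<phi>"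
    proof -
      have "g = h + t * \<phi>" by (simp add: h_def)
      thus "g div \<phi> = t + h div \<phi>" "g mod \<phi> = h mod \<phi>" using \<phi>0 by (simp_all add: poly_div_add_left poly_mod_add_left)
    qed
    have "h mod \<phi> \<in> polys_over A \<and> h div \<phi> \<in> polys_over A"
    proof (cases "degree g = 0")
      case True
      hence "degree \<phi> = 0" using False by simp
      hence "\<phi> = 1" using \<phi>(2) by (metis degree_0_id lead_coeff_pCons(1) degree_eq_zeroE degree_pCons_0 coeff_pCons_0 one_pCons)
      thus ?thesis using hA over_closed(1) by simp
    next
      case pos: False
      have "poly.coeff h i = 0" if "i \<ge> degree g" for i
      proof (cases "i = degree g")
        case True
        thus ?thesis using dt by (simp add: h_def)
      next
        case False
        thus ?thesis using that dt(1) by (simp add: h_def coeff_eq_0)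
      qed
      hence "degree h \<le> degree g - 1" by (intro degree_le) auto
      thus ?thesis using less.hyps[of h] pos hA by simp
    qed
    thus ?thesis using eq tA over_closed(3) by auto
  qed
qed

locale key_chain = tame_val f u v0 A
  for f :: "'k::field poly" and u :: "'k poly \<Rightarrow> 'g::linordered_ab_group_add ext_value" and v0 A +
  fixes n :: nat and \<phi> :: "nat \<Rightarrow> 'k poly"
  assumes n_pos: "1 \<le> n" and \<phi>_1: "\<phi> 1 = [:0, 1:]" and \<phi>_n: "\<phi> n = f"
    and \<phi>_abstract_key: "k \<in> {1..n} \<Longrightarrow> abstract_key (\<phi> k)" and \<phi>_over: "k \<in> {1..n} \<Longrightarrow> \<phi> k \<in> polys_over A"
    and \<phi>_finite: "k \<in> {1..<n} \<Longrightarrow> u (\<phi> k) \<noteq> Infty" and \<phi>_jump: "k \<in> {1..<n} \<Longrightarrow> jump (\<phi> k) (\<phi> (Suc k))"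
begin

definition "m i = degree (\<phi> (Suc i)) div degree (\<phi> i)"

lemma \<phi>_props:
  assumes "k \<in> {1..n}"
  shows "lead_coeff (\<phi> k) = 1" "0 < degree (\<phi> k)" "\<phi> k \<noteq> 0"
  using abstract_keyD[OF \<phi>_abstract_key[OF assms]] by auto

lemma \<phi>_dvd: "k \<in> {1..<n} \<Longrightarrow> degree (\<phi> k) dvd degree (\<phi> (Suc k))"
  using jump_degree_dvd[of "\<phi> k" "\<phi> (Suc k)"] \<phi>_abstract_key \<phi>_finite \<phi>_jump by simp

lemma m_degree: "k \<in> {1..<n} \<Longrightarrow> m k * degree (\<phi> k) = degree (\<phi> (Suc k))"
  using \<phi>_dvd by (simp add: m_def)

lemma m_pos: "k \<in> {1..<n} \<Longrightarrow> 0 < m k"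
  using m_degree[of k] \<phi>_props(2)[of "Suc k"] by (cases "m k") auto

lemma trunc_\<phi>: "k \<in> {1..<n} \<Longrightarrow> degree g < degree (\<phi> (Suc k)) \<Longrightarrow> trunc (\<phi> k) g = u g"
  using jump_simps(4)[of "\<phi> k" "\<phi> (Suc k)"] \<phi>_abstract_key \<phi>_finite \<phi>_jump by simp

text \<open>
  Monomials in \<open>\<phi>\<^sub>1, \<dots>, \<phi>\<^sub>k\<^sub>-\<^sub>1\<close> with exponents below \<open>m\<^sub>l\<close>. Monomials are multisets of indices, as in
  the polynomial rings over the graded ring.
\<close>

definition box :: "nat \<Rightarrow> nat multiset set" where
  "box k = {M. set_mset M \<subseteq> {1..<k} \<and> (\<forall>l\<in>{1..<k}. count M l < m l)}"

definition key_monomial :: "nat multiset \<Rightarrow> 'k poly" where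
  "key_monomial M = prod_mset (image_mset \<phi> M)"

lemma key_monomial_simps [simp]: "key_monomial {#} = 1" "key_monomial (add_mset i M) = \<phi> i * key_monomial M" "key_monomial (M + N) = key_monomial M * key_monomial N"
  "key_monomial (replicate_mset j i) = \<phi> i ^ j"
  by (simp_all add: key_monomial_def)

lemma box_1: "box 1 = {{#}}" by (auto simp: box_def)

lemma box_Suc: "1 \<le> k \<Longrightarrow> box (Suc k) = (\<lambda>(j, M). M + replicate_mset j k) ` ({..<m k} \<times> box k)"
proof (rule antisym; rule subsetI)
  fix M assume k: "1 \<le> k" and M: "M \<in> box (Suc k)"
  let ?N = "filter_mset (\<lambda>l. l \<noteq> k) M"
  have "M = ?N + replicate_mset (count M k) k" by (rule multiset_eqI) simp
  moreover have "?N \<in> box k" using M by (auto simp: box_def)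
  moreover have "count M k < m k" using M k by (simp add: box_def)
  ultimately show "M \<in> (\<lambda>(j, M). M + replicate_mset j k) ` ({..<m k} \<times> box k)" by force
next
  fix M assume k: "1 \<le> k" and "M \<in> (\<lambda>(j, M). M + replicate_mset j k) ` ({..<m k} \<times> box k)"
  then obtain j N where N: "j < m k" "N \<in> box k" "M = N + replicate_mset j k" by auto
  have "count N k = 0" using N(2) by (auto simp: box_def count_eq_zero_iff)
  thus "M \<in> box (Suc k)" using N k by (auto simp: box_def less_Suc_eq split: if_splits)
qed

lemma box_Suc_inj: "inj_on (\<lambda>(j, M). M + replicate_mset j k) ({..<m k} \<times> box k)"
proof (rule inj_onI, clarify)
  fix j M j' M' assume M: "M \<in> box k" "M' \<in> box k" and eq: "M + replicate_mset j k = M' + replicate_mset j' k"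
  have "count M k = 0" "count M' k = 0" using M by (auto simp: box_def count_eq_zero_iff)
  hence "j = j'" using arg_cong[OF eq, of "\<lambda>X. count X k"] by simp
  thus "j = j' \<and> M = M'" using eq by simp
qed

lemma box_finite: "1 \<le> k \<Longrightarrow> finite (box k)"
proof (induction k rule: dec_induct)
  case base
  show ?case using box_1 by simp
next
  case (step k)
  thus ?case by (simp add: box_Suc)
qed

lemma sum_box_Suc:
  assumes "1 \<le> k"
  shows "(\<Sum>M\<in>box (Suc k). F M) = (\<Sum>j<m k. \<Sum>M\<in>box k. F (M + replicate_mset j k))"
  unfolding box_Suc[OF assms] sum.reindex[OF box_Suc_inj] sum.cartesian_product
  by (intro sum.cong) auto

lemma box_degree: "1 \<le> k \<Longrightarrow> k \<le> n \<Longrightarrow> M \<in> box k \<Longrightarrow> degree (key_monomial M) < degree (\<phi> k)"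
proof (induction k arbitrary: M rule: dec_induct)
  case base
  thus ?case using box_1 \<phi>_1 by simp
next
  case (step k)
  then obtain j N where N: "j < m k" "N \<in> box k" "M = N + replicate_mset j k" by (auto simp: box_Suc)
  have IH: "degree (key_monomial N) < degree (\<phi> k)" using step N by simp
  have "degree (key_monomial M) \<le> degree (key_monomial N) + j * degree (\<phi> k)"
    using degree_mult_le[of "key_monomial N" "\<phi> k ^ j"] degree_power_le[of "\<phi> k" j] N(3) by (simp add: mult.commute)
  also have "\<dots> < Suc j * degree (\<phi> k)" using IH by simp
  also have "\<dots> \<le> m k * degree (\<phi> k)" using N(1) by (intro mult_le_mono1) simp
  also have "\<dots> = degree (\<phi> (Suc k))" using step by (intro m_degree) simp
  finally show ?case .
qed

definition box_sum :: "nat \<Rightarrow> (nat multiset \<Rightarrow> 'k) \<Rightarrow> 'k poly" where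
  "box_sum k a = (\<Sum>M\<in>box k. [:a M:] * key_monomial M)"

lemma box_sum_degree:
  assumes "1 \<le> k" "k \<le> n"
  shows "degree (box_sum k a) < degree (\<phi> k)"
proof -
  have "degree (box_sum k a) \<le> degree (\<phi> k) - 1"
    unfolding box_sum_def
  proof (rule degree_sum_le[OF box_finite[OF assms(1)]])
    fix M assume "M \<in> box k"
    from box_degree[OF assms this] show "degree ([:a M:] * key_monomial M) \<le> degree (\<phi> k) - 1"
      using degree_mult_le[of "[:a M:]" "key_monomial M"] by simp
  qed
  thus ?thesis using \<phi>_props(2)[of k] assms by simp
qed

lemma box_sum_Suc: "1 \<le> k \<Longrightarrow> box_sum (Suc k) a = (\<Sum>j<m k. box_sum k (\<lambda>M. a (M + replicate_mset j k)) * \<phi> k ^ j)"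
  by (simp add: box_sum_def sum_box_Suc sum_distrib_right mult.assoc del: mult_pCons_left)

text \<open>
  The basis monomials are valuation independent. Grouped by the exponent of \<open>\<phi>\<^sub>k\<close>, a combination is an
  expansion in powers of \<open>\<phi>\<^sub>k\<close>, and its degree is small enough for \<open>u\<close> to be the least value of the
  terms.
\<close>

lemma box_sum_value:
  "1 \<le> k \<Longrightarrow> k \<le> n \<Longrightarrow> M \<in> box k \<Longrightarrow> u (box_sum k a) \<le> u ([:a M:] * key_monomial M)"
proof (induction k arbitrary: M a rule: dec_induct)
  case base
  thus ?case by (simp add: box_sum_def box_1[simplified])
next
  case (step k)
  have k: "k \<in> {1..<n}" "k \<in> {1..n}" using step by auto
  obtain j N where N: "j < m k" "N \<in> box k" "M = N + replicate_mset j k" using step by (auto simp: box_Suc)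
  define g where "g j = box_sum k (\<lambda>M. a (M + replicate_mset j k))" for j
  have dg: "degree (g j) < degree (\<phi> k)" for j
    unfolding g_def using k by (intro box_sum_degree) auto
  have "u (box_sum (Suc k) a) = trunc (\<phi> k) (box_sum (Suc k) a)"
    using step.prems by (intro trunc_\<phi>[OF k(1), symmetric] box_sum_degree) auto
  also have "\<dots> \<le> u (exp_term (\<phi> k) (box_sum (Suc k) a) j)" by (rule trunc_le)
  also have "exp_term (\<phi> k) (box_sum (Suc k) a) j = g j * \<phi> k ^ j"
    using \<phi>_props(2)[OF k(2)] dg N(1) step.hyps
    by (simp add: box_sum_Suc exp_term_sum exp_term_monomial g_def[symmetric])
  also have "u (g j * \<phi> k ^ j) = u (g j) + u (\<phi> k ^ j)" by (rule u_mult)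
  also have "\<dots> \<le> u ([:a M:] * key_monomial N) + u (\<phi> k ^ j)"
    using step.IH[of N "\<lambda>M. a (M + replicate_mset j k)"] N step.prems by (intro add_right_mono) (simp add: g_def)
  also have "\<dots> = u ([:a M:] * key_monomial M)" using N(3) by (simp add: u_mult[symmetric])
  finally show ?case .
qed

text \<open>
  Expansion in powers of the monic polynomial \<open>\<phi>\<^sub>k\<close> does not leave \<open>A[x]\<close>; the coefficients are expanded
  in turn.
\<close>

lemma box_sum_exists:
  "1 \<le> k \<Longrightarrow> k \<le> n \<Longrightarrow> g \<in> polys_over A \<Longrightarrow> degree g < degree (\<phi> k) \<Longrightarrow>
     \<exists>a. (\<forall>M. a M \<in> A) \<and> g = box_sum k a"
proof (induction k arbitrary: g rule: dec_induct)
  case base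
  then obtain c where c: "g = [:c:]" using \<phi>_1 by (auto elim!: degree_eq_zeroE)
  hence "c \<in> A" using base by (auto simp: polys_over_def dest: spec[of _ 0])
  thus ?case using c by (intro exI[of _ "\<lambda>_. c"]) (simp add: box_sum_def box_1[simplified])
next
  case (step k)
  have k: "k \<in> {1..<n}" "k \<in> {1..n}" using step by auto
  note p = \<phi>_props[OF k(2)]
  obtain e where e: "is_expansion (\<phi> k) e" "poly e (\<phi> k) = g" "\<And>i. poly.coeff e i \<in> polys_over A"
    using expansion_exists_over[OF p(2), of "polys_over A" g] div_mod_over[OF \<phi>_over[OF k(2)] p(1)] over_closed(1) step.prems
    by blast
  have de: "degree e < m k"
  proof (cases "e = 0")
    case True
    thus ?thesis using m_pos[OF k(1)] by simp
  next
    case False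
    have "degree e * degree (\<phi> k) < m k * degree (\<phi> k)"
      using expansion_degree(1)[OF p(2,1) e(1) False] e(2) step.prems m_degree[OF k(1)] by simp
    thus ?thesis by simp
  qed
  have "\<forall>j. \<exists>a. (\<forall>M. a M \<in> A) \<and> poly.coeff e j = box_sum k a"
    using step.IH e(1,3) step.prems(1) by (auto simp: is_expansion_def)
  then obtain a where a: "\<And>j M. a j M \<in> A" "\<And>j. poly.coeff e j = box_sum k (a j)" by metis
  define b where "b M = a (count M k) (filter_mset (\<lambda>l. l \<noteq> k) M)" for M
  have b: "b (M + replicate_mset j k) = a j M" if "M \<in> box k" for M j
  proof -
    have c: "count M k = 0" using that by (auto simp: box_def count_eq_zero_iff)
    hence "filter_mset (\<lambda>l. l \<noteq> k) (M + replicate_mset j k) = M" by (intro multiset_eqI) auto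
    thus ?thesis using c by (simp add: b_def)
  qed
  have "box_sum (Suc k) b = (\<Sum>j<m k. box_sum k (a j) * \<phi> k ^ j)"
    unfolding box_sum_Suc[OF step.hyps(1)] using b by (intro sum.cong refl) (simp add: box_sum_def)
  also have "\<dots> = (\<Sum>j\<le>degree e. poly.coeff e j * \<phi> k ^ j)"
    using de by (intro sum.mono_neutral_cong_right) (auto simp: a(2)[symmetric] coeff_eq_0)
  also have "\<dots> = g" using e(2) by (simp add: poly_altdef)
  finally have "g = box_sum (Suc k) b" by (rule sym)
  moreover have "b M \<in> A" for M using a(1) by (simp add: b_def)
  ultimately show ?case by blast
qed

text \<open>
  Since \<open>u(\<phi>\<^sub>i\<^sub>+\<^sub>1)\<close> exceeds the truncated value, the terms of least value must cancel. This is only possible if the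
  difference of \<open>\<phi>\<^sub>i\<^sub>+\<^sub>1\<close> and the power of \<open>\<phi>\<^sub>i\<close> has at least the value of that power.
\<close>

lemma \<phi>_step:
  assumes "i \<in> {1..<n}"
  shows "u (\<phi> i ^ m i) < u (\<phi> (Suc i))"
    and "u (\<phi> i ^ m i) \<le> u (\<phi> (Suc i) - \<phi> i ^ m i)"
    and "degree (\<phi> (Suc i) - \<phi> i ^ m i) < degree (\<phi> (Suc i))"
    and "\<phi> (Suc i) - \<phi> i ^ m i \<in> polys_over A"
proof -
  have i: "i \<in> {1..n}" "Suc i \<in> {1..n}" using assms by auto
  note p = \<phi>_props[OF i(1)] and q = \<phi>_props[OF i(2)]
  let ?g = "\<phi> (Suc i) - \<phi> i ^ m i"
  have dp: "degree (\<phi> i ^ m i) = degree (\<phi> (Suc i))" "lead_coeff (\<phi> i ^ m i) = 1"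
  proof -
    show d: "degree (\<phi> i ^ m i) = degree (\<phi> (Suc i))"
      using p m_degree[OF assms] by (simp add: degree_power_eq)
    show "lead_coeff (\<phi> i ^ m i) = 1" by (simp only: lead_coeff_power p(1) power_one)
  qed
  have "poly.coeff ?g j = 0" if "j \<ge> degree (\<phi> (Suc i))" for j
  proof (cases "j = degree (\<phi> (Suc i))")
    case True
    thus ?thesis using dp q(1) by simp
  next
    case False
    thus ?thesis using that dp by (simp add: coeff_eq_0)
  qed
  hence "degree ?g \<le> degree (\<phi> (Suc i)) - 1" by (intro degree_le) auto
  thus dg: "degree ?g < degree (\<phi> (Suc i))" using q(2) by simp
  show "?g \<in> polys_over A" using \<phi>_over i by (intro over_closed) auto
  have Wg: "trunc (\<phi> i) ?g = u ?g" by (rule trunc_\<phi>[OF assms dg])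
  have Wp: "trunc (\<phi> i) (\<phi> i ^ m i) = u (\<phi> i ^ m i)" by (rule trunc_self[OF p(2)])
  have J: "trunc (\<phi> i) (\<phi> (Suc i)) < u (\<phi> (Suc i))"
    using jump_simps(2)[OF \<phi>_abstract_key \<phi>_finite \<phi>_jump] assms by simp
  show ge: "u (\<phi> i ^ m i) \<le> u ?g"
  proof (rule ccontr)
    assume "\<not> ?thesis"
    hence lt: "u ?g < u (\<phi> i ^ m i)" by simp
    have "u (\<phi> (Suc i)) = u ?g" using u_add_eq[OF lt] by simp
    moreover have "trunc (\<phi> i) (\<phi> (Suc i)) = u ?g"
      using trunc_diff_eq(1)[OF p(2), where g = ?g and h = "- (\<phi> i ^ m i)"] lt Wg Wp trunc_uminus[OF p(2)] by simp
    ultimately show False using J by simp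
  qed
  have "min (trunc (\<phi> i) (\<phi> i ^ m i)) (trunc (\<phi> i) ?g) \<le> trunc (\<phi> i) (\<phi> i ^ m i + ?g)" by (rule trunc_add[OF p(2)])
  hence "u (\<phi> i ^ m i) \<le> trunc (\<phi> i) (\<phi> (Suc i))" using ge Wg Wp by simp
  thus "u (\<phi> i ^ m i) < u (\<phi> (Suc i))" using J by simp
qed

end

lemma single_eq_0_iff [simp]: "single k a = 0 \<longleftrightarrow> a = 0"
  by (metis lookup_single_eq lookup_zero single_zero)

locale graded_chain = key_chain f u v0 A n \<phi>
  for f :: "'k::field poly" and u :: "'k poly \<Rightarrow> 'g::linordered_ab_group_add ext_value" and v0 A n \<phi> +
  fixes v :: "'k poly set \<Rightarrow> 'g ext_value"
  assumes val_K: "valuation cring_class_ops v0" and val_L: "valuation (quot_field f) v"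
    and u_eq: "u g = v (cls f g)"
begin

(* keeps the index set {1..<n} literally equal to the parameter of the sublocale below *)
declare One_nat_def [simp del]

abbreviation "gS \<equiv> gr (cring_class_ops :: 'k ring) v0 A"
abbreviation "gT \<equiv> gr (quot_field f) v (quot_subring A f)"
abbreviation "P \<equiv> mpoly_ring gS {1..<n}"

lemma A_subr: "subr A" using A_closed by (simp add: subr_def)

lemma over_subr: "subr (polys_over A)" using over_closed by (simp add: subr_def)

sublocale S: gr_rep "cring_class_ops :: 'k ring" v0 "\<lambda>a. a" A A
  by standard (use val_K A_subr in \<open>auto simp: ring_hom_def\<close>)

sublocale T: gr_rep "quot_field f" v "cls f" "polys_over A" "quot_subring A f"
  by standard (use val_L over_subr cls_hom in \<open>auto simp: quot_subring_def\<close>)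

sublocale M: mpoly_rep gS S.\<rho> S.Rees "{1..<n}"
  by (rule mpoly_rep.intro[OF S.gr_cring S.Rees_subr S.\<rho>_hom S.\<rho>_image S.\<rho>_zero])

lemma \<omega>_S [simp]: "S.\<omega> a = v0 a" by (simp add: S.\<omega>_def)
lemma \<omega>_T [simp]: "T.\<omega> g = u g" by (simp add: T.\<omega>_def u_eq)

definition "\<mu> i = fin_part (u (\<phi> i))"

definition "lift = Poly_Mapping.map (\<lambda>c::'k. [:c:])"

lemma lookup_lift [simp]: "lookup (lift a) \<gamma> = [:lookup a \<gamma>:]" for a :: "'g \<Rightarrow>\<^sub>0 'k"
  by (simp add: lift_def Poly_Mapping.map.rep_eq when_def)

lemma keys_lift [simp]: "keys (lift a) = keys a" for a :: "'g \<Rightarrow>\<^sub>0 'k"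
  by (auto simp: in_keys_iff)

sublocale E: evaluation "lift :: ('g \<Rightarrow>\<^sub>0 'k) \<Rightarrow> 'g \<Rightarrow>\<^sub>0 'k poly" "\<lambda>i. single (\<mu> i) (\<phi> i)"
proof
  fix a b :: "'g \<Rightarrow>\<^sub>0 'k"
  show "lift (a + b) = lift a + lift b" by (rule poly_mapping_eqI) (simp add: lookup_add)
  have s: "(\<Sum>i\<in>X. [:t i:]) = [:\<Sum>i\<in>X. t i:]" for X and t :: "'g \<Rightarrow> 'k"
    by (induction X rule: infinite_finite_induct) auto
  show "lift (a * b) = lift a * lift b"
    by (rule poly_mapping_eqI) (simp add: lookup_mult_group s mult.commute)
  show "lift (1 :: 'g \<Rightarrow>\<^sub>0 'k) = 1"
    by (rule poly_mapping_eqI) (simp add: lookup_one when_def one_pCons)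
qed

definition "mon_degree M = (\<Sum>i\<in>#M. \<mu> i)"

lemma mon_degree_simps [simp]: "mon_degree {#} = 0" "mon_degree (add_mset i M) = \<mu> i + mon_degree M" "mon_degree (M + N) = mon_degree M + mon_degree N"
  by (simp_all add: mon_degree_def)

lemma monomial_value: "prod_mset (image_mset (\<lambda>i. single (\<mu> i) (\<phi> i)) M) = single (mon_degree M) (key_monomial M)"
  by (induction M) (simp_all add: mult_single)

text \<open>
  In degree \<open>\<delta>\<close>, evaluation of lifts is a combination of key monomials with constant coefficients, to
  which the statements about \<open>box_sum\<close> apply.
\<close>

lemma lookup_E: "lookup (E.E p) \<delta> =
    (\<Sum>M\<in>keys p. [:lookup (lookup p M) (\<delta> - mon_degree M):] * key_monomial M)"
proof -
  have "lookup (lift a * single e g) \<delta> = [:lookup a (\<delta> - e):] * g"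
    for a :: "'g \<Rightarrow>\<^sub>0 'k" and e g
  proof -
    have "lookup (single e g * lift a) \<delta> = g * [:lookup a (\<delta> - e):]"
      by (cases "g = 0") (simp_all add: lookup_mult_group)
    thus ?thesis by (simp add: mult.commute)
  qed
  thus ?thesis by (simp only: E.E_def monomial_value lookup_sum)
qed

lemma E_single: "E.E (single M (single \<gamma> a)) = single (\<gamma> + mon_degree M) ([:a:] * key_monomial M)"
proof (rule poly_mapping_eqI)
  fix \<delta>
  show "lookup (E.E (single M (single \<gamma> a))) \<delta> =
      lookup (single (\<gamma> + mon_degree M) ([:a:] * key_monomial M)) \<delta>"
    by (cases "a = 0") (auto simp: lookup_E lookup_single when_def)
qed

lemma u_\<phi>: "i \<in> {1..<n} \<Longrightarrow> u (\<phi> i) = Fin (\<mu> i)"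
  using \<phi>_finite[of i] by (cases "u (\<phi> i)") (auto simp: \<mu>_def)

lemma u_key_monomial: "set_mset M \<subseteq> {1..<n} \<Longrightarrow> u (key_monomial M) = Fin (mon_degree M)"
  by (induction M) (auto simp: u_mult u_\<phi> zero_ext_value_def)

lemma u_term_iff:
  assumes "set_mset M \<subseteq> {1..<n}"
  shows "Fin \<delta> \<le> u ([:a:] * key_monomial M) \<longleftrightarrow> Fin (\<delta> - mon_degree M) \<le> v0 a" "Fin \<delta> < u ([:a:] * key_monomial M) \<longleftrightarrow> Fin (\<delta> - mon_degree M) < v0 a"
proof -
  have e: "u ([:a:] * key_monomial M) = v0 a + Fin (mon_degree M)" unfolding u_mult u_key_monomial[OF assms] u_const ..
  show "Fin \<delta> \<le> u ([:a:] * key_monomial M) \<longleftrightarrow> Fin (\<delta> - mon_degree M) \<le> v0 a" "Fin \<delta> < u ([:a:] * key_monomial M) \<longleftrightarrow> Fin (\<delta> - mon_degree M) < v0 a"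
    unfolding e by (cases "v0 a"; simp add: algebra_simps)+
qed

lemma key_monomial_over: "set_mset M \<subseteq> {1..<n} \<Longrightarrow> key_monomial M \<in> polys_over A"
  by (induction M) (auto intro!: over_closed \<phi>_over)

lemma const_over: "a \<in> A \<Longrightarrow> [:a:] \<in> polys_over A"
  using over_closed(6)[of a 0] by (simp add: monom_0)

lemma lifts_keys: "p \<in> M.lifts \<Longrightarrow> N \<in> keys p \<Longrightarrow> set_mset N \<subseteq> {1..<n}"
  using M.liftsD(2) by (simp add: in_keys_iff)

lemma E_Rees:
  assumes "p \<in> M.lifts"
  shows "E.E p \<in> T.Rees"
  unfolding T.Rees_def
proof (intro CollectI allI conjI)
  fix \<gamma>
  have c: "lookup p N \<in> S.Rees" for N using M.liftsD(1)[OF assms] .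
  show "lookup (E.E p) \<gamma> \<in> polys_over A"
    unfolding lookup_E
    by (intro subr_sum[OF over_subr] over_closed(5) const_over key_monomial_over S.ReesD(1)[OF c] lifts_keys[OF assms])
  show "Fin \<gamma> \<le> T.\<omega> (lookup (E.E p) \<gamma>)"
    unfolding \<omega>_T lookup_E
  proof (rule u_sum_ge)
    fix N assume "N \<in> keys p"
    thus "Fin \<gamma> \<le> u ([:lookup (lookup p N) (\<gamma> - mon_degree N):] * key_monomial N)"
      using u_term_iff(1)[OF lifts_keys[OF assms]] S.ReesD(2)[OF c, of "\<gamma> - mon_degree N" N] by simp
  qed
qed

definition eval_class :: "(nat multiset \<Rightarrow>\<^sub>0 'g \<Rightarrow>\<^sub>0 'k) \<Rightarrow> 'g \<Rightarrow> 'k poly set set" where "eval_class p = T.\<rho> (E.E p)"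

lemma eval_class_add: "p \<in> M.lifts \<Longrightarrow> q \<in> M.lifts \<Longrightarrow> eval_class (p + q) = eval_class p \<oplus>\<^bsub>gT\<^esub> eval_class q"
  by (simp add: eval_class_def E.E_add T.\<rho>_add E_Rees)

lemma eval_class_hom: "eval_class \<in> ring_hom (cring_class_ops \<lparr>carrier := M.lifts\<rparr>) gT"
proof (rule ring_hom_memI)
  fix p q assume "p \<in> carrier (cring_class_ops \<lparr>carrier := M.lifts\<rparr>)" "q \<in> carrier (cring_class_ops \<lparr>carrier := M.lifts\<rparr>)"
  hence pq: "p \<in> M.lifts" "q \<in> M.lifts" by auto
  show "eval_class p \<in> carrier gT" using T.\<rho>_image E_Rees[OF pq(1)] by (auto simp: eval_class_def)
  show "eval_class (p \<otimes>\<^bsub>cring_class_ops \<lparr>carrier := M.lifts\<rparr>\<^esub> q) = eval_class p \<otimes>\<^bsub>gT\<^esub> eval_class q"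
    using pq by (simp add: cring_class_ops_def eval_class_def E.E_mult T.\<rho>_mult E_Rees)
  show "eval_class (p \<oplus>\<^bsub>cring_class_ops \<lparr>carrier := M.lifts\<rparr>\<^esub> q) = eval_class p \<oplus>\<^bsub>gT\<^esub> eval_class q"
    using pq by (simp add: cring_class_ops_def eval_class_add)
next
  show "eval_class \<one>\<^bsub>cring_class_ops \<lparr>carrier := M.lifts\<rparr>\<^esub> = \<one>\<^bsub>gT\<^esub>"
    by (simp add: cring_class_ops_def eval_class_def E.E_one T.\<rho>_one)
qed

lemma H_zero_iff:
  assumes "p \<in> M.lifts"
  shows "M.H p = \<zero>\<^bsub>P\<^esub> \<longleftrightarrow> (\<forall>N \<gamma>. Fin \<gamma> < v0 (lookup (lookup p N) \<gamma>))"
proof -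
  have "M.H p = \<zero>\<^bsub>P\<^esub> \<longleftrightarrow> (\<forall>N. S.\<rho> (lookup p N) = \<zero>\<^bsub>gS\<^esub>)"
    unfolding M.H_def M.mpoly_ring_simps(3) by (rule fun_eq_iff)
  thus ?thesis by (simp only: S.\<rho>_eq_zero_iff[OF M.liftsD(1)[OF assms]] \<omega>_S)
qed

lemma eval_class_zero_iff: "p \<in> M.lifts \<Longrightarrow> eval_class p = \<zero>\<^bsub>gT\<^esub> \<longleftrightarrow> (\<forall>\<delta>. Fin \<delta> < u (lookup (E.E p) \<delta>))"
  using T.\<rho>_eq_zero_iff[OF E_Rees[of p]] by (simp add: eval_class_def)

lemma H_zero_imp:
  assumes p: "p \<in> M.lifts" and H0: "M.H p = \<zero>\<^bsub>P\<^esub>"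
  shows "eval_class p = \<zero>\<^bsub>gT\<^esub>"
  unfolding eval_class_zero_iff[OF p] lookup_E
proof (intro allI u_sum_gt)
  fix \<delta> N assume N: "N \<in> keys p"
  show "Fin \<delta> < u ([:lookup (lookup p N) (\<delta> - mon_degree N):] * key_monomial N)"
    unfolding u_term_iff(2)[OF lifts_keys[OF p N]]
    by (rule H0[unfolded H_zero_iff[OF p], THEN spec, THEN spec])
qed simp

definition "boxed p \<longleftrightarrow> keys p \<subseteq> box n" for p :: "nat multiset \<Rightarrow>\<^sub>0 'g \<Rightarrow>\<^sub>0 'k"

text \<open>
  Valuation independence of the basis monomials: if a combination has value above \<open>\<delta>\<close>, so has each
  of its terms.
\<close>

lemma eval_class_boxed:
  assumes "p \<in> M.lifts" "boxed p" "eval_class p = \<zero>\<^bsub>gT\<^esub>"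
  shows "M.H p = \<zero>\<^bsub>P\<^esub>"
  unfolding H_zero_iff[OF assms(1)]
proof (intro allI)
  fix N \<gamma>
  show "Fin \<gamma> < v0 (lookup (lookup p N) \<gamma>)"
  proof (cases "N \<in> keys p")
    case False
    thus ?thesis using u_const[of 0] by (simp add: in_keys_iff flip: u_const)
  next
    case True
    let ?a = "\<lambda>M. lookup (lookup p M) (\<gamma> + mon_degree N - mon_degree M)"
    have N: "N \<in> box n" using True assms(2) by (auto simp: boxed_def)
    have eq: "lookup (E.E p) (\<gamma> + mon_degree N) = box_sum n ?a"
      unfolding lookup_E box_sum_def
      using assms(2) box_finite[OF n_pos]
      by (intro sum.mono_neutral_left) (auto simp: boxed_def in_keys_iff)
    have "Fin (\<gamma> + mon_degree N) < u (box_sum n ?a)"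
      by (rule assms(3)[unfolded eval_class_zero_iff[OF assms(1)], THEN spec, of "\<gamma> + mon_degree N", unfolded eq])
    also have "\<dots> \<le> u ([:?a N:] * key_monomial N)" by (rule box_sum_value[OF n_pos order_refl N])
    finally show ?thesis using u_term_iff(2)[OF lifts_keys[OF assms(1) True]] by simp
  qed
qed

text \<open>
  Lifts of homogeneous polynomials in which each coefficient is concentrated in the one degree where its
  image can be nonzero.
\<close>

definition homog_lifts :: "'g \<Rightarrow> (nat multiset \<Rightarrow>\<^sub>0 'g \<Rightarrow>\<^sub>0 'k) set" where
  "homog_lifts \<delta> = {p \<in> M.lifts. \<forall>N \<gamma>. \<gamma> \<noteq> \<delta> - mon_degree N \<longrightarrow> lookup (lookup p N) \<gamma> = 0}"

abbreviation "PH \<delta> \<equiv> mpoly_homog gS {1..<n} (gr_homog (cring_class_ops :: 'k ring) v0 A) \<mu> \<delta>"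

lemma homog_lifts_homog: "p \<in> homog_lifts \<delta> \<Longrightarrow> M.H p \<in> PH \<delta>"
  using M.H_image S.\<rho>_homog_iff[OF M.liftsD(1)[of p]] u_const[of 0]
  by (auto simp: homog_lifts_def mpoly_homog_def M.H_def mon_degree_def[symmetric] simp flip: u_const)

lemma homog_lifts_onto:
  assumes "x \<in> PH \<delta>"
  obtains p where "p \<in> homog_lifts \<delta>" "x = M.H p"
proof -
  obtain q where q: "q \<in> M.lifts" "x = M.H q" using assms M.H_image by (auto simp: mpoly_homog_def)
  have h: "S.\<rho> (lookup q N) \<in> gr_homog cring_class_ops v0 A (\<delta> - mon_degree N)" for N
    using assms q(2) by (simp add: mpoly_homog_def M.H_def mon_degree_def)
  define t where "t N = single (\<delta> - mon_degree N) (lookup (lookup q N) (\<delta> - mon_degree N))" for N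
  define p where "p = Abs_poly_mapping t"
  have "{N. t N \<noteq> 0} \<subseteq> keys q" by (auto simp: t_def in_keys_iff)
  hence "finite {N. t N \<noteq> 0}" by (rule finite_subset) simp
  hence lp: "lookup p N = t N" for N by (simp add: p_def)
  have tR: "t N \<in> S.Rees" for N
    unfolding t_def using S.ReesD[OF M.liftsD(1)[OF q(1)]] by (intro S.single_Rees)
  have "set_mset N \<subseteq> {1..<n}" if "t N \<noteq> 0" for N
    using M.liftsD(2)[OF q(1), of N] that by (cases "lookup q N = 0") (auto simp: t_def)
  hence pMP: "p \<in> M.lifts" using tR by (simp add: M.lifts_def lp)
  have "S.\<rho> (t N) = S.\<rho> (lookup q N)" for N
    unfolding S.\<rho>_eq_iff[OF tR M.liftsD(1)[OF q(1)]]
  proof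
    fix \<gamma>
    have inf: "v0 0 = Infty" using u_const[of 0] by simp
    show "Fin \<gamma> < S.\<omega> (lookup (t N) \<gamma> - lookup (lookup q N) \<gamma>)"
    proof (cases "\<gamma> = \<delta> - mon_degree N")
      case True
      thus ?thesis using inf by (simp add: t_def)
    next
      case False
      hence "Fin \<gamma> < v0 (lookup (lookup q N) \<gamma>)"
        using h[of N] S.\<rho>_homog_iff[OF M.liftsD(1)[OF q(1)]] by simp
      thus ?thesis using False S.\<omega>_uminus[of "lookup (lookup q N) \<gamma>"]
        by (simp add: t_def lookup_single_not_eq)
    qed
  qed
  hence "M.H p = x" using q(2) by (simp add: M.H_def lp)
  moreover have "p \<in> homog_lifts \<delta>" using pMP by (auto simp: homog_lifts_def lp t_def lookup_single_not_eq)
  ultimately show ?thesis using that by blast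
qed

lemma homog_lifts_eval_class: "p \<in> homog_lifts \<delta> \<Longrightarrow> eval_class p \<in> gr_homog (quot_field f) v (quot_subring A f) \<delta>"
proof -
  assume p: "p \<in> homog_lifts \<delta>"
  hence pM: "p \<in> M.lifts" by (simp add: homog_lifts_def)
  have "lookup (E.E p) \<gamma> = 0" if "\<gamma> \<noteq> \<delta>" for \<gamma>
    unfolding lookup_E using p that by (intro sum.neutral) (auto simp: homog_lifts_def)
  thus ?thesis using T.\<rho>_homog_iff[OF E_Rees[OF pM]] by (simp add: eval_class_def)
qed

lemma mod_f_over: "g \<in> polys_over A \<Longrightarrow> g mod f \<in> polys_over A"
  using div_mod_over[OF f_over f_monic] by blast

text \<open>
  Reduce \<open>g\<close> modulo \<open>f\<close>, which does not change its class, and expand the remainder in the basis monomials. The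
  terms have value at least \<open>\<delta>\<close>, so the expansion lifts to a homogeneous polynomial of degree \<open>\<delta>\<close>.
\<close>

lemma \<rho>_lift:
  assumes g: "g \<in> polys_over A" "Fin \<delta> \<le> u g"
  obtains p where "p \<in> homog_lifts \<delta>" "boxed p" "eval_class p = T.\<rho> (single \<delta> g)"
proof -
  let ?r = "g mod f"
  have r: "?r \<in> polys_over A" "degree ?r < degree (\<phi> n)"
    using mod_f_over[OF g(1)] f_degree \<phi>_n by (auto simp: degree_mod_lt)
  obtain a where a: "\<And>M. a M \<in> A" "?r = box_sum n a" using box_sum_exists[OF n_pos order_refl r] by blast
  define p where "p = (\<Sum>N\<in>box n. single N (single (\<delta> - mon_degree N) (a N)))"
  have sub: "set_mset N \<subseteq> {1..<n}" if "N \<in> box n" for N using that by (simp add: box_def)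
  have lp: "lookup p N = (if N \<in> box n then single (\<delta> - mon_degree N) (a N) else 0)" for N
    using box_finite[OF n_pos] by (simp add: p_def lookup_sum lookup_single when_def sum.delta)
  have R: "single (\<delta> - mon_degree N) (a N) \<in> S.Rees" if N: "N \<in> box n" for N
  proof (rule S.single_Rees[OF a(1)])
    have "Fin \<delta> \<le> u (box_sum n a)" using g(2) a(2) u_mod_f[of g] by simp
    also have "\<dots> \<le> u ([:a N:] * key_monomial N)" by (rule box_sum_value[OF n_pos order_refl N])
    finally show "Fin (\<delta> - mon_degree N) \<le> S.\<omega> (a N)" using u_term_iff(1)[OF sub[OF N]] by simp
  qed
  have lifts: "p \<in> M.lifts" unfolding p_def by (intro subr_sum[OF M.lifts_subr] M.single_lifts R sub)
  have "E.E p = (\<Sum>N\<in>box n. single \<delta> ([:a N:] * key_monomial N))" by (simp only: p_def E.E_sum E_single) simp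
  also have "\<dots> = single \<delta> ?r"
    by (rule poly_mapping_eqI) (auto simp: a(2) box_sum_def lookup_sum lookup_single when_def)
  finally have E: "E.E p = single \<delta> ?r" .
  have ur: "Fin \<delta> \<le> u ?r" using g(2) u_mod_f by simp
  have "T.\<rho> (single \<delta> ?r) = T.\<rho> (single \<delta> g)"
  proof -
    have "f dvd ?r - g" by (metis dvd_minus_iff dvd_minus_mod minus_diff_eq)
    hence "u (?r - g) = Infty" using u_Infty by blast
    thus ?thesis using g r ur
      by (subst T.\<rho>_eq_iff) (auto intro!: T.single_Rees simp: lookup_single when_def)
  qed
  hence "eval_class p = T.\<rho> (single \<delta> g)" by (simp add: eval_class_def E)
  moreover have "p \<in> homog_lifts \<delta>" using lifts by (auto simp: homog_lifts_def lp lookup_single_not_eq)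
  moreover have "boxed p" by (auto simp: boxed_def in_keys_iff lp split: if_splits)
  ultimately show ?thesis using that by blast
qed

lemma eval_class_onto: "eval_class ` M.lifts = carrier gT"
proof (rule antisym; rule subsetI)
  fix y assume "y \<in> eval_class ` M.lifts" thus "y \<in> carrier gT" using T.\<rho>_image E_Rees by (auto simp: eval_class_def)
next
  fix y assume "y \<in> carrier gT"
  then obtain b where b: "b \<in> T.Rees" "y = T.\<rho> b" using T.\<rho>_image by blast
  let ?t = "\<lambda>\<gamma>. single \<gamma> (lookup b \<gamma>)"
  have tR: "?t \<gamma> \<in> T.Rees" for \<gamma> using T.ReesD[OF b(1)] by (intro T.single_Rees)
  have "finite X \<Longrightarrow> \<exists>p\<in>M.lifts. eval_class p = T.\<rho> (\<Sum>\<gamma>\<in>X. ?t \<gamma>)" for X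
  proof (induction X rule: finite_induct)
    case empty
    show ?case using subrD(2)[OF M.lifts_subr] by (intro bexI[of _ 0]) (simp_all add: eval_class_def)
  next
    case (insert \<gamma> X)
    then obtain p where p: "p \<in> M.lifts" "eval_class p = T.\<rho> (\<Sum>\<gamma>\<in>X. ?t \<gamma>)" by blast
    have le: "Fin \<gamma> \<le> u (lookup b \<gamma>)" using T.ReesD(2)[OF b(1), of \<gamma>] by simp
    obtain q where q: "q \<in> homog_lifts \<gamma>" "boxed q" "eval_class q = T.\<rho> (?t \<gamma>)"
      by (rule \<rho>_lift[OF T.ReesD(1)[OF b(1)] le])
    have qM: "q \<in> M.lifts" using q by (simp add: homog_lifts_def)
    have sR: "(\<Sum>\<gamma>\<in>X. ?t \<gamma>) \<in> T.Rees" by (intro subr_sum[OF T.Rees_subr] tR)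
    have "eval_class (q + p) = T.\<rho> (?t \<gamma> + (\<Sum>\<gamma>\<in>X. ?t \<gamma>))"
      by (simp add: eval_class_add[OF qM p(1)] p(2) q(3) T.\<rho>_add[OF tR sR])
    thus ?case using insert.hyps subrD(5)[OF M.lifts_subr qM p(1)] by (intro bexI[of _ "q + p"]) simp_all
  qed
  from this[of "keys b"] obtain p where p: "p \<in> M.lifts" "eval_class p = T.\<rho> b"
    using poly_mapping_sum_single[of b] by auto
  hence "y = eval_class p" using b(2) by simp
  thus "y \<in> eval_class ` M.lifts" using p(1) by (rule image_eqI)
qed

section \<open>The relations\<close>

text \<open>
  The coefficients of \<open>\<phi>\<^sub>i\<^sub>+\<^sub>1 - \<phi>\<^sub>i\<^sup>m\<close>, with \<open>m = m\<^sub>i\<close>, in the basis monomials; their initial forms in the degrees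
  given by \<open>rel_term\<close> are the coefficients of the relation of index \<open>i\<close>.
\<close>

definition "rel_coeff i = (SOME a. (\<forall>M. a M \<in> A) \<and> \<phi> (Suc i) - \<phi> i ^ m i = box_sum (Suc i) a)"

lemma rel_coeff:
  assumes "i \<in> {1..<n}"
  shows "rel_coeff i M \<in> A" "\<phi> (Suc i) - \<phi> i ^ m i = box_sum (Suc i) (rel_coeff i)"
proof -
  have "\<exists>a. (\<forall>M. a M \<in> A) \<and> \<phi> (Suc i) - \<phi> i ^ m i = box_sum (Suc i) a"
    using \<phi>_step(3,4)[OF assms] assms by (intro box_sum_exists) auto
  from someI_ex[OF this] show "rel_coeff i M \<in> A" "\<phi> (Suc i) - \<phi> i ^ m i = box_sum (Suc i) (rel_coeff i)"
    by (auto simp: rel_coeff_def)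
qed

definition "top_monomial i = replicate_mset (m i) i"

definition "rel_term i M = single (mon_degree (top_monomial i) - mon_degree M) (rel_coeff i M)"

definition "lifted_rel i = single (top_monomial i) 1 + (\<Sum>M\<in>box (Suc i). single M (rel_term i M))"

lemma box_sub: "i \<in> {1..<n} \<Longrightarrow> M \<in> box (Suc i) \<Longrightarrow> set_mset M \<subseteq> {1..<n}"
  by (auto simp: box_def)

lemma top_monomial_sub: "i \<in> {1..<n} \<Longrightarrow> set_mset (top_monomial i) \<subseteq> {1..<n}"
  by (auto simp: top_monomial_def)

lemma u_top_monomial: "i \<in> {1..<n} \<Longrightarrow> u (\<phi> i ^ m i) = Fin (mon_degree (top_monomial i))"
  using u_key_monomial[OF top_monomial_sub] by (simp add: top_monomial_def)

lemma rel_term_value: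
  assumes "i \<in> {1..<n}" "M \<in> box (Suc i)"
  shows "Fin (mon_degree (top_monomial i) - mon_degree M) \<le> v0 (rel_coeff i M)"
proof -
  have "Fin (mon_degree (top_monomial i)) \<le> u (box_sum (Suc i) (rel_coeff i))"
    using \<phi>_step(2)[OF assms(1)] rel_coeff(2)[OF assms(1)] u_top_monomial[OF assms(1)] by simp
  also have "\<dots> \<le> u ([:rel_coeff i M:] * key_monomial M)" using assms by (intro box_sum_value) auto
  finally show ?thesis using u_term_iff(1)[OF box_sub[OF assms]] by simp
qed

lemma rel_term_Rees: "i \<in> {1..<n} \<Longrightarrow> M \<in> box (Suc i) \<Longrightarrow> rel_term i M \<in> S.Rees"
  unfolding rel_term_def using rel_coeff rel_term_value by (intro S.single_Rees) auto

lemma lifted_rel_lifts: "i \<in> {1..<n} \<Longrightarrow> lifted_rel i \<in> M.lifts"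
  unfolding lifted_rel_def
  by (intro subrD(5)[OF M.lifts_subr] subr_sum[OF M.lifts_subr] M.single_lifts rel_term_Rees subrD(1)[OF S.Rees_subr] top_monomial_sub box_sub)

lemma lifted_rel_homog_lifts: "i \<in> {1..<n} \<Longrightarrow> lifted_rel i \<in> homog_lifts (mon_degree (top_monomial i))"
proof -
  assume i: "i \<in> {1..<n}"
  have "lookup (lookup (lifted_rel i) N) \<gamma> = 0" if "\<gamma> \<noteq> mon_degree (top_monomial i) - mon_degree N" for N \<gamma>
  proof -
    have 1: "lookup (lookup (single (top_monomial i) (1 :: 'g \<Rightarrow>\<^sub>0 'k)) N) \<gamma> = 0"
      using that by (auto simp: lookup_single when_def lookup_one)
    have 2: "lookup (lookup (single M (rel_term i M)) N) \<gamma> = 0" for M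
      using that by (auto simp: lookup_single when_def rel_term_def)
    show ?thesis by (simp add: lifted_rel_def lookup_add lookup_sum 1 2)
  qed
  thus ?thesis using lifted_rel_lifts[OF i] by (simp add: homog_lifts_def)
qed

text \<open>
  Evaluation turns the relation into \<open>\<phi>\<^sub>i\<^sub>+\<^sub>1\<close>, placed in the degree of \<open>\<phi>\<^sub>i\<^sup>m\<close>, with \<open>m = m\<^sub>i\<close>. There it
  vanishes because its value is larger.
\<close>

lemma eval_class_lifted_rel: "i \<in> {1..<n} \<Longrightarrow> eval_class (lifted_rel i) = \<zero>\<^bsub>gT\<^esub>"
proof -
  assume i: "i \<in> {1..<n}"
  have "E.E (lifted_rel i) = single (mon_degree (top_monomial i)) (key_monomial (top_monomial i)) +
      (\<Sum>M\<in>box (Suc i). single (mon_degree (top_monomial i)) ([:rel_coeff i M:] * key_monomial M))"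
    using E_single[of "top_monomial i" 0 1]
    by (simp add: lifted_rel_def E.E_add E.E_sum rel_term_def E_single del: mult_pCons_left) (simp add: one_pCons[symmetric])
  also have "\<dots> = single (mon_degree (top_monomial i)) (\<phi> (Suc i))"
  proof (rule poly_mapping_eqI)
    fix \<gamma>
    have "\<phi> (Suc i) = key_monomial (top_monomial i) + (\<Sum>M\<in>box (Suc i). [:rel_coeff i M:] * key_monomial M)"
      using rel_coeff(2)[OF i] by (simp add: box_sum_def top_monomial_def algebra_simps)
    thus "lookup (single (mon_degree (top_monomial i)) (key_monomial (top_monomial i)) +
      (\<Sum>M\<in>box (Suc i). single (mon_degree (top_monomial i)) ([:rel_coeff i M:] * key_monomial M))) \<gamma> =
      lookup (single (mon_degree (top_monomial i)) (\<phi> (Suc i))) \<gamma>"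
      by (simp add: lookup_add lookup_sum lookup_single when_def)
  qed
  finally have "E.E (lifted_rel i) = single (mon_degree (top_monomial i)) (\<phi> (Suc i))" .
  thus ?thesis using \<phi>_step(1)[OF i] u_top_monomial[OF i]
    by (auto simp: eval_class_zero_iff[OF lifted_rel_lifts[OF i]] lookup_single when_def)
qed

lemma key_monomial_nonzero: "set_mset M \<subseteq> {1..<n} \<Longrightarrow> key_monomial M \<noteq> 0"
  using u_key_monomial[of M] by (metis ext_value.distinct(1) u_0)

text \<open>
  A monomial outside the box is divisible by the top monomial of some relation, and is rewritten by it. The
  degree in \<open>x\<close> of the evaluated monomial decreases, because the other monomials of the relation have
  degree below that of \<open>\<phi>\<^sub>i\<^sub>+\<^sub>1\<close>, the degree of the top monomial.
\<close>

lemma reduce_monomial: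
  assumes J: "\<And>p q. p \<in> J \<Longrightarrow> q \<in> J \<Longrightarrow> p + q \<in> J" "\<And>p q. p \<in> M.lifts \<Longrightarrow> q \<in> J \<Longrightarrow> p * q \<in> J" "0 \<in> J"
    and lifted_rel: "\<And>i. i \<in> {1..<n} \<Longrightarrow> lifted_rel i \<in> J"
  shows "set_mset M \<subseteq> {1..<n} \<Longrightarrow> c \<in> S.Rees \<Longrightarrow>
    \<exists>q\<in>M.lifts. boxed q \<and> single M c - q \<in> J"
proof (induction "degree (key_monomial M)" arbitrary: M c rule: less_induct)
  case less
  have Js: "sum t X \<in> J" if "\<And>i. i \<in> X \<Longrightarrow> t i \<in> J" for X :: "nat multiset set" and t
    using that by (induction X rule: infinite_finite_induct) (auto intro: J)
  have Jm: "- p \<in> J" if "p \<in> J" for p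
    using J(2)[of "- 1" p] that subrD(6)[OF M.lifts_subr subrD(1)[OF M.lifts_subr]] by simp
  show ?case
  proof (cases "M \<in> box n")
    case True
    thus ?thesis using less.prems J(3)
      by (intro bexI[of _ "single M c"]) (auto simp: boxed_def M.single_lifts)
  next
    case False
    then obtain i where i: "i \<in> {1..<n}" "m i \<le> count M i" using less.prems(1) by (auto simp: box_def not_less)
    define M0 where "M0 = M - top_monomial i"
    have "top_monomial i \<subseteq># M" using i(2) by (simp add: top_monomial_def count_le_replicate_mset_subset_eq)
    hence M: "M = M0 + top_monomial i" by (simp add: M0_def)
    have M0: "set_mset M0 \<subseteq> {1..<n}" using less.prems(1) M by auto
    have ex: "\<exists>q\<in>M.lifts. boxed q \<and> single (M0 + N) (c * rel_term i N) - q \<in> J" if N: "N \<in> box (Suc i)" for N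
    proof (rule less.hyps)
      have "degree (key_monomial N) < degree (\<phi> (Suc i))" using i(1) N by (intro box_degree) auto
      also have "\<dots> = degree (key_monomial (top_monomial i))"
        using m_degree[OF i(1)] \<phi>_props(3)[of i] i(1) by (simp add: top_monomial_def degree_power_eq)
      finally show "degree (key_monomial (M0 + N)) < degree (key_monomial M)"
        using key_monomial_nonzero[OF M0] key_monomial_nonzero[OF box_sub[OF i(1) N]] key_monomial_nonzero[OF top_monomial_sub[OF i(1)]]
        by (simp add: M degree_mult_eq)
      show "set_mset (M0 + N) \<subseteq> {1..<n}" using M0 box_sub[OF i(1) N] by simp
      show "c * rel_term i N \<in> S.Rees" by (rule subrD(4)[OF S.Rees_subr less.prems(2) rel_term_Rees[OF i(1) N]])
    qed
    then obtain q where q: "\<And>N. N \<in> box (Suc i) \<Longrightarrow> q N \<in> M.lifts \<and> boxed (q N) \<and> single (M0 + N) (c * rel_term i N) - q N \<in> J"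
      by metis
    define p where "p = - (\<Sum>N\<in>box (Suc i). q N)"
    have "p \<in> M.lifts" unfolding p_def using q by (intro subrD(6)[OF M.lifts_subr] subr_sum[OF M.lifts_subr]) auto
    moreover have "boxed p"
      unfolding boxed_def
    proof
      fix N assume "N \<in> keys p"
      hence "(\<Sum>K\<in>box (Suc i). lookup (q K) N) \<noteq> 0" by (simp add: p_def in_keys_iff lookup_sum)
      then obtain K where "K \<in> box (Suc i)" "lookup (q K) N \<noteq> 0" by (rule sum.not_neutral_contains_not_neutral)
      thus "N \<in> box n" using q[of K] by (auto simp: boxed_def in_keys_iff)
    qed
    moreover have "single M c - p \<in> J"
    proof -
      have "single M0 c * lifted_rel i =
          single M c + (\<Sum>N\<in>box (Suc i). single (M0 + N) (c * rel_term i N))"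
        by (simp add: lifted_rel_def distrib_left sum_distrib_left mult_single M)
      hence "single M c - p = single M0 c * lifted_rel i +
          - (\<Sum>N\<in>box (Suc i). single (M0 + N) (c * rel_term i N) - q N)"
        by (simp add: p_def sum_subtractf)
      also have "\<dots> \<in> J"
        using q by (intro J(1) J(2) Jm Js M.single_lifts less.prems M0 lifted_rel i) auto
      finally show ?thesis .
    qed
    ultimately show ?thesis by blast
  qed
qed

lemma reduce:
  assumes J: "\<And>p q. p \<in> J \<Longrightarrow> q \<in> J \<Longrightarrow> p + q \<in> J" "\<And>p q. p \<in> M.lifts \<Longrightarrow> q \<in> J \<Longrightarrow> p * q \<in> J" "0 \<in> J"
    and lifted_rel: "\<And>i. i \<in> {1..<n} \<Longrightarrow> lifted_rel i \<in> J" and p: "p \<in> M.lifts"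
  obtains q where "q \<in> M.lifts" "boxed q" "p - q \<in> J"
proof -
  have "\<exists>q\<in>M.lifts. boxed q \<and> single M (lookup p M) - q \<in> J" if "M \<in> keys p" for M
    using lifts_keys[OF p that] M.liftsD(1)[OF p] by (intro reduce_monomial J lifted_rel) auto
  then obtain q where q: "\<And>M. M \<in> keys p \<Longrightarrow> q M \<in> M.lifts \<and> boxed (q M) \<and> single M (lookup p M) - q M \<in> J"
    by metis
  have Js: "sum t X \<in> J" if "\<And>i. i \<in> X \<Longrightarrow> t i \<in> J" for X :: "nat multiset set" and t
    using that by (induction X rule: infinite_finite_induct) (auto intro: J)
  let ?q = "\<Sum>M\<in>keys p. q M"
  have "?q \<in> M.lifts" using q by (intro subr_sum[OF M.lifts_subr]) auto
  moreover have "boxed ?q"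
    unfolding boxed_def
  proof
    fix N assume "N \<in> keys ?q"
    hence "(\<Sum>K\<in>keys p. lookup (q K) N) \<noteq> 0" by (simp add: in_keys_iff lookup_sum)
    then obtain K where "K \<in> keys p" "lookup (q K) N \<noteq> 0" by (rule sum.not_neutral_contains_not_neutral)
    thus "N \<in> box n" using q[of K] by (auto simp: boxed_def in_keys_iff)
  qed
  moreover have "p - ?q \<in> J"
  proof -
    have "p - ?q = (\<Sum>M\<in>keys p. single M (lookup p M) - q M)"
      using poly_mapping_sum_single[of p] by (simp add: sum_subtractf)
    also have "\<dots> \<in> J" using q by (intro Js) auto
    finally show ?thesis .
  qed
  ultimately show ?thesis using that by blast
qed

end

lemma power_single: "single {#l#} 1 ^ j = single (replicate_mset j l) (1 :: 'r::comm_ring_1)"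
  by (induction j) (simp_all add: mult_single)

lemma prod_single: "(\<Prod>l\<in>X. single (N l) 1) = single (\<Sum>l\<in>X. N l) (1 :: 'r::comm_ring_1)"
  for N :: "'i \<Rightarrow> 'j multiset"
  by (induction X rule: infinite_finite_induct) (simp_all add: mult_single)

context graded_chain
begin

definition index_monomial :: "nat \<Rightarrow> (nat \<Rightarrow> nat) \<Rightarrow> nat \<Rightarrow> nat multiset" where
  "index_monomial i j k = (\<Sum>l\<in>{1..<i}. replicate_mset (j l) l) + replicate_mset k i"

lemma count_index_monomial: "count (index_monomial i j k) x = (if x \<in> {1..<i} then j x else 0) + (if x = i then k else 0)"
proof -
  have "(\<Sum>l\<in>{1..<i}. count (replicate_mset (j l) l) x) = (\<Sum>l\<in>{1..<i}. if l = x then j x else 0)"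
    by (intro sum.cong) auto
  also have "\<dots> = (if x \<in> {1..<i} then j x else 0)" by (rule sum.delta) simp
  finally show ?thesis by (simp add: index_monomial_def count_sum)
qed

lemma index_monomial_inj: "inj_on (\<lambda>(j, k). index_monomial i j k) (relation_indices m i)"
proof (rule inj_onI, clarify)
  fix j k j' k' assume J: "(j, k) \<in> relation_indices m i" "(j', k') \<in> relation_indices m i" and eq: "index_monomial i j k = index_monomial i j' k'"
  have c: "count (index_monomial i j k) x = count (index_monomial i j' k') x" for x using eq by simp
  have "k = k'" using c[of i] by (simp add: count_index_monomial)
  moreover have "j = j'"
  proof (rule PiE_ext[of _ "{1..<i}" "\<lambda>l. {..<m l}"])
    show "j \<in> (\<Pi>\<^sub>E l\<in>{1..<i}. {..<m l})" "j' \<in> (\<Pi>\<^sub>E l\<in>{1..<i}. {..<m l})" using J by (auto simp: relation_indices_def)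
    fix x assume "x \<in> {1..<i}" thus "j x = j' x" using c[of x] by (simp add: count_index_monomial)
  qed
  ultimately show "j = j' \<and> k = k'" by simp
qed

lemma index_monomial_box:
  assumes i: "i \<in> {1..<n}" and jk: "(j, k) \<in> relation_indices m i"
  shows "index_monomial i j k \<in> box (Suc i)"
proof -
  have jl: "j l < m l" if "l \<in> {1..<i}" for l using jk that by (auto simp: relation_indices_def PiE_iff)
  have k: "k < m i" using jk by (auto simp: relation_indices_def)
  have "set_mset (index_monomial i j k) \<subseteq> {1..<Suc i}"
  proof
    fix x assume "x \<in># index_monomial i j k"
    hence "count (index_monomial i j k) x \<noteq> 0" by simp
    thus "x \<in> {1..<Suc i}" using i unfolding count_index_monomial by (auto split: if_splits)
  qed
  moreover have "count (index_monomial i j k) l < m l" if "l \<in> {1..<Suc i}" for l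
    using that jl[of l] k by (cases "l = i") (auto simp: count_index_monomial)
  ultimately show ?thesis by (simp add: box_def)
qed

lemma index_monomial_image:
  assumes i: "i \<in> {1..<n}"
  shows "(\<lambda>(j, k). index_monomial i j k) ` relation_indices m i = box (Suc i)"
proof (rule antisym; rule subsetI)
  fix M assume M: "M \<in> box (Suc i)"
  define j where "j = (\<lambda>l\<in>{1..<i}. count M l)"
  have cM: "count M l < m l" if "l \<in> {1..<Suc i}" for l using M that by (simp add: box_def)
  have "(j, count M i) \<in> relation_indices m i"
    using cM i by (auto simp: relation_indices_def j_def)
  moreover have "index_monomial i j (count M i) = M"
  proof (rule multiset_eqI)
    fix x
    have "count M x = 0" if "x \<notin> {1..<Suc i}" using M that by (auto simp: box_def count_eq_zero_iff)
    thus "count (index_monomial i j (count M i)) x = count M x" using i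
      by (auto simp: count_index_monomial j_def)
  qed
  ultimately show "M \<in> (\<lambda>(j, k). index_monomial i j k) ` relation_indices m i" by force
qed (use index_monomial_box[OF i] in auto)

definition "rel_class i j k = S.\<rho> (rel_term i (index_monomial i j k))"

lemma H_lifted_rel:
  assumes i: "i \<in> {1..<n}"
  shows "M.H (lifted_rel i) = relation gS n m rel_class i"
proof -
  interpret P: cring P by (rule M.mpoly_cring)
  let ?X = "\<lambda>l. single {#l#} (1 :: 'g \<Rightarrow>\<^sub>0 'k)"
  have one: "1 \<in> S.Rees" by (rule subrD(1)[OF S.Rees_subr])
  have XM: "?X l \<in> M.lifts" if "l \<in> {1..<n}" for l using that one by (intro M.single_lifts) auto
  have XpM: "?X l ^ j \<in> M.lifts" if "l \<in> {1..<n}" for l j using subrD(7)[OF M.lifts_subr XM[OF that]] .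
  have term_eq: "M.H (single (index_monomial i j k) (rel_term i (index_monomial i j k))) =
      mpoly_const gS (rel_class i j k) \<otimes>\<^bsub>P\<^esub> (\<Otimes>\<^bsub>P\<^esub>l\<in>{1..<i}. mpoly_var gS l [^]\<^bsub>P\<^esub> j l) \<otimes>\<^bsub>P\<^esub> mpoly_var gS i [^]\<^bsub>P\<^esub> k"
    if jk: "(j, k) \<in> relation_indices m i" for j k
  proof -
    let ?c = "rel_term i (index_monomial i j k)"
    have cR: "?c \<in> S.Rees" by (rule rel_term_Rees[OF i index_monomial_box[OF i jk]])
    have cM: "single {#} ?c \<in> M.lifts" using cR by (intro M.single_lifts) auto
    have sub: "l \<in> {1..<n}" if "l \<in> {1..<i}" for l using that i by auto
    have pr: "M.H (\<Prod>l\<in>{1..<i}. ?X l ^ j l) = (\<Otimes>\<^bsub>P\<^esub>l\<in>{1..<i}. M.H (?X l ^ j l)) \<and> (\<Prod>l\<in>{1..<i}. ?X l ^ j l) \<in> M.lifts"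
      by (rule M.H_prod) (use XpM sub in auto)
    have "single (index_monomial i j k) ?c = single {#} ?c * (\<Prod>l\<in>{1..<i}. ?X l ^ j l) * ?X i ^ k"
      by (simp add: power_single prod_single mult_single index_monomial_def)
    hence "M.H (single (index_monomial i j k) ?c) =
        M.H (single {#} ?c) \<otimes>\<^bsub>P\<^esub> M.H (\<Prod>l\<in>{1..<i}. ?X l ^ j l) \<otimes>\<^bsub>P\<^esub> M.H (?X i ^ k)"
      using cM pr XpM[OF i] subrD(4)[OF M.lifts_subr] by (simp add: M.H_simps)
    also have "(\<Otimes>\<^bsub>P\<^esub>l\<in>{1..<i}. M.H (?X l ^ j l)) = (\<Otimes>\<^bsub>P\<^esub>l\<in>{1..<i}. mpoly_var gS l [^]\<^bsub>P\<^esub> j l)"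
      using sub XM by (intro P.finprod_cong') (auto simp: M.H_power M.H_var[symmetric] M.H_simps)
    hence "M.H (\<Prod>l\<in>{1..<i}. ?X l ^ j l) = (\<Otimes>\<^bsub>P\<^esub>l\<in>{1..<i}. mpoly_var gS l [^]\<^bsub>P\<^esub> j l)" using pr by simp
    also have "M.H (?X i ^ k) = mpoly_var gS i [^]\<^bsub>P\<^esub> k" using M.H_power[OF XM[OF i]] by (simp add: M.H_var)
    also have "M.H (single {#} ?c) = mpoly_const gS (rel_class i j k)" by (simp add: M.H_const rel_class_def)
    finally show ?thesis .
  qed
  have tM: "single M (rel_term i M) \<in> M.lifts" if "M \<in> box (Suc i)" for M
    using that i by (intro M.single_lifts rel_term_Rees box_sub)
  have fin: "finite (box (Suc i))" using i by (intro box_finite) auto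
  have sum: "M.H (\<Sum>M\<in>box (Suc i). single M (rel_term i M)) = (\<Oplus>\<^bsub>P\<^esub>M\<in>box (Suc i). M.H (single M (rel_term i M)))"
    by (rule M.H_sum[OF fin tM])
  have sM: "(\<Sum>M\<in>box (Suc i). single M (rel_term i M)) \<in> M.lifts" by (intro subr_sum[OF M.lifts_subr] tM)
  have "(\<Oplus>\<^bsub>P\<^esub>M\<in>box (Suc i). M.H (single M (rel_term i M))) =
      (\<Oplus>\<^bsub>P\<^esub>x\<in>relation_indices m i. M.H (single ((\<lambda>(j, k). index_monomial i j k) x) (rel_term i ((\<lambda>(j, k). index_monomial i j k) x))))"
    unfolding index_monomial_image[OF i, symmetric]
    by (rule P.finsum_reindex[OF _ index_monomial_inj]) (use index_monomial_box[OF i] tM M.H_simps(1) in auto)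
  also have "\<dots> = finsum P (\<lambda>(j, k). mpoly_const gS (rel_class i j k) \<otimes>\<^bsub>P\<^esub>
      (\<Otimes>\<^bsub>P\<^esub>l\<in>{1..<i}. mpoly_var gS l [^]\<^bsub>P\<^esub> j l) \<otimes>\<^bsub>P\<^esub> mpoly_var gS i [^]\<^bsub>P\<^esub> k) (relation_indices m i)"
  proof (rule P.finsum_cong'[OF refl])
    show "(\<lambda>(j, k). mpoly_const gS (rel_class i j k) \<otimes>\<^bsub>P\<^esub> (\<Otimes>\<^bsub>P\<^esub>l\<in>{1..<i}. mpoly_var gS l [^]\<^bsub>P\<^esub> j l) \<otimes>\<^bsub>P\<^esub>
        mpoly_var gS i [^]\<^bsub>P\<^esub> k) \<in> relation_indices m i \<rightarrow> carrier P"
    proof (rule funcsetI, clarify)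
      fix j k assume jk: "(j, k) \<in> relation_indices m i"
      show "mpoly_const gS (rel_class i j k) \<otimes>\<^bsub>P\<^esub> (\<Otimes>\<^bsub>P\<^esub>l\<in>{1..<i}. mpoly_var gS l [^]\<^bsub>P\<^esub> j l) \<otimes>\<^bsub>P\<^esub>
        mpoly_var gS i [^]\<^bsub>P\<^esub> k \<in> carrier P"
        unfolding term_eq[OF jk, symmetric] using tM[OF index_monomial_box[OF i jk]] by (rule M.H_simps(1))
    qed
  qed (use term_eq in auto)
  finally have s: "M.H (\<Sum>M\<in>box (Suc i). single M (rel_term i M)) = \<dots>" using sum by simp
  have "M.H (lifted_rel i) = M.H (?X i ^ m i) \<oplus>\<^bsub>P\<^esub> M.H (\<Sum>M\<in>box (Suc i). single M (rel_term i M))"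
    using M.H_simps(2)[OF XpM[OF i, of "m i"] sM] by (simp add: lifted_rel_def top_monomial_def power_single)
  also have "M.H (?X i ^ m i) = mpoly_var gS i [^]\<^bsub>P\<^esub> m i" using M.H_power[OF XM[OF i]] by (simp add: M.H_var)
  finally show ?thesis unfolding s relation_def Let_def .
qed

lemma gr_map_\<rho>:
  assumes s: "s \<in> S.Rees"
  shows "gr_map cring_class_ops v0 (quot_field f) v (quot_subring A f) (\<lambda>b. cls f [:b:]) (S.\<rho> s) = T.\<rho> (lift s)"
proof
  fix \<gamma>
  let ?s = "lookup s \<gamma>"
  have sA: "?s \<in> A" "Fin \<gamma> \<le> v0 ?s" using S.ReesD[OF s] by auto
  have so: "[:?s:] \<in> polys_over A" by (rule const_over[OF sA(1)])
  have "P_gt v (quot_subring A f) \<gamma> <+>\<^bsub>quot_field f\<^esub> ((\<lambda>b. cls f [:b:]) ` S.residue_coset \<gamma> ?s) = T.residue_coset \<gamma> [:?s:]"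
    unfolding set_add_def' T.P_gt_eq S.residue_coset_eq[OF sA(1)] T.residue_coset_eq[OF so] \<omega>_S \<omega>_T
  proof (rule antisym; rule subsetI)
    fix x assume "x \<in> (\<Union>h\<in>cls f ` {h \<in> polys_over A. Fin \<gamma> < u h}.
      \<Union>k\<in>(\<lambda>b. cls f [:b:]) ` (\<lambda>a. a) ` {t \<in> A. Fin \<gamma> < v0 (t - ?s)}. {h \<oplus>\<^bsub>quot_field f\<^esub> k})"
    then obtain h t where ht: "h \<in> polys_over A" "Fin \<gamma> < u h" "t \<in> A" "Fin \<gamma> < v0 (t - ?s)"
      "x = cls f (h + [:t:])" by (auto simp: quot_field_ops)
    have "Fin \<gamma> < T.\<omega> (h + [:t - ?s:])"
      using ht u_const[of "t - ?s"] by (intro T.\<omega>_gt_add) simp_all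
    moreover have "h + [:t:] - [:?s:] = h + [:t - ?s:]" by simp
    ultimately have "Fin \<gamma> < u (h + [:t:] - [:?s:])" by (simp only: \<omega>_T)
    moreover have "h + [:t:] \<in> polys_over A" using ht by (intro over_closed const_over)
    ultimately show "x \<in> cls f ` {g \<in> polys_over A. Fin \<gamma> < u (g - [:?s:])}" using ht(5) by blast
  next
    fix x assume "x \<in> cls f ` {g \<in> polys_over A. Fin \<gamma> < u (g - [:?s:])}"
    then obtain g where g: "g \<in> polys_over A" "Fin \<gamma> < u (g - [:?s:])" "x = cls f g" by blast
    have "x = cls f (g - [:?s:]) \<oplus>\<^bsub>quot_field f\<^esub> cls f [:?s:]" using g by (simp add: quot_field_ops)
    moreover have "g - [:?s:] \<in> polys_over A" using g so by (intro over_closed)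
    moreover have "Fin \<gamma> < v0 (?s - ?s)" using u_const[of 0] by simp
    ultimately show "x \<in> (\<Union>h\<in>cls f ` {h \<in> polys_over A. Fin \<gamma> < u h}.
      \<Union>k\<in>(\<lambda>b. cls f [:b:]) ` (\<lambda>a. a) ` {t \<in> A. Fin \<gamma> < v0 (t - ?s)}. {h \<oplus>\<^bsub>quot_field f\<^esub> k})"
      using g(2) sA(1) by blast
  qed
  moreover have "P_gt v (quot_subring A f) \<gamma> = T.residue_coset \<gamma> [:?s:]" if "\<gamma> \<notin> value_group cring_class_ops v0"
  proof -
    have "v0 ?s \<noteq> Fin \<gamma>"
    proof
      assume "v0 ?s = Fin \<gamma>"
      hence "Fin \<gamma> \<in> range v0" by (metis rangeI)
      thus False using that by (simp add: value_group_def cring_class_ops_def)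
    qed
    hence "Fin \<gamma> < T.\<omega> [:?s:]" using sA(2) by (simp add: u_const)
    hence "T.residue_coset \<gamma> [:?s:] = P_gt v (quot_subring A f) \<gamma>" unfolding T.residue_coset_eq_0_iff[OF so] .
    thus ?thesis by (rule sym)
  qed
  ultimately show "gr_map cring_class_ops v0 (quot_field f) v (quot_subring A f) (\<lambda>b. cls f [:b:]) (S.\<rho> s) \<gamma> = T.\<rho> (lift s) \<gamma>"
    by (simp add: gr_map_def T.\<rho>_def S.\<rho>_def)
qed

text \<open>
  The kernel is generated by the relations: modulo these, an element of the kernel is congruent to a
  combination of basis monomials, which is in the kernel as well and therefore zero.
\<close>

theorem graded_structure:
  "\<exists>\<Phi>. \<Phi> \<in> ring_hom P gT \<and>
    (\<forall>a\<in>carrier gS. \<Phi> (mpoly_const gS a) =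
       gr_map cring_class_ops v0 (quot_field f) v (quot_subring A f) (\<lambda>b. cls f [:b:]) a) \<and>
    (\<forall>i\<in>{1..<n}. \<Phi> (mpoly_var gS i) = initial_form (quot_field f) v (quot_subring A f) (cls f (\<phi> i))) \<and>
    (\<forall>\<delta>. \<Phi> ` PH \<delta> = gr_homog (quot_field f) v (quot_subring A f) \<delta>) \<and>
    \<Phi> ` carrier P = carrier gT \<and>
    a_kernel P gT \<Phi> = Idl\<^bsub>P\<^esub> (relation gS n m rel_class ` {1..<n})"
proof -
  interpret P: cring P by (rule M.mpoly_cring)
  interpret T': cring gT by (rule T.gr_cring)
  have H_onto: "M.H ` carrier (cring_class_ops \<lparr>carrier := M.lifts\<rparr>) = carrier P" by (simp add: M.H_image)
  obtain \<Phi> where \<Phi>: "\<Phi> \<in> ring_hom P gT" "\<And>x. x \<in> carrier (cring_class_ops \<lparr>carrier := M.lifts\<rparr>) \<Longrightarrow> \<Phi> (M.H x) = eval_class x"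
    by (rule induced_hom[OF M.lifts_cring P.ring_axioms T'.ring_axioms M.H_hom H_onto eval_class_hom]) (auto intro: H_zero_imp)
  have \<Phi>H: "\<Phi> (M.H p) = eval_class p" if "p \<in> M.lifts" for p using \<Phi>(2) that by simp
  have one: "1 \<in> S.Rees" by (rule subrD(1)[OF S.Rees_subr])
  interpret \<Phi>: ring_hom_ring P gT \<Phi> by (rule ring_hom_ringI2[OF P.ring_axioms T'.ring_axioms \<Phi>(1)])
  show ?thesis
  proof (intro exI[of _ \<Phi>] conjI ballI allI)
    show "\<Phi> \<in> ring_hom P gT" by fact
  next
    fix a assume "a \<in> carrier gS"
    then obtain s where s: "s \<in> S.Rees" "a = S.\<rho> s" using S.\<rho>_image by blast
    have "\<Phi> (mpoly_const gS a) = eval_class (single {#} s)"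
      unfolding s(2) M.H_const[symmetric] using s(1) by (intro \<Phi>H M.single_lifts) auto
    also have "\<dots> = T.\<rho> (lift s)" by (simp add: eval_class_def E.E_single)
    finally show "\<Phi> (mpoly_const gS a) = gr_map cring_class_ops v0 (quot_field f) v (quot_subring A f) (\<lambda>b. cls f [:b:]) a"
      by (simp add: s gr_map_\<rho>)
  next
    fix i assume i: "i \<in> {1..<n}"
    have "\<Phi> (mpoly_var gS i) = eval_class (single {#i#} 1)"
      unfolding M.H_var[symmetric] using one i by (intro \<Phi>H M.single_lifts) auto
    also have "\<dots> = T.\<rho> (single (\<mu> i) (\<phi> i))" by (simp add: eval_class_def E.E_single E.l_one)
    also have "\<dots> = initial_form (quot_field f) v (quot_subring A f) (cls f (\<phi> i))"
      using i u_\<phi>[OF i] by (intro T.initial_form_eq[symmetric] \<phi>_over) auto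
    finally show "\<Phi> (mpoly_var gS i) = initial_form (quot_field f) v (quot_subring A f) (cls f (\<phi> i))" .
  next
    fix \<delta>
    show "\<Phi> ` PH \<delta> = gr_homog (quot_field f) v (quot_subring A f) \<delta>"
    proof (rule antisym; rule subsetI)
      fix y assume "y \<in> \<Phi> ` PH \<delta>"
      then obtain x where x: "x \<in> PH \<delta>" "y = \<Phi> x" by blast
      then obtain p where p: "p \<in> homog_lifts \<delta>" "x = M.H p" using homog_lifts_onto by blast
      thus "y \<in> gr_homog (quot_field f) v (quot_subring A f) \<delta>" using x \<Phi>H[of p] homog_lifts_eval_class[OF p(1)] by (simp add: homog_lifts_def)
    next
      fix y assume "y \<in> gr_homog (quot_field f) v (quot_subring A f) \<delta>"
      then obtain g where g: "g \<in> polys_over A" "Fin \<delta> \<le> T.\<omega> g" "y = T.\<rho> (single \<delta> g)"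
        by (rule T.gr_homogE)
      have "Fin \<delta> \<le> u g" using g(2) by simp
      then obtain p where p: "p \<in> homog_lifts \<delta>" "boxed p" "eval_class p = T.\<rho> (single \<delta> g)" by (rule \<rho>_lift[OF g(1)])
      have "\<Phi> (M.H p) = y" using p g \<Phi>H[of p] by (simp add: homog_lifts_def)
      thus "y \<in> \<Phi> ` PH \<delta>" using homog_lifts_homog[OF p(1)] by blast
    qed
  next
    have "\<Phi> ` carrier P = \<Phi> ` M.H ` M.lifts" by (simp only: M.H_image)
    also have "\<dots> = eval_class ` M.lifts" unfolding image_image by (rule image_cong[OF refl \<Phi>H])
    finally show "\<Phi> ` carrier P = carrier gT" by (simp only: eval_class_onto)
  next
    let ?I = "Idl\<^bsub>P\<^esub> (relation gS n m rel_class ` {1..<n})"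
    have rels: "relation gS n m rel_class ` {1..<n} = (\<lambda>i. M.H (lifted_rel i)) ` {1..<n}"
      by (intro image_cong refl) (simp add: H_lifted_rel)
    have car: "relation gS n m rel_class ` {1..<n} \<subseteq> carrier P"
      unfolding rels using M.H_simps(1)[OF lifted_rel_lifts] by auto
    interpret I: ideal ?I P by (rule P.genideal_ideal[OF car])
    have ker: "x \<in> a_kernel P gT \<Phi> \<longleftrightarrow> x \<in> carrier P \<and> \<Phi> x = \<zero>\<^bsub>gT\<^esub>" for x
      by (simp only: a_kernel_def' mem_Collect_eq)
    have sub: "?I \<subseteq> a_kernel P gT \<Phi>"
    proof (rule P.genideal_minimal[OF \<Phi>.kernel_is_ideal], rule subsetI)
      fix x assume "x \<in> relation gS n m rel_class ` {1..<n}"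
      then obtain i where i: "i \<in> {1..<n}" "x = M.H (lifted_rel i)" unfolding rels by blast
      have "\<Phi> x = \<zero>\<^bsub>gT\<^esub>" unfolding i(2) \<Phi>H[OF lifted_rel_lifts[OF i(1)]] by (rule eval_class_lifted_rel[OF i(1)])
      moreover have "x \<in> carrier P" unfolding i(2) by (rule M.H_simps(1)[OF lifted_rel_lifts[OF i(1)]])
      ultimately show "x \<in> a_kernel P gT \<Phi>" unfolding ker by blast
    qed
    show "a_kernel P gT \<Phi> = ?I"
    proof (rule antisym)
      show "?I \<subseteq> a_kernel P gT \<Phi>" by (rule sub)
      show "a_kernel P gT \<Phi> \<subseteq> ?I"
      proof
        fix x assume "x \<in> a_kernel P gT \<Phi>"
        hence x: "x \<in> carrier P" "\<Phi> x = \<zero>\<^bsub>gT\<^esub>" unfolding ker by blast+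
        from x(1) obtain p where p: "p \<in> M.lifts" "x = M.H p" unfolding M.H_image[symmetric] by blast
        define J where "J = {p \<in> M.lifts. M.H p \<in> ?I}"
        have Jadd: "p + q \<in> J" if "p \<in> J" "q \<in> J" for p q
          using that subrD(5)[OF M.lifts_subr] I.a_closed by (simp add: J_def M.H_simps)
        have Jmult: "p * q \<in> J" if "p \<in> M.lifts" "q \<in> J" for p q
          using that subrD(4)[OF M.lifts_subr] I.I_l_closed by (simp add: J_def M.H_simps)
        have J0: "0 \<in> J" using subrD(2)[OF M.lifts_subr] I.zero_closed by (simp add: J_def M.H_zero)
        have Jrel: "lifted_rel i \<in> J" if "i \<in> {1..<n}" for i
          using lifted_rel_lifts[OF that] subsetD[OF P.genideal_self[OF car], of "relation gS n m rel_class i"] that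
          by (simp add: J_def H_lifted_rel[OF that])
        obtain q where q: "q \<in> M.lifts" "boxed q" "p - q \<in> J"
          by (rule reduce[of J, OF Jadd Jmult J0 Jrel p(1)])
        have pq: "p - q \<in> M.lifts" "M.H (p - q) \<in> ?I" using q(3) by (auto simp: J_def)
        have "\<Phi> (M.H (p - q)) = \<zero>\<^bsub>gT\<^esub>" using subsetD[OF sub pq(2)] unfolding ker by blast
        hence "eval_class (p - q) = \<zero>\<^bsub>gT\<^esub>" using \<Phi>H[OF pq(1)] by simp
        moreover have "eval_class p = \<zero>\<^bsub>gT\<^esub>" using x p \<Phi>H by simp
        moreover have "eval_class p = eval_class (p - q) \<oplus>\<^bsub>gT\<^esub> eval_class q" using eval_class_add[OF pq(1) q(1)] by simp
        moreover have "eval_class q \<in> carrier gT" using eval_class_onto q(1) by blast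
        ultimately have "eval_class q = \<zero>\<^bsub>gT\<^esub>" by simp
        hence "M.H q = \<zero>\<^bsub>P\<^esub>" by (rule eval_class_boxed[OF q(1,2)])
        moreover have "M.H p = M.H (p - q) \<oplus>\<^bsub>P\<^esub> M.H q" using M.H_simps(2)[OF pq(1) q(1)] by simp
        ultimately show "x \<in> ?I" using p(2) pq(2) M.H_simps(1)[OF pq(1)] by simp
      qed
    qed
  qed
qed

end

section \<open>Local rings\<close>

lemma (in cring) maximal_ideal_exists:
  assumes I: "ideal I R" "\<one> \<notin> I"
  obtains M where "maximalideal M R" "I \<subseteq> M"
proof -
  let ?A = "{J. ideal J R \<and> I \<subseteq> J \<and> \<one> \<notin> J}"
  have "\<exists>M\<in>?A. \<forall>X\<in>?A. M \<subseteq> X \<longrightarrow> X = M"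
  proof (rule subset_Zorn_nonempty)
    show "?A \<noteq> {}" using I by blast
    fix C assume C: "C \<noteq> {}" "subset.chain ?A C"
    have sub: "C \<subseteq> ?A" and tot: "\<And>X Y. X \<in> C \<Longrightarrow> Y \<in> C \<Longrightarrow> X \<subseteq> Y \<or> Y \<subseteq> X"
      using C(2) unfolding subset.chain_def by blast+
    have id: "ideal X R" if "X \<in> C" for X using sub that by blast
    obtain X0 where X0: "X0 \<in> C" using C(1) by blast
    have "ideal (\<Union>C) R"
    proof (rule idealI[OF ring_axioms add.subgroupI])
      show "\<Union>C \<subseteq> carrier R" using ideal.Icarr[OF id] by blast
      show "\<Union>C \<noteq> {}" using X0 additive_subgroup.zero_closed[OF ideal.axioms(1)[OF id[OF X0]]] by blast
      fix a assume "a \<in> \<Union>C"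
      then obtain X where X: "X \<in> C" "a \<in> X" by blast
      show "\<ominus> a \<in> \<Union>C"
        using X additive_subgroup.a_inv_closed[OF ideal.axioms(1)[OF id[OF X(1)]]] by blast
      { fix x assume "x \<in> carrier R"
        thus "x \<otimes> a \<in> \<Union>C" using X ideal.I_l_closed[OF id[OF X(1)]] by blast }
      { fix x assume "x \<in> carrier R"
        thus "a \<otimes> x \<in> \<Union>C" using X ideal.I_r_closed[OF id[OF X(1)]] by blast }
      fix b assume "b \<in> \<Union>C"
      then obtain Y where Y: "Y \<in> C" "b \<in> Y" by blast
      obtain Z where Z: "Z \<in> C" "a \<in> Z" "b \<in> Z" using tot X Y by blast
      thus "a \<oplus> b \<in> \<Union>C" using additive_subgroup.a_closed[OF ideal.axioms(1)[OF id[OF Z(1)]]] by blast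
    qed
    thus "\<Union>C \<in> ?A" using C(1) sub by blast
  qed
  then obtain M where MA: "M \<in> ?A" and Mmax: "\<forall>X\<in>?A. M \<subseteq> X \<longrightarrow> X = M" by (rule bexE)
  from MA have M: "ideal M R" "I \<subseteq> M" "\<one> \<notin> M" by simp_all
  have max: "X = M" if "ideal X R" "I \<subseteq> X" "\<one> \<notin> X" "M \<subseteq> X" for X
    using Mmax[rule_format, of X] that by simp
  have "maximalideal M R"
  proof (rule maximalidealI[OF M(1)])
    show "carrier R \<noteq> M" using M(3) by blast
    fix J assume J: "ideal J R" "M \<subseteq> J" "J \<subseteq> carrier R"
    show "J = M \<or> J = carrier R"
      using ideal.one_imp_carrier[OF J(1)] max[OF J(1) subset_trans[OF M(2) J(2)] _ J(2)]
      by (cases "\<one> \<in> J") simp_all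
  qed
  thus ?thesis using that M(2) by blast
qed

lemma local_domain_unit:
  fixes A :: "'k::field set"
  assumes loc: "local_domain_of A" and a: "a \<in> A" "a \<notin> max_ideal (cring_class_ops\<lparr>carrier := A\<rparr>)"
  shows "a \<noteq> 0" "inverse a \<in> A"
proof -
  let ?R = "cring_class_ops\<lparr>carrier := A\<rparr> :: 'k ring"
  have cr: "cring ?R" and ex: "\<exists>!M. maximalideal M ?R" using loc by (auto simp: local_domain_of_def local_ring_def)
  interpret R: cring ?R by (rule cr)
  have M: "maximalideal (max_ideal ?R) ?R" unfolding max_ideal_def by (rule theI'[OF ex])
  have aR: "a \<in> carrier ?R" using a by simp
  have "\<one>\<^bsub>?R\<^esub> \<in> PIdl\<^bsub>?R\<^esub> a"
  proof (rule ccontr)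
    assume "\<one>\<^bsub>?R\<^esub> \<notin> PIdl\<^bsub>?R\<^esub> a"
    then obtain M' where M': "maximalideal M' ?R" "PIdl\<^bsub>?R\<^esub> a \<subseteq> M'"
      using R.maximal_ideal_exists[OF R.cgenideal_ideal[OF aR]] by blast
    have "M' = max_ideal ?R" using ex M M'(1) by blast
    thus False using a(2) M'(2) R.cgenideal_self[OF aR] by blast
  qed
  then obtain x where x: "x \<in> A" "1 = x * a" by (auto simp: cgenideal_def cring_class_ops_def)
  show a0: "a \<noteq> 0" using x by auto
  have "inverse a = x" using x(2) a0 by (simp add: field_simps)
  thus "inverse a \<in> A" using x(1) by simp
qed

text \<open>
  In the residue field the image of \<open>d\<close> is \<open>d\<close> times \<open>1\<close>, and the characteristic is the additive
  order of \<open>1\<close>.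
\<close>

lemma of_nat_not_max_ideal:
  fixes A :: "'k::field set"
  assumes loc: "local_domain_of A"
    and d: "\<not> ring_characteristic (residue_field (cring_class_ops\<lparr>carrier := A\<rparr> :: 'k ring)) dvd d"
  shows "(of_nat d :: 'k) \<notin> max_ideal (cring_class_ops\<lparr>carrier := A\<rparr>)"
proof
  let ?R = "cring_class_ops\<lparr>carrier := A\<rparr> :: 'k ring"
  let ?M = "max_ideal ?R"
  assume dM: "(of_nat d :: 'k) \<in> ?M"
  have cr: "cring ?R" and ex: "\<exists>!M. maximalideal M ?R" using loc by (auto simp: local_domain_of_def local_ring_def)
  interpret R: cring ?R by (rule cr)
  have M: "maximalideal ?M ?R" unfolding max_ideal_def by (rule theI'[OF ex])
  interpret M: ideal ?M ?R using M by (simp add: maximalideal_def)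
  let ?Q = "?R Quot ?M"
  interpret Q: cring ?Q by (rule M.quotient_is_cring[OF cr])
  have hom: "(+>\<^bsub>?R\<^esub>) ?M \<in> ring_hom ?R ?Q" by (rule M.rcos_ring_hom)
  have A: "(of_nat k :: 'k) \<in> A" for k
  proof (induction k)
    case 0
    show ?case using R.zero_closed by (simp add: cring_class_ops_def)
  next
    case (Suc k)
    thus ?case using R.a_closed[of 1 "of_nat k"] R.one_closed by (simp add: cring_class_ops_def)
  qed
  have pow: "\<one>\<^bsub>?Q\<^esub> [^]\<^bsub>add_monoid ?Q\<^esub> k = ?M +>\<^bsub>?R\<^esub> of_nat k" for k
  proof (induction k)
    case 0
    have "?M +>\<^bsub>?R\<^esub> \<zero>\<^bsub>?R\<^esub> = \<zero>\<^bsub>?Q\<^esub>" using ring_hom_zero[OF hom R.ring_axioms Q.ring_axioms] .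
    thus ?case by (simp add: cring_class_ops_def)
  next
    case (Suc k)
    have "?M +>\<^bsub>?R\<^esub> (of_nat k \<oplus>\<^bsub>?R\<^esub> \<one>\<^bsub>?R\<^esub>) = (?M +>\<^bsub>?R\<^esub> of_nat k) \<oplus>\<^bsub>?Q\<^esub> (?M +>\<^bsub>?R\<^esub> \<one>\<^bsub>?R\<^esub>)"
      using A R.one_closed by (intro ring_hom_add[OF hom]) simp_all
    also have "?M +>\<^bsub>?R\<^esub> \<one>\<^bsub>?R\<^esub> = \<one>\<^bsub>?Q\<^esub>" by (rule ring_hom_one[OF hom])
    also have "of_nat k \<oplus>\<^bsub>?R\<^esub> \<one>\<^bsub>?R\<^esub> = of_nat (Suc k)" by (simp add: cring_class_ops_def)
    finally show ?case using Suc by simp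
  qed
  have "?M +>\<^bsub>?R\<^esub> of_nat d = ?M" by (rule M.a_rcos_const[OF dM])
  hence "\<one>\<^bsub>?Q\<^esub> [^]\<^bsub>add_monoid ?Q\<^esub> d = \<one>\<^bsub>add_monoid ?Q\<^esub>" by (simp only: pow) (simp add: FactRing_def)
  hence "group.ord (add_monoid ?Q) \<one>\<^bsub>?Q\<^esub> dvd d"
    using group.pow_eq_id[OF Q.a_group, of "\<one>\<^bsub>?Q\<^esub>" d] Q.one_closed by simp
  thus False using d by (simp add: ring_characteristic_def residue_field_def)
qed

text \<open>
  If \<open>e k = d\<close>, the values of \<open>e\<close> and \<open>k\<close> are nonnegative with sum \<open>0\<close>, so \<open>e\<close> is outside the maximal ideal
  as well as \<open>d\<close>.
\<close>

lemma degree_divisor_unit: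
  fixes A :: "'k::field set"
  assumes loc: "local_domain_of A" and val: "valuation cring_class_ops v0" and dom: "dominates cring_class_ops v0 A"
    and char: "\<not> ring_characteristic (residue_field (cring_class_ops\<lparr>carrier := A\<rparr> :: 'k ring)) dvd d"
    and e: "e dvd d"
  shows "(of_nat e :: 'k) \<noteq> 0 \<and> inverse (of_nat e) \<in> A"
proof -
  have sub: "subring A (cring_class_ops :: 'k ring)" using loc by (simp add: local_domain_of_def)
  have A: "(of_nat k :: 'k) \<in> A" for k
    using subringE(2,3,7)[OF sub] by (induction k) (auto simp: cring_class_ops_def)
  have ge: "0 \<le> v0 a" if "a \<in> A" for a using dom that by (auto simp: dominates_def)
  have max: "max_ideal (cring_class_ops\<lparr>carrier := A\<rparr>) = {x. 0 < v0 x} \<inter> A"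
    using dom by (simp add: dominates_def cring_class_ops_def)
  obtain k where k: "d = e * k" using e by auto
  have "v0 (of_nat d) = v0 (of_nat e) + v0 (of_nat k)" using val by (simp add: k valuation_def cring_class_ops_def)
  moreover have "v0 (of_nat d) = 0"
    using of_nat_not_max_ideal[OF loc char] ge[OF A, of d] A[of d] by (auto simp: max le_less)
  ultimately have "v0 (of_nat e) = 0"
    using ge[OF A, of e] ge[OF A, of k]
    by (cases "v0 (of_nat e)"; cases "v0 (of_nat k)") (auto simp: zero_ext_value_def add_nonneg_eq_0_iff)
  hence "(of_nat e :: 'k) \<notin> max_ideal (cring_class_ops\<lparr>carrier := A\<rparr>)" by (simp add: max)
  thus ?thesis using local_domain_unit[OF loc A] by blast
qed

section \<open>The graded ring of \<open>A[x]/(f)\<close>\<close>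

theorem mainTheorem2:
  fixes A :: "'k::field set"
    and v0 :: "'k \<Rightarrow> 'g::linordered_ab_group_add ext_value"
    and f :: "'k poly"
    and v :: "'k poly set \<Rightarrow> 'g ext_value"
  assumes "local_domain_of A"
    and "valuation cring_class_ops v0"
    and "dominates cring_class_ops v0 A"
    and "f \<in> polys_over A" and "Polynomial.lead_coeff f = 1" and "irreducible f"
    and "\<not> ring_characteristic (residue_field ((cring_class_ops :: 'k ring)\<lparr>carrier := A\<rparr>))
             dvd Polynomial.degree f"
    and "unique_extension cring_class_ops v0 (quot_field f) (\<lambda>a. cls f [:a:]) v"
  shows "\<exists>n \<phi> V.
    inductive_values v0 n \<phi> (\<lambda>k. v (cls f (\<phi> k))) V \<and>
    \<phi> n = f \<and> (\<forall>k\<in>{1..n}. \<phi> k \<in> polys_over A) \<and>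
    (\<forall>g. V n g = v (cls f g)) \<and>
    (\<forall>i\<in>{1..<n}. Polynomial.degree (\<phi> i) dvd Polynomial.degree (\<phi> (Suc i))) \<and>
    (let K = (cring_class_ops :: 'k ring);
         L = quot_field f;
         B = quot_subring A f;
         m = (\<lambda>i. Polynomial.degree (\<phi> (Suc i)) div Polynomial.degree (\<phi> i));
         S = gr K v0 A;
         T = gr L v B;
         P = mpoly_ring S {1..<n};
         P_homog = mpoly_homog S {1..<n} (gr_homog K v0 A) (\<lambda>i. fin_part (v (cls f (\<phi> i))))
     in \<exists>c \<Phi>.
       (\<forall>i\<in>{1..<n}. \<forall>(j, k)\<in>relation_indices m i. \<exists>\<gamma>. c i j k \<in> gr_homog K v0 A \<gamma>) \<and>
       (\<forall>i\<in>{1..<n}. \<exists>\<delta>. relation S n m c i \<in> P_homog \<delta>) \<and>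
       \<Phi> \<in> ring_hom P T \<and>
       (\<forall>a\<in>carrier S. \<Phi> (mpoly_const S a) = gr_map K v0 L v B (\<lambda>b. cls f [:b:]) a) \<and>
       (\<forall>i\<in>{1..<n}. \<Phi> (mpoly_var S i) = initial_form L v B (cls f (\<phi> i))) \<and>
       (\<forall>\<delta>. \<Phi> ` P_homog \<delta> \<subseteq> gr_homog L v B \<delta>) \<and>
       \<Phi> ` carrier P = carrier T \<and>
       (let I = Idl\<^bsub>P\<^esub> (relation S n m c ` {1..<n});
            \<Psi> = (\<lambda>X. the_elem (\<Phi> ` X))
        in a_kernel P T \<Phi> = I \<and>
           \<Psi> \<in> ring_iso (P Quot I) T \<and>
           (\<forall>\<delta>. \<Psi> ` ((\<lambda>p. I +>\<^bsub>P\<^esub> p) ` P_homog \<delta>) = gr_homog L v B \<delta>)))"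
proof -
  have "f \<noteq> 0" using assms(5) by auto
  hence deg: "0 < degree f"
    using assms(6) by (metis gr0I irreducible_not_unit is_unit_iff_degree)
  have iv: "integral_val f (\<lambda>g. v (cls f g)) v0"
    by (rule unique_extension_integral_val[OF assms(2,8,5) deg])
  interpret tv: tame_val f "\<lambda>g. v (cls f g)" v0 A
  proof (intro tame_val.intro tame_val_axioms.intro iv)
    show "subring A (cring_class_ops :: 'k ring)" using assms(1) by (simp add: local_domain_of_def)
    show "\<And>a. a \<in> A \<Longrightarrow> 0 \<le> v0 a" using assms(3) by (auto simp: dominates_def)
    show "\<And>e. e dvd degree f \<Longrightarrow> (of_nat e :: 'k) \<noteq> 0 \<and> inverse (of_nat e) \<in> A"
      by (rule degree_divisor_unit[OF assms(1-3,7)])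
  qed (rule assms(4))
  from tv.key_sequence obtain n \<phi> where
    n\<phi>: "inductive_values v0 n \<phi> (\<lambda>k. v (cls f (\<phi> k))) (\<lambda>k. tv.trunc (\<phi> k))" "\<phi> n = f"
    "\<forall>k\<in>{1..n}. tv.abstract_key (\<phi> k) \<and> \<phi> k \<in> polys_over A"
    "\<forall>k\<in>{1..<n}. v (cls f (\<phi> k)) \<noteq> Infty \<and> tv.jump (\<phi> k) (\<phi> (Suc k))"
    by blast
  interpret gc: graded_chain f "\<lambda>g. v (cls f g)" v0 A n \<phi> v
    by standard
      (use n\<phi> assms(2,8) in \<open>auto simp: inductive_values_def unique_extension_def\<close>)
  define I where "I = Idl\<^bsub>gc.P\<^esub> (relation gc.gS n gc.m gc.rel_class ` {1..<n})"
  from gc.graded_structure[folded I_def] obtain \<Phi> where \<Phi>_all: "\<Phi> \<in> ring_hom gc.P gc.gT \<and>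
    (\<forall>a\<in>carrier gc.gS. \<Phi> (mpoly_const gc.gS a) =
       gr_map cring_class_ops v0 (quot_field f) v (quot_subring A f) (\<lambda>b. cls f [:b:]) a) \<and>
    (\<forall>i\<in>{1..<n}. \<Phi> (mpoly_var gc.gS i) = initial_form (quot_field f) v (quot_subring A f) (cls f (\<phi> i))) \<and>
    (\<forall>\<delta>. \<Phi> ` gc.PH \<delta> = gr_homog (quot_field f) v (quot_subring A f) \<delta>) \<and>
    \<Phi> ` carrier gc.P = carrier gc.gT \<and>
    a_kernel gc.P gc.gT \<Phi> = I" by (rule exE)
  note \<Phi> = \<Phi>_all[THEN conjunct1]
    \<Phi>_all[THEN conjunct2, THEN conjunct1]
    \<Phi>_all[THEN conjunct2, THEN conjunct2, THEN conjunct1]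
    \<Phi>_all[THEN conjunct2, THEN conjunct2, THEN conjunct2, THEN conjunct1]
    \<Phi>_all[THEN conjunct2, THEN conjunct2, THEN conjunct2, THEN conjunct2, THEN conjunct1]
    \<Phi>_all[THEN conjunct2, THEN conjunct2, THEN conjunct2, THEN conjunct2, THEN conjunct2]
  interpret \<Phi>: ring_hom_ring gc.P gc.gT \<Phi>
    by (rule ring_hom_ringI2[OF cring.axioms(1)[OF gc.M.mpoly_cring] cring.axioms(1)[OF gc.T.gr_cring] \<Phi>(1)])
  have m: "(\<lambda>i. degree (\<phi> (Suc i)) div degree (\<phi> i)) = gc.m"
    by (simp add: gc.m_def fun_eq_iff)
  have \<mu>: "(\<lambda>i. fin_part (v (cls f (\<phi> i)))) = gc.\<mu>" by (simp add: gc.\<mu>_def fun_eq_iff)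
  have 1: "\<exists>\<gamma>. gc.rel_class i j k \<in> gr_homog cring_class_ops v0 A \<gamma>" if "i \<in> {1..<n}" "(j, k) \<in> relation_indices gc.m i" for i j k
  proof -
    have "Fin (gc.mon_degree (gc.top_monomial i) - gc.mon_degree (gc.index_monomial i j k)) \<le> gc.S.\<omega> (gc.rel_coeff i (gc.index_monomial i j k))"
      using gc.rel_term_value[OF that(1) gc.index_monomial_box[OF that]] by simp
    from gc.S.single_homog[OF gc.rel_coeff(1)[OF that(1)] this] show ?thesis
      unfolding gc.rel_class_def gc.rel_term_def by blast
  qed
  have 2: "\<exists>\<delta>. relation gc.gS n gc.m gc.rel_class i \<in> gc.PH \<delta>" if "i \<in> {1..<n}" for i
    using gc.homog_lifts_homog[OF gc.lifted_rel_homog_lifts[OF that]] unfolding gc.H_lifted_rel[OF that] by blast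
  have iso: "(\<lambda>X. the_elem (\<Phi> ` X)) \<in> ring_iso (gc.P Quot I) gc.gT"
    using \<Phi>.FactRing_iso_set[OF \<Phi>(5)] unfolding \<Phi>(6) .
  have hom: "(\<lambda>X. the_elem (\<Phi> ` X)) ` ((\<lambda>p. I +>\<^bsub>gc.P\<^esub> p) ` gc.PH \<delta>) = gr_homog (quot_field f) v (quot_subring A f) \<delta>" for \<delta>
  proof -
    have "the_elem (\<Phi> ` (I +>\<^bsub>gc.P\<^esub> p)) = \<Phi> p" if "p \<in> gc.PH \<delta>" for p
      using \<Phi>.the_elem_simp[of p] that unfolding \<Phi>(6) by (simp add: mpoly_homog_def)
    hence "(\<lambda>X. the_elem (\<Phi> ` X)) ` ((\<lambda>p. I +>\<^bsub>gc.P\<^esub> p) ` gc.PH \<delta>) = \<Phi> ` gc.PH \<delta>"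
      unfolding image_image by (rule image_cong[OF refl])
    thus ?thesis using \<Phi>(4) by simp
  qed
  show ?thesis
    unfolding Let_def
  proof (intro exI[of _ n] exI[of _ \<phi>] exI[of _ "\<lambda>k. tv.trunc (\<phi> k)"] conjI)
    show "inductive_values v0 n \<phi> (\<lambda>k. v (cls f (\<phi> k))) (\<lambda>k. tv.trunc (\<phi> k))" by (rule n\<phi>(1))
    show "\<phi> n = f" by (rule n\<phi>(2))
    show "\<forall>k\<in>{1..n}. \<phi> k \<in> polys_over A" using n\<phi>(3) by blast
    show "\<forall>g. tv.trunc (\<phi> n) g = v (cls f g)" using tv.trunc_f n\<phi>(2) by simp
    show "\<forall>i\<in>{1..<n}. degree (\<phi> i) dvd degree (\<phi> (Suc i))" using gc.\<phi>_dvd by blast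
    show "\<exists>c \<Phi>. (\<forall>i\<in>{1..<n}. \<forall>(j, k)\<in>relation_indices (\<lambda>i. degree (\<phi> (Suc i)) div degree (\<phi> i)) i.
            \<exists>\<gamma>. c i j k \<in> gr_homog cring_class_ops v0 A \<gamma>) \<and>
       (\<forall>i\<in>{1..<n}. \<exists>\<delta>. relation gc.gS n (\<lambda>i. degree (\<phi> (Suc i)) div degree (\<phi> i)) c i
          \<in> mpoly_homog gc.gS {1..<n} (gr_homog cring_class_ops v0 A) (\<lambda>i. fin_part (v (cls f (\<phi> i)))) \<delta>) \<and>
       \<Phi> \<in> ring_hom gc.P gc.gT \<and>
       (\<forall>a\<in>carrier gc.gS. \<Phi> (mpoly_const gc.gS a) = gr_map cring_class_ops v0 (quot_field f) v (quot_subring A f) (\<lambda>b. cls f [:b:]) a) \<and>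
       (\<forall>i\<in>{1..<n}. \<Phi> (mpoly_var gc.gS i) = initial_form (quot_field f) v (quot_subring A f) (cls f (\<phi> i))) \<and>
       (\<forall>\<delta>. \<Phi> ` mpoly_homog gc.gS {1..<n} (gr_homog cring_class_ops v0 A) (\<lambda>i. fin_part (v (cls f (\<phi> i)))) \<delta>
          \<subseteq> gr_homog (quot_field f) v (quot_subring A f) \<delta>) \<and>
       \<Phi> ` carrier gc.P = carrier gc.gT \<and>
       a_kernel gc.P gc.gT \<Phi> = Idl\<^bsub>gc.P\<^esub> (relation gc.gS n (\<lambda>i. degree (\<phi> (Suc i)) div degree (\<phi> i)) c ` {1..<n}) \<and>
       (\<lambda>X. the_elem (\<Phi> ` X)) \<in> ring_iso (gc.P Quot Idl\<^bsub>gc.P\<^esub> (relation gc.gS n (\<lambda>i. degree (\<phi> (Suc i)) div degree (\<phi> i)) c ` {1..<n})) gc.gT \<and>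
       (\<forall>\<delta>. (\<lambda>X. the_elem (\<Phi> ` X)) ` ((\<lambda>p. Idl\<^bsub>gc.P\<^esub> (relation gc.gS n (\<lambda>i. degree (\<phi> (Suc i)) div degree (\<phi> i)) c ` {1..<n}) +>\<^bsub>gc.P\<^esub> p) `
          mpoly_homog gc.gS {1..<n} (gr_homog cring_class_ops v0 A) (\<lambda>i. fin_part (v (cls f (\<phi> i)))) \<delta>) =
          gr_homog (quot_field f) v (quot_subring A f) \<delta>)"
      unfolding m \<mu>
    proof (intro exI[of _ gc.rel_class] exI[of _ \<Phi>] conjI ballI allI, unfold I_def[symmetric])
    qed (use \<Phi> 1 2 iso hom in auto)
  qed
qed

end
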